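(* There exist a function $f\in C^2(\mathbb{T})$, a separable Hilbert space $\mathcal{H}$, a unitary operator $U\in B(\mathcal{H})$ and a self-adjoint operator $Z\in\mathcal{S}^2(\mathcal{H})$ such that $$ f(e^{iZ}U)-f(U)-\frac{d}{dt}\bigl(f(e^{itZ}U)\bigr)_{\vert t=0}\ \notin\ \mathcal{S}^1(\mathcal{H}). $$
   Context: $\mathbb{T}=\{z\in\mathbb{C}:|z|=1\}$, and $C^2(\mathbb{T})$ is the space of twice continuously differentiable functions $f\colon\mathbb{T}\to\mathbb{C}$. $B(\mathcal{H})$ is the algebra of bounded operators on the (complex) Hilbert space $\mathcal{H}$; $\mathcal{S}^2(\mathcal{H})$ and $\mathcal{S}^1(\mathcal{H})$ are the Hilbert-Schmidt and trace class operators on $\mathcal{H}$. For a unitary $V$, $f(V)$ is defined by the continuous functional calculus. For $f\in C^1(\mathbb{T})$, $U$ unitary and $Z\in\mathcal{S}^2(\mathcal{H})$ self-adjoint, it is known that $f(e^{itZ}U)-f(U)\in\mathcal{S}^2(\mathcal{H})$ for all $t\in\mathbb{R}$ and that $t\mapsto f(e^{itZ}U)-f(U)$ is differentiable from $\mathbb{R}$ into $\mathcal{S}^2(\mathcal{H})$; the symbol $\frac{d}{dt}\bigl(f(e^{itZ}U)\bigr)_{\vert t=0}$ denotes its derivative at $t=0$ (in $\mathcal{S}^2(\mathcal{H})$). *)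

theory Defs
  imports "HOL-Analysis.Analysis" "HOL-Algebra.Module"
begin

section \<open>Complex Hilbert spaces\<close>

definition complex_ring :: "complex ring" where
  "complex_ring = \<lparr>carrier = UNIV, mult = (*), one = 1, zero = 0, add = (+)\<rparr>"

text \<open>
  A complex Hilbert space is a module over the field of complex numbers with an inner product
  (linear in the first argument). As for every module record, the fields
  \<^const>\<open>mult\<close> and \<^const>\<open>one\<close> inherited from the ring record carry no meaning.
\<close>

record 'a hilbert = "(complex, 'a) module" +
  cinner :: "'a \<Rightarrow> 'a \<Rightarrow> complex"

definition hnorm :: "('a, 'm) hilbert_scheme \<Rightarrow> 'a \<Rightarrow> real" where
  "hnorm H x = sqrt (Re (cinner H x x))"

definition hdist :: "('a, 'm) hilbert_scheme \<Rightarrow> 'a \<Rightarrow> 'a \<Rightarrow> real" where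
  "hdist H x y = hnorm H (x \<ominus>\<^bsub>H\<^esub> y)"

locale hilbert_space = Module.module complex_ring H for H (structure) +
  assumes cinner_add_left:
      "\<lbrakk>x \<in> carrier H; y \<in> carrier H; z \<in> carrier H\<rbrakk>
        \<Longrightarrow> cinner H (x \<oplus> y) z = cinner H x z + cinner H y z"
    and cinner_smult_left:
      "\<lbrakk>x \<in> carrier H; y \<in> carrier H\<rbrakk> \<Longrightarrow> cinner H (c \<odot> x) y = c * cinner H x y"
    and cinner_commute:
      "\<lbrakk>x \<in> carrier H; y \<in> carrier H\<rbrakk> \<Longrightarrow> cinner H x y = cnj (cinner H y x)"
    and cinner_pos:
      "\<lbrakk>x \<in> carrier H; x \<noteq> \<zero>\<rbrakk> \<Longrightarrow> 0 < Re (cinner H x x)"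
    and complete:
      "Metric_space.mcomplete (carrier H) (hdist H)"

definition separable_hilbert :: "('a, 'm) hilbert_scheme \<Rightarrow> bool" where
  "separable_hilbert H \<longleftrightarrow> separable_space (Metric_space.mtopology (carrier H) (hdist H))"

definition orthonormal_basis :: "('a, 'm) hilbert_scheme \<Rightarrow> 'a set \<Rightarrow> bool" where
  "orthonormal_basis H E \<longleftrightarrow>
     E \<subseteq> carrier H \<and>
     (\<forall>e\<in>E. \<forall>e'\<in>E. cinner H e e' = (if e = e' then 1 else 0)) \<and>
     (\<forall>x\<in>carrier H. (\<forall>e\<in>E. cinner H x e = 0) \<longrightarrow> x = \<zero>\<^bsub>H\<^esub>)"


section \<open>Bounded operators\<close>

text \<open>
  Operators are extensional functions on the carrier, so that equality of operators is
  equality of functions.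
\<close>

definition bounded_ops :: "('a, 'm) hilbert_scheme \<Rightarrow> ('a \<Rightarrow> 'a) set" where
  "bounded_ops H = {A \<in> carrier H \<rightarrow>\<^sub>E carrier H.
     (\<forall>x\<in>carrier H. \<forall>y\<in>carrier H. A (x \<oplus>\<^bsub>H\<^esub> y) = A x \<oplus>\<^bsub>H\<^esub> A y) \<and>
     (\<forall>c. \<forall>x\<in>carrier H. A (c \<odot>\<^bsub>H\<^esub> x) = c \<odot>\<^bsub>H\<^esub> A x) \<and>
     (\<exists>K. \<forall>x\<in>carrier H. hnorm H (A x) \<le> K * hnorm H x)}"

definition op_id :: "('a, 'm) hilbert_scheme \<Rightarrow> 'a \<Rightarrow> 'a" where
  "op_id H = (\<lambda>x\<in>carrier H. x)"

definition op_add :: "('a, 'm) hilbert_scheme \<Rightarrow> ('a \<Rightarrow> 'a) \<Rightarrow> ('a \<Rightarrow> 'a) \<Rightarrow> 'a \<Rightarrow> 'a" where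
  "op_add H A B = (\<lambda>x\<in>carrier H. A x \<oplus>\<^bsub>H\<^esub> B x)"

definition op_diff :: "('a, 'm) hilbert_scheme \<Rightarrow> ('a \<Rightarrow> 'a) \<Rightarrow> ('a \<Rightarrow> 'a) \<Rightarrow> 'a \<Rightarrow> 'a" where
  "op_diff H A B = (\<lambda>x\<in>carrier H. A x \<ominus>\<^bsub>H\<^esub> B x)"

definition op_scale :: "('a, 'm) hilbert_scheme \<Rightarrow> complex \<Rightarrow> ('a \<Rightarrow> 'a) \<Rightarrow> 'a \<Rightarrow> 'a" where
  "op_scale H c A = (\<lambda>x\<in>carrier H. c \<odot>\<^bsub>H\<^esub> A x)"

definition op_comp :: "('a, 'm) hilbert_scheme \<Rightarrow> ('a \<Rightarrow> 'a) \<Rightarrow> ('a \<Rightarrow> 'a) \<Rightarrow> 'a \<Rightarrow> 'a" where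
  "op_comp H A B = compose (carrier H) A B"

definition op_norm :: "('a, 'm) hilbert_scheme \<Rightarrow> ('a \<Rightarrow> 'a) \<Rightarrow> real" where
  "op_norm H A = (SUP x\<in>{x \<in> carrier H. hnorm H x \<le> 1}. hnorm H (A x))"

definition op_adj :: "('a, 'm) hilbert_scheme \<Rightarrow> ('a \<Rightarrow> 'a) \<Rightarrow> 'a \<Rightarrow> 'a" where
  "op_adj H A = (THE B. B \<in> bounded_ops H \<and>
     (\<forall>x\<in>carrier H. \<forall>y\<in>carrier H. cinner H (A x) y = cinner H x (B y)))"

definition unitary_op :: "('a, 'm) hilbert_scheme \<Rightarrow> ('a \<Rightarrow> 'a) \<Rightarrow> bool" where
  "unitary_op H U \<longleftrightarrow> U \<in> bounded_ops H \<and>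
     op_comp H (op_adj H U) U = op_id H \<and> op_comp H U (op_adj H U) = op_id H"

definition self_adjoint_op :: "('a, 'm) hilbert_scheme \<Rightarrow> ('a \<Rightarrow> 'a) \<Rightarrow> bool" where
  "self_adjoint_op H A \<longleftrightarrow> A \<in> bounded_ops H \<and> op_adj H A = A"

definition positive_op :: "('a, 'm) hilbert_scheme \<Rightarrow> ('a \<Rightarrow> 'a) \<Rightarrow> bool" where
  "positive_op H A \<longleftrightarrow> self_adjoint_op H A \<and> (\<forall>x\<in>carrier H. 0 \<le> Re (cinner H (A x) x))"

text \<open>The exponential series, converging in operator norm.\<close>

definition op_exp :: "('a, 'm) hilbert_scheme \<Rightarrow> ('a \<Rightarrow> 'a) \<Rightarrow> 'a \<Rightarrow> 'a" where
  "op_exp H A = (THE B. B \<in> bounded_ops H \<and>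
     (\<lambda>N. op_norm H (op_diff H
        (\<lambda>x\<in>carrier H. \<Oplus>\<^bsub>H\<^esub>n\<in>{..<N}. (1 / fact n) \<odot>\<^bsub>H\<^esub> (A ^^ n) x) B)) \<longlonglongrightarrow> 0)"


section \<open>Hilbert-Schmidt and trace class operators\<close>

text \<open>
  Every Hilbert space has an orthonormal basis, and none of the sums below depends on the basis,
  so quantifying over all bases or picking one makes no difference.
\<close>

definition hilbert_schmidt :: "('a, 'm) hilbert_scheme \<Rightarrow> ('a \<Rightarrow> 'a) set" where
  "hilbert_schmidt H = {A \<in> bounded_ops H.
     \<forall>E. orthonormal_basis H E \<longrightarrow> (\<lambda>e. (hnorm H (A e))\<^sup>2) summable_on E}"

definition hs_norm :: "('a, 'm) hilbert_scheme \<Rightarrow> ('a \<Rightarrow> 'a) \<Rightarrow> real" where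
  "hs_norm H A = sqrt (\<Sum>\<^sub>\<infinity>e\<in>(SOME E. orthonormal_basis H E). (hnorm H (A e))\<^sup>2)"

definition is_op_abs :: "('a, 'm) hilbert_scheme \<Rightarrow> ('a \<Rightarrow> 'a) \<Rightarrow> ('a \<Rightarrow> 'a) \<Rightarrow> bool" where
  "is_op_abs H A P \<longleftrightarrow> positive_op H P \<and> op_comp H P P = op_comp H (op_adj H A) A"

definition trace_class :: "('a, 'm) hilbert_scheme \<Rightarrow> ('a \<Rightarrow> 'a) set" where
  "trace_class H = {A \<in> bounded_ops H. \<exists>P. is_op_abs H A P \<and>
     (\<forall>E. orthonormal_basis H E \<longrightarrow> (\<lambda>e. Re (cinner H (P e) e)) summable_on E)}"

text \<open>
  Derivative of a map into the space of Hilbert-Schmidt operators, with respect to the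
  Hilbert-Schmidt norm.
\<close>

definition has_hs_derivative ::
    "('a, 'm) hilbert_scheme \<Rightarrow> (real \<Rightarrow> 'a \<Rightarrow> 'a) \<Rightarrow> ('a \<Rightarrow> 'a) \<Rightarrow> real \<Rightarrow> bool" where
  "has_hs_derivative H G D s \<longleftrightarrow>
     (\<forall>t. G t \<in> hilbert_schmidt H) \<and> D \<in> hilbert_schmidt H \<and>
     ((\<lambda>t. hs_norm H (op_diff H (op_scale H (of_real (1 / (t - s))) (op_diff H (G t) (G s))) D))
        \<longlongrightarrow> 0) (at s)"


section \<open>Functions on the circle and functional calculus\<close>

abbreviation circle :: "complex set" where
  "circle \<equiv> sphere 0 1"

text \<open>
  The derivatives are taken along the circle: \<open>f'(z)\<close> is the limit of
  \<open>(f w - f z) / (w - z)\<close> as \<open>w\<close> tends to \<open>z\<close> within the circle.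
\<close>

definition C2_circle :: "(complex \<Rightarrow> complex) \<Rightarrow> bool" where
  "C2_circle f \<longleftrightarrow> (\<exists>f' f''.
     (\<forall>z\<in>circle. (f has_field_derivative f' z) (at z within circle)) \<and>
     (\<forall>z\<in>circle. (f' has_field_derivative f'' z) (at z within circle)) \<and>
     continuous_on circle f'')"

text \<open>
  The continuous functional calculus of a unitary \<open>V\<close>, composed with the restriction of functions
  from the circle to the spectrum of \<open>V\<close>: the contractive unital \<open>*\<close>-homomorphism on the algebra of
  continuous functions on the circle that maps the identity function to \<open>V\<close>. Contractivity forces
  the value at \<open>f\<close> to depend only on the values of \<open>f\<close> on the circle.
\<close>

definition is_functional_calculus ::
    "('a, 'm) hilbert_scheme \<Rightarrow> ('a \<Rightarrow> 'a) \<Rightarrow> ((complex \<Rightarrow> complex) \<Rightarrow> 'a \<Rightarrow> 'a) \<Rightarrow> bool" where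
  "is_functional_calculus H V \<Phi> \<longleftrightarrow>
     (\<forall>f. continuous_on circle f \<longrightarrow> \<Phi> f \<in> bounded_ops H) \<and>
     \<Phi> (\<lambda>z. 1) = op_id H \<and>
     \<Phi> (\<lambda>z. z) = V \<and>
     (\<forall>f g. continuous_on circle f \<longrightarrow> continuous_on circle g \<longrightarrow>
        \<Phi> (\<lambda>z. f z + g z) = op_add H (\<Phi> f) (\<Phi> g)) \<and>
     (\<forall>f g. continuous_on circle f \<longrightarrow> continuous_on circle g \<longrightarrow>
        \<Phi> (\<lambda>z. f z * g z) = op_comp H (\<Phi> f) (\<Phi> g)) \<and>
     (\<forall>c f. continuous_on circle f \<longrightarrow> \<Phi> (\<lambda>z. c * f z) = op_scale H c (\<Phi> f)) \<and>
     (\<forall>f. continuous_on circle f \<longrightarrow> \<Phi> (\<lambda>z. cnj (f z)) = op_adj H (\<Phi> f)) \<and>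
     (\<forall>f K. continuous_on circle f \<longrightarrow> (\<forall>z\<in>circle. cmod (f z) \<le> K) \<longrightarrow> op_norm H (\<Phi> f) \<le> K)"

definition cfc :: "('a, 'm) hilbert_scheme \<Rightarrow> (complex \<Rightarrow> complex) \<Rightarrow> ('a \<Rightarrow> 'a) \<Rightarrow> 'a \<Rightarrow> 'a" where
  "cfc H f V = (THE A. \<exists>\<Phi>. is_functional_calculus H V \<Phi> \<and> A = \<Phi> f)"

definition perturbed_unitary ::
    "('a, 'm) hilbert_scheme \<Rightarrow> ('a \<Rightarrow> 'a) \<Rightarrow> ('a \<Rightarrow> 'a) \<Rightarrow> real \<Rightarrow> 'a \<Rightarrow> 'a" where
  "perturbed_unitary H Z U t = op_comp H (op_exp H (op_scale H (\<i> * of_real t) Z)) U"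

end

theory Submission
  imports Defs "HOL-Real_Asymp.Real_Asymp"
begin

text \<open>
  Take \<open>U\<close> diagonal with eigenvalues \<open>\<lambda>\<^sub>k\<close>. If \<open>f z - f \<lambda>\<^sub>k = p\<^sub>k z (z - \<lambda>\<^sub>k)\<close> on the circle, then
  \<open>(f V - f U) e\<^sub>k = p\<^sub>k(V) (V - U) e\<^sub>k\<close> for every unitary \<open>V\<close>. This makes the Hilbert-Schmidt derivative
  a matter of dominated convergence over the columns, with \<open>p\<^sub>k\<close> bounded by the Lipschitz constant of
  \<open>f\<close>; a second divided difference gives the second order term. When \<open>Z\<close> couples one eigenvector
  of eigenvalue 1 to the others with amplitudes \<open>a\<^sub>j\<close>, the entries of that term are \<open>a\<^sub>j\<close> times the
  conjugate of \<open>a\<^sub>k\<close> times a second divided difference of \<open>f\<close> at \<open>\<lambda>\<^sub>j\<close>, \<open>1\<close>, \<open>\<lambda>\<^sub>k\<close>, up to lower terms.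

  Let \<open>f\<close> vanish on the lower half circle and behave near 1 like \<open>w(\<theta>) \<theta>\<^sup>2\<close> on the upper half, where
  \<open>w(\<theta>) = 1 / sqrt (ln (ln (3 + 1 / \<theta>)))\<close> tends to 0 so slowly that \<open>f\<close> is only just twice
  continuously differentiable. With eigenvalues alternating between the two halves and tending
  rapidly to 1, the \<open>N\<close>-point block becomes \<open>w\<close> times triangular truncation of a rank one matrix.
  Tested against Fourier vectors it has trace norm of order \<open>w N ln N\<close>, although the amplitudes only
  contribute \<open>N\<close> to the squared Hilbert-Schmidt norm of \<open>Z\<close>, and \<open>w\<close> still exceeds a multiple of
  \<open>1 / sqrt (ln N)\<close>. Repeating each block many times at a small scale keeps \<open>Z\<close> Hilbert-Schmidt, makes
  the second order term dominate, and lets the trace norms add up to infinity.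
\<close>

section \<open>The Hilbert space of square summable sequences\<close>

text \<open>The obstacle is uniformity. The trace norm of a block exceeds its Hilbert-Schmidt cost
  only by a factor of order \<open>sqrt (ln N)\<close>, so many blocks must act in a single
  \<open>Z\<close> whose norm is bounded but not small. Then \<open>exp (\<i> Z) U\<close> need not
  be close to \<open>U\<close> in norm. It is close on vectors of one block, and the functional
  calculus and the second order expansion are compared there, with thresholds independent of all
  other blocks. The ratio \<open>1 / N\<close> of successive spectral parameters balances two
  demands. It is small enough for the divided differences: an entrywise distance
  \<open>1 / N\<close> from the triangular matrix costs a bounded amount against the
  \<open>ln N\<close> of triangular truncation. It is large enough for the weight: the smallest
  parameter is \<open>N\<close> to the power \<open>- 2 N\<close>, and the double logarithm of its
  inverse is still of order \<open>ln N\<close>. Vectors and operators get types of their own, which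
  carry the algebra and the limits. The Hilbert space record is reached only at the end, where every
  bounded operator of the record is shown to come from \<open>bop\<close>.\<close>

typedef ell2 = "{x :: nat \<Rightarrow> complex. summable (\<lambda>n. (cmod (x n))\<^sup>2)}"
  morphisms coord Abs_ell2
  by (intro exI[of _ "\<lambda>_. 0"]) simp

setup_lifting type_definition_ell2

lemma summable_coord: "summable (\<lambda>n. (cmod (coord x n))\<^sup>2)"
  using coord[of x] by simp

lemma cmod_add_square_le: "(cmod (a + b))\<^sup>2 \<le> 2 * (cmod a)\<^sup>2 + 2 * (cmod b)\<^sup>2"
proof -
  have "(cmod (a + b))\<^sup>2 \<le> (cmod a + cmod b)\<^sup>2"
    by (intro power_mono norm_triangle_ineq) auto
  also have "\<dots> \<le> 2 * (cmod a)\<^sup>2 + 2 * (cmod b)\<^sup>2"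
    using zero_le_power2[of "cmod a - cmod b"] by (simp add: power2_eq_square algebra_simps)
  finally show ?thesis .
qed

lemma square_summable_add:
  assumes "summable (\<lambda>n. (cmod (x n))\<^sup>2)" "summable (\<lambda>n. (cmod (y n))\<^sup>2)"
  shows "summable (\<lambda>n. (cmod (x n + y n))\<^sup>2)"
proof (rule summable_comparison_test')
  show "summable (\<lambda>n. 2 * (cmod (x n))\<^sup>2 + 2 * (cmod (y n))\<^sup>2)"
    by (intro summable_add summable_mult assms)
  show "norm ((cmod (x n + y n))\<^sup>2) \<le> 2 * (cmod (x n))\<^sup>2 + 2 * (cmod (y n))\<^sup>2" for n
    using cmod_add_square_le[of "x n" "y n"] by simp
qed

lemma square_summable_mult:
  assumes "summable (\<lambda>n. (cmod (x n))\<^sup>2)" "\<And>n. cmod (c n) \<le> K"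
  shows "summable (\<lambda>n. (cmod (c n * x n))\<^sup>2)"
proof (rule summable_comparison_test')
  show "summable (\<lambda>n. K\<^sup>2 * (cmod (x n))\<^sup>2)"
    by (intro summable_mult assms)
  show "norm ((cmod (c n * x n))\<^sup>2) \<le> K\<^sup>2 * (cmod (x n))\<^sup>2" for n
    using assms(2)[of n] by (simp add: norm_mult power_mult_distrib mult_right_mono power_mono)
qed

instantiation ell2 :: real_vector
begin

lift_definition zero_ell2 :: ell2 is "\<lambda>_. 0" by simp

lift_definition plus_ell2 :: "ell2 \<Rightarrow> ell2 \<Rightarrow> ell2" is "\<lambda>x y n. x n + y n"
  by (rule square_summable_add)

lift_definition uminus_ell2 :: "ell2 \<Rightarrow> ell2" is "\<lambda>x n. - x n"
  by simp

lift_definition minus_ell2 :: "ell2 \<Rightarrow> ell2 \<Rightarrow> ell2" is "\<lambda>x y n. x n - y n"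
  using square_summable_add[of _ "\<lambda>n. - y n" for y] by simp

lift_definition scaleR_ell2 :: "real \<Rightarrow> ell2 \<Rightarrow> ell2" is "\<lambda>r x n. of_real r * x n"
  by (rule square_summable_mult) auto

instance
  by standard (transfer; auto simp: algebra_simps fun_eq_iff)+

end

lift_definition scaleC :: "complex \<Rightarrow> ell2 \<Rightarrow> ell2" (infixr "*\<^sub>C" 75) is "\<lambda>c x n. c * x n"
  by (rule square_summable_mult) auto

lemma ell2_eqI: "(\<And>n. coord x n = coord y n) \<Longrightarrow> x = y"
  by (simp add: coord_inject[symmetric] fun_eq_iff)

lemma coord_simps [simp]:
  "coord 0 n = 0" "coord (x + y) n = coord x n + coord y n" "coord (x - y) n = coord x n - coord y n"
  "coord (- x) n = - coord x n" "coord (r *\<^sub>R x) n = of_real r * coord x n"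
  "coord (c *\<^sub>C x) n = c * coord x n"
  by (transfer; simp)+

lemma coord_sum [simp]: "coord (\<Sum>i\<in>A. f i) n = (\<Sum>i\<in>A. coord (f i) n)"
  by (induction A rule: infinite_finite_induct) auto

lemma scaleC_simps [simp]:
  "0 *\<^sub>C x = 0" "1 *\<^sub>C x = x" "c *\<^sub>C (0::ell2) = 0" "a *\<^sub>C (b *\<^sub>C x) = (a * b) *\<^sub>C x"
  by (rule ell2_eqI; simp)+

lemma scaleC_add_right: "c *\<^sub>C (x + y) = c *\<^sub>C x + c *\<^sub>C y"
  and scaleC_diff_right: "c *\<^sub>C (x - y) = c *\<^sub>C x - c *\<^sub>C y"
  and scaleC_add_left: "(a + b) *\<^sub>C x = a *\<^sub>C x + b *\<^sub>C x"
  and scaleC_diff_left: "(a - b) *\<^sub>C x = a *\<^sub>C x - b *\<^sub>C x"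
  and scaleC_minus_right: "c *\<^sub>C (- x) = - (c *\<^sub>C x)"
  and scaleC_minus_left: "(- c) *\<^sub>C x = - (c *\<^sub>C x)"
  and scaleC_scaleR: "c *\<^sub>C (r *\<^sub>R x) = r *\<^sub>R (c *\<^sub>C x)"
  and scaleR_scaleC: "r *\<^sub>R x = of_real r *\<^sub>C x"
  by (rule ell2_eqI; simp add: algebra_simps)+

lemma mult_cnj_cmod: "z * cnj z = (of_real (cmod z))\<^sup>2" "cnj z * z = (of_real (cmod z))\<^sup>2"
  using complex_norm_square[of z] by (simp_all add: mult.commute)

definition ip :: "ell2 \<Rightarrow> ell2 \<Rightarrow> complex" where
  "ip x y = (\<Sum>n. coord x n * cnj (coord y n))"

lemma cmod_mult_le: "cmod (a * b) \<le> ((cmod a)\<^sup>2 + (cmod b)\<^sup>2) / 2"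
  using zero_le_power2[of "cmod a - cmod b"] by (simp add: norm_mult power2_eq_square algebra_simps)

lemma summable_ip_norm: "summable (\<lambda>n. cmod (coord x n * cnj (coord y n)))"
proof (rule summable_comparison_test')
  show "summable (\<lambda>n. ((cmod (coord x n))\<^sup>2 + (cmod (coord y n))\<^sup>2) / 2)"
    by (intro summable_divide summable_add summable_coord)
  show "norm (cmod (coord x n * cnj (coord y n))) \<le> ((cmod (coord x n))\<^sup>2 + (cmod (coord y n))\<^sup>2) / 2" for n
    using cmod_mult_le[of "coord x n" "cnj (coord y n)"] by simp
qed

lemma summable_ip: "summable (\<lambda>n. coord x n * cnj (coord y n))"
  by (rule summable_norm_cancel[OF summable_ip_norm])

lemma ip_add_left: "ip (x + y) z = ip x z + ip y z"
  unfolding ip_def by (simp add: suminf_add[OF summable_ip summable_ip] distrib_right)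

lemma ip_scaleC_left: "ip (c *\<^sub>C x) y = c * ip x y"
  unfolding ip_def by (simp add: suminf_mult[OF summable_ip, symmetric] mult.assoc)

lemma ip_commute: "ip x y = cnj (ip y x)"
proof -
  have "(\<lambda>n. cnj (coord y n * cnj (coord x n))) sums cnj (ip y x)"
    unfolding ip_def by (intro sums_cnj[THEN iffD2] summable_sums summable_ip)
  then show ?thesis
    unfolding ip_def by (simp add: sums_iff mult.commute)
qed

lemma ip_minus_left: "ip (- x) y = - ip x y"
  using ip_scaleC_left[of "-1" x y] by (simp add: scaleC_minus_left)

lemma ip_diff_left: "ip (x - y) z = ip x z - ip y z"
  using ip_add_left[of x "- y" z] by (simp add: ip_minus_left)

lemma ip_zero_left [simp]: "ip 0 y = 0"
  by (simp add: ip_def)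

lemma ip_add_right: "ip x (y + z) = ip x y + ip x z"
  by (metis ip_commute ip_add_left complex_cnj_add)

lemma ip_diff_right: "ip x (y - z) = ip x y - ip x z"
  by (metis ip_commute ip_diff_left complex_cnj_diff)

lemma ip_minus_right: "ip x (- y) = - ip x y"
  by (metis ip_commute ip_minus_left complex_cnj_minus)

lemma ip_scaleC_right: "ip x (c *\<^sub>C y) = cnj c * ip x y"
  by (metis ip_commute ip_scaleC_left complex_cnj_mult)

lemma ip_zero_right [simp]: "ip x 0 = 0"
  by (simp add: ip_def)

lemma ip_sum_left: "ip (\<Sum>i\<in>A. f i) y = (\<Sum>i\<in>A. ip (f i) y)"
  by (induction A rule: infinite_finite_induct) (auto simp: ip_add_left)

lemma ip_sum_right: "ip x (\<Sum>i\<in>A. f i) = (\<Sum>i\<in>A. ip x (f i))"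
  by (induction A rule: infinite_finite_induct) (auto simp: ip_add_right)

lemma ip_self_sums: "(\<lambda>n. (cmod (coord x n))\<^sup>2) sums Re (ip x x)"
proof -
  have "(\<lambda>n. Re (coord x n * cnj (coord x n))) sums Re (ip x x)"
    unfolding ip_def by (intro sums_Re summable_sums summable_ip)
  then show ?thesis by (simp only: complex_mult_cnj cmod_power2 Re_complex_of_real)
qed

lemma Im_ip_self [simp]: "Im (ip x x) = 0"
  using ip_commute[of x x] by (metis Im_complex_of_real Reals_cases Reals_cnj_iff)

instantiation ell2 :: real_inner
begin

definition inner_ell2 :: "ell2 \<Rightarrow> ell2 \<Rightarrow> real" where "inner_ell2 x y = Re (ip x y)"
definition norm_ell2 :: "ell2 \<Rightarrow> real" where "norm_ell2 x = sqrt (inner x x)"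
definition dist_ell2 :: "ell2 \<Rightarrow> ell2 \<Rightarrow> real" where "dist_ell2 x y = norm (x - y)"
definition sgn_ell2 :: "ell2 \<Rightarrow> ell2" where "sgn_ell2 x = inverse (norm x) *\<^sub>R x"
definition uniformity_ell2 :: "(ell2 \<times> ell2) filter" where
  "uniformity_ell2 = (INF e\<in>{0<..}. principal {(x, y). dist x y < e})"
definition open_ell2 :: "ell2 set \<Rightarrow> bool" where
  "open_ell2 U = (\<forall>x\<in>U. \<forall>\<^sub>F (x', y) in uniformity. x' = x \<longrightarrow> y \<in> U)"

instance
proof
  fix x y z :: ell2 and r :: real
  show "inner x y = inner y x"
    using ip_commute[of x y] by (simp add: inner_ell2_def)
  show "inner (x + y) z = inner x z + inner y z"
    by (simp add: inner_ell2_def ip_add_left)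
  show "inner (r *\<^sub>R x) y = r * inner x y"
    by (simp add: inner_ell2_def scaleR_scaleC ip_scaleC_left)
  show "0 \<le> inner x x"
    unfolding inner_ell2_def using sums_le[OF _ sums_zero ip_self_sums[of x]] by simp
  show "inner x x = 0 \<longleftrightarrow> x = 0"
  proof
    assume *: "inner x x = 0"
    have "(cmod (coord x n))\<^sup>2 = 0" for n
    proof -
      have "\<forall>n. (cmod (coord x n))\<^sup>2 = 0"
        using suminf_eq_zero_iff[OF summable_coord[of x]] ip_self_sums[of x] *
        by (simp add: inner_ell2_def sums_iff)
      then show ?thesis by blast
    qed
    then show "x = 0" by (intro ell2_eqI) auto
  qed (simp add: inner_ell2_def)
  show "norm x = sqrt (inner x x)" by (rule norm_ell2_def)
qed (simp_all add: dist_ell2_def sgn_ell2_def uniformity_ell2_def open_ell2_def)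

end

lemma ip_self: "ip x x = of_real ((norm x)\<^sup>2)"
  by (simp add: complex_eq_iff power2_norm_eq_inner inner_ell2_def)

lemma norm_sums: "(\<lambda>n. (cmod (coord x n))\<^sup>2) sums (norm x)\<^sup>2"
  using ip_self_sums[of x] by (simp add: power2_norm_eq_inner inner_ell2_def)

lemma norm_scaleC [simp]: "norm (c *\<^sub>C x) = cmod c * norm x"
proof -
  have "complex_of_real ((norm (c *\<^sub>C x))\<^sup>2) = of_real ((cmod c * norm x)\<^sup>2)"
    unfolding ip_self[symmetric] ip_scaleC_left ip_scaleC_right
    by (simp add: ip_self power_mult_distrib mult_cnj_cmod)
  then have "(norm (c *\<^sub>C x))\<^sup>2 = (cmod c * norm x)\<^sup>2" by (simp only: of_real_eq_iff)
  then show ?thesis by (simp add: power2_eq_iff_nonneg)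
qed

lemma cmod_ip_le: "cmod (ip x y) \<le> norm x * norm y"
proof (cases "ip x y = 0")
  case False
  \<comment> \<open>A unimodular factor makes the inner product real, so that Cauchy-Schwarz for the
    real inner product \<open>Re (ip x y)\<close> applies.\<close>
  define c where "c = cnj (sgn (ip x y))"
  have c: "cmod c = 1" using False by (simp add: c_def norm_sgn)
  have "c * ip x y = of_real (cmod (ip x y))"
    using False unfolding c_def sgn_eq by (simp add: complex_norm_square[symmetric] power2_eq_square mult.commute)
  then have "cmod (ip x y) = inner (c *\<^sub>C x) y"
    by (simp add: inner_ell2_def ip_scaleC_left)
  also have "\<dots> \<le> norm (c *\<^sub>C x) * norm y" by (rule norm_cauchy_schwarz)
  finally show ?thesis using c by simp
qed simp

lemma sum_coord_le: "finite F \<Longrightarrow> (\<Sum>n\<in>F. (cmod (coord x n))\<^sup>2) \<le> (norm x)\<^sup>2"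
  using sum_le_suminf[OF summable_coord[of x], of F] norm_sums[of x] by (simp add: sums_iff)

lemma cmod_coord_le: "cmod (coord x n) \<le> norm x"
  using sum_coord_le[of "{n}" x] by (simp add: power2_le_iff_abs_le)

instance ell2 :: complete_space
proof
  fix X :: "nat \<Rightarrow> ell2"
  assume X: "Cauchy X"
  have "Cauchy (\<lambda>k. coord (X k) n)" for n
    unfolding Cauchy_def
  proof (intro allI impI)
    fix e :: real assume "e > 0"
    then obtain M where M: "\<forall>m\<ge>M. \<forall>k\<ge>M. dist (X m) (X k) < e"
      using X unfolding Cauchy_def by blast
    have "dist (coord (X m) n) (coord (X k) n) < e" if "m \<ge> M" "k \<ge> M" for m k
    proof -
      have "dist (coord (X m) n) (coord (X k) n) \<le> dist (X m) (X k)"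
        using cmod_coord_le[of "X m - X k" n] by (simp add: dist_norm)
      also have "\<dots> < e" using M that by blast
      finally show ?thesis .
    qed
    then show "\<exists>M. \<forall>m\<ge>M. \<forall>k\<ge>M. dist (coord (X m) n) (coord (X k) n) < e" by blast
  qed
  then have "\<exists>l. (\<lambda>k. coord (X k) n) \<longlonglongrightarrow> l" for n
    by (simp add: Cauchy_convergent_iff convergent_def)
  then obtain L where L: "\<And>n. (\<lambda>k. coord (X k) n) \<longlonglongrightarrow> L n" by metis
  \<comment> \<open>Letting \<open>m\<close> tend to infinity is possible on finitely many
    coordinates at a time; the bound does not depend on \<open>N\<close> and so survives summation
    over all of them.\<close>
  have bound: "(\<Sum>n<N. (cmod (coord (X k) n - L n))\<^sup>2) \<le> e\<^sup>2"
    if M: "\<forall>m\<ge>M. \<forall>k\<ge>M. dist (X m) (X k) < e" and k: "k \<ge> M" for M e k N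
  proof (rule tendsto_upperbound[where F = sequentially])
    show "(\<lambda>m. \<Sum>n<N. (cmod (coord (X k) n - coord (X m) n))\<^sup>2)
        \<longlonglongrightarrow> (\<Sum>n<N. (cmod (coord (X k) n - L n))\<^sup>2)"
      by (intro tendsto_intros L)
    have "(\<Sum>n<N. (cmod (coord (X k) n - coord (X m) n))\<^sup>2) \<le> e\<^sup>2" if "m \<ge> M" for m
    proof -
      have "(\<Sum>n<N. (cmod (coord (X k) n - coord (X m) n))\<^sup>2) \<le> (norm (X k - X m))\<^sup>2"
        using sum_coord_le[of "{..<N}" "X k - X m"] by simp
      also have "\<dots> \<le> e\<^sup>2"
        using M k that by (intro power_mono) (auto simp: dist_norm intro: less_imp_le)
      finally show ?thesis .
    qed
    then show "\<forall>\<^sub>F m in sequentially. (\<Sum>n<N. (cmod (coord (X k) n - coord (X m) n))\<^sup>2) \<le> e\<^sup>2"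
      by (auto simp: eventually_at_top_linorder)
  qed simp
  have diff: "summable (\<lambda>n. (cmod (coord (X k) n - L n))\<^sup>2) \<and> (\<Sum>n. (cmod (coord (X k) n - L n))\<^sup>2) \<le> e\<^sup>2"
    if "\<forall>m\<ge>M. \<forall>k\<ge>M. dist (X m) (X k) < e" "k \<ge> M" for M e k
  proof -
    have "summable (\<lambda>n. (cmod (coord (X k) n - L n))\<^sup>2)"
      by (rule summableI_nonneg_bounded[of _ "e\<^sup>2"]) (auto intro: bound[OF that])
    moreover from this have "(\<Sum>n. (cmod (coord (X k) n - L n))\<^sup>2) \<le> e\<^sup>2"
      by (rule suminf_le_const) (rule bound[OF that])
    ultimately show ?thesis by blast
  qed
  have "summable (\<lambda>n. (cmod (L n))\<^sup>2)"
  proof -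
    obtain M where M: "\<forall>m\<ge>M. \<forall>k\<ge>M. dist (X m) (X k) < 1"
      using X unfolding Cauchy_def by (metis zero_less_one)
    have "summable (\<lambda>n. (cmod (- (coord (X M) n - L n)))\<^sup>2)"
      using diff[OF M, of M] unfolding norm_minus_cancel by simp
    from square_summable_add[OF summable_coord[of "X M"] this] show ?thesis by simp
  qed
  then have cL: "coord (Abs_ell2 L) = L"
    by (simp add: Abs_ell2_inverse)
  have "X \<longlonglongrightarrow> Abs_ell2 L"
    unfolding lim_sequentially
  proof (intro allI impI)
    fix e :: real assume "e > 0"
    then have "e / 2 > 0" by simp
    then obtain M where M: "\<forall>m\<ge>M. \<forall>k\<ge>M. dist (X m) (X k) < e / 2"
      using X unfolding Cauchy_def by blast
    have "dist (X k) (Abs_ell2 L) < e" if "k \<ge> M" for k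
    proof -
      have "(norm (X k - Abs_ell2 L))\<^sup>2 \<le> (e / 2)\<^sup>2"
        using diff[OF M that] norm_sums[of "X k - Abs_ell2 L"] by (simp add: sums_iff cL)
      then have "norm (X k - Abs_ell2 L) \<le> e / 2"
        using \<open>e > 0\<close> by (simp add: power2_le_iff_abs_le)
      then show ?thesis using \<open>e > 0\<close> by (simp add: dist_norm)
    qed
    then show "\<exists>M. \<forall>k\<ge>M. dist (X k) (Abs_ell2 L) < e" by blast
  qed
  then show "convergent X" by (auto simp: convergent_def)
qed

instance ell2 :: banach ..

section \<open>Coordinate vectors and orthonormal families\<close>

definition basis_vec :: "nat \<Rightarrow> ell2" where
  "basis_vec k = Abs_ell2 (\<lambda>n. if n = k then 1 else 0)"

lemma coord_basis_vec [simp]: "coord (basis_vec k) n = (if n = k then 1 else 0)"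
proof -
  have "summable (\<lambda>n. (cmod (if n = k then 1 else 0))\<^sup>2)"
    by (rule summable_finite[of "{k}"]) auto
  then show ?thesis unfolding basis_vec_def by (simp add: Abs_ell2_inverse)
qed

lemma ip_basis_right [simp]: "ip x (basis_vec k) = coord x k"
proof -
  have "(\<lambda>n. coord x n * cnj (coord (basis_vec k) n)) sums (\<Sum>n\<in>{k}. coord x n * cnj (coord (basis_vec k) n))"
    by (rule sums_finite) auto
  then show ?thesis by (simp add: ip_def sums_iff)
qed

lemma ip_basis_left [simp]: "ip (basis_vec k) x = cnj (coord x k)"
  by (subst ip_commute) simp

lemma norm_basis_vec [simp]: "norm (basis_vec k) = 1"
proof -
  have "complex_of_real ((norm (basis_vec k))\<^sup>2) = 1" unfolding ip_self[symmetric] by simp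
  then have "(norm (basis_vec k))\<^sup>2 = 1" by (simp only: of_real_eq_1_iff)
  then show ?thesis by (metis norm_ge_zero power2_eq_1_iff neg_0_le_iff_le not_one_le_zero)
qed

lemma coord_expansion: "(\<lambda>k. coord x k *\<^sub>C basis_vec k) sums x"
  unfolding sums_def tendsto_iff
proof (intro allI impI)
  fix e :: real assume e: "e > 0"
  have "(\<lambda>N. (norm x)\<^sup>2 - (\<Sum>n<N. (cmod (coord x n))\<^sup>2)) \<longlonglongrightarrow> (norm x)\<^sup>2 - (norm x)\<^sup>2"
    using norm_sums[of x] unfolding sums_def by (intro tendsto_intros)
  then have "\<forall>\<^sub>F N in sequentially. (norm x)\<^sup>2 - (\<Sum>n<N. (cmod (coord x n))\<^sup>2) < e\<^sup>2"
    using e by (auto dest!: order_tendstoD(2)[where a = "e\<^sup>2"])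
  then show "\<forall>\<^sub>F N in sequentially. dist (\<Sum>k<N. coord x k *\<^sub>C basis_vec k) x < e"
  proof eventually_elim
    case (elim N)
    \<comment> \<open>The remainder keeps the coordinates from \<open>N\<close> on; its squared norm
      is the tail of a convergent series.\<close>
    define y where "y = x - (\<Sum>k<N. coord x k *\<^sub>C basis_vec k)"
    have y: "coord y n = (if n < N then 0 else coord x n)" for n
      by (simp add: y_def if_distrib[of "(*) _"] sum.delta' cong: if_cong)
    have "(\<lambda>n. (cmod (coord x n))\<^sup>2 - (if n < N then (cmod (coord x n))\<^sup>2 else 0)) sums
        ((norm x)\<^sup>2 - (\<Sum>n<N. (cmod (coord x n))\<^sup>2))"
    proof (intro sums_diff norm_sums)
      show "(\<lambda>n. if n < N then (cmod (coord x n))\<^sup>2 else 0) sums (\<Sum>n<N. (cmod (coord x n))\<^sup>2)"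
        using sums_If_finite_set[of "{..<N}" "\<lambda>n. (cmod (coord x n))\<^sup>2"] by simp
    qed
    moreover have "(\<lambda>n. (cmod (coord x n))\<^sup>2 - (if n < N then (cmod (coord x n))\<^sup>2 else 0)) =
        (\<lambda>n. (cmod (coord y n))\<^sup>2)"
      by (auto simp: y)
    ultimately have "(norm y)\<^sup>2 = (norm x)\<^sup>2 - (\<Sum>n<N. (cmod (coord x n))\<^sup>2)"
      using norm_sums[of y] by (simp add: sums_iff)
    with elim have "(norm y)\<^sup>2 < e\<^sup>2" by simp
    then have "norm y < e" using e by (simp add: power2_less_imp_less)
    then show ?case by (simp add: y_def dist_norm norm_minus_commute)
  qed
qed

text \<open>Expand \<open>|x - p|^2 \<ge> 0\<close> for the projection \<open>p\<close> of
  \<open>x\<close> onto the span. The vectors form a family \<open>v\<close> over an arbitrary index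
  type, because Fourier vectors indexed by triples are inserted later.\<close>

lemma orthonormal_Bessel:
  assumes "finite F" and on: "\<And>e e'. e \<in> F \<Longrightarrow> e' \<in> F \<Longrightarrow> ip (v e) (v e') = (if e = e' then 1 else 0)"
  shows "(\<Sum>e\<in>F. (cmod (ip x (v e)))\<^sup>2) \<le> (norm x)\<^sup>2"
proof -
  define p where "p = (\<Sum>e\<in>F. ip x (v e) *\<^sub>C v e)"
  define S where "S = (\<Sum>e\<in>F. (cmod (ip x (v e)))\<^sup>2)"
  have xp: "ip x p = of_real S"
    by (simp add: p_def S_def ip_sum_right ip_scaleC_right mult_cnj_cmod)
  have "ip (v e) p = cnj (ip x (v e))" if "e \<in> F" for e
  proof -
    have "ip (v e) p = (\<Sum>e'\<in>F. if e = e' then cnj (ip x (v e')) else 0)"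
      unfolding p_def ip_sum_right ip_scaleC_right by (intro sum.cong refl) (use on that in auto)
    then show ?thesis using that \<open>finite F\<close> by simp
  qed
  then have "ip p p = of_real S"
    by (subst (1) p_def) (simp add: S_def ip_sum_left ip_scaleC_left mult_cnj_cmod)
  moreover have "ip p x = of_real S" using xp by (subst ip_commute) simp
  ultimately have "ip (x - p) (x - p) = ip x x - of_real S"
    using xp by (simp add: ip_diff_left ip_diff_right)
  then have "ip (x - p) (x - p) = of_real ((norm x)\<^sup>2 - S)" by (simp add: ip_self)
  then have "(norm (x - p))\<^sup>2 = (norm x)\<^sup>2 - S" unfolding ip_self of_real_eq_iff .
  then show ?thesis using zero_le_power2[of "norm (x - p)"] by (simp add: S_def)
qed

section \<open>Bounded operators on the sequence space\<close>

text \<open>\<open>ell2 \<Rightarrow>\<^sub>L ell2\<close> consists of real linear maps; complex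
  linearity cuts out a closed subalgebra. As a type of its own it is a real Banach algebra, which
  makes \<open>exp\<close>, geometric sums and operator norm limits available.\<close>

typedef bop = "{A :: ell2 \<Rightarrow>\<^sub>L ell2. \<forall>c x. blinfun_apply A (c *\<^sub>C x) = c *\<^sub>C blinfun_apply A x}"
  morphisms blinfun_of_bop Abs_bop
  by (intro exI[of _ 0]) simp

lifting_forget ell2.lifting
setup_lifting type_definition_bop

lift_definition app :: "bop \<Rightarrow> ell2 \<Rightarrow> ell2" (infixr "\<cdot>" 68) is blinfun_apply .

lemma bop_eqI: "(\<And>x. A \<cdot> x = B \<cdot> x) \<Longrightarrow> A = B"
  by transfer (rule blinfun_eqI)

instantiation bop :: real_normed_algebra_1
begin

lift_definition zero_bop :: bop is 0 by simp
lift_definition one_bop :: bop is id_blinfun by simp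
lift_definition plus_bop :: "bop \<Rightarrow> bop \<Rightarrow> bop" is "(+)"
  by (simp add: blinfun.add_left scaleC_add_right)
lift_definition minus_bop :: "bop \<Rightarrow> bop \<Rightarrow> bop" is "(-)"
  by (simp add: blinfun.diff_left scaleC_diff_right)
lift_definition uminus_bop :: "bop \<Rightarrow> bop" is uminus
  by (simp add: blinfun.minus_left scaleC_minus_right)
lift_definition times_bop :: "bop \<Rightarrow> bop \<Rightarrow> bop" is "(o\<^sub>L)"
  by simp
lift_definition scaleR_bop :: "real \<Rightarrow> bop \<Rightarrow> bop" is "(*\<^sub>R)"
  by (simp add: blinfun.scaleR_left scaleC_scaleR)
lift_definition norm_bop :: "bop \<Rightarrow> real" is norm .

definition dist_bop :: "bop \<Rightarrow> bop \<Rightarrow> real" where "dist_bop x y = norm (x - y)"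
definition sgn_bop :: "bop \<Rightarrow> bop" where "sgn_bop x = inverse (norm x) *\<^sub>R x"
definition uniformity_bop :: "(bop \<times> bop) filter" where
  "uniformity_bop = (INF e\<in>{0<..}. principal {(x, y). dist x y < e})"
definition open_bop :: "bop set \<Rightarrow> bool" where
  "open_bop U = (\<forall>x\<in>U. \<forall>\<^sub>F (x', y) in uniformity. x' = x \<longrightarrow> y \<in> U)"

instance
proof
  fix A B C :: bop and r s :: real
  show "A + B + C = A + (B + C)" "A + B = B + A" "0 + A = A" "- A + A = 0" "A - B = A + - B"
    by (transfer; simp)+
  show "r *\<^sub>R (A + B) = r *\<^sub>R A + r *\<^sub>R B" "(r + s) *\<^sub>R A = r *\<^sub>R A + s *\<^sub>R A"
    "r *\<^sub>R s *\<^sub>R A = (r * s) *\<^sub>R A" "1 *\<^sub>R A = A"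
    by (transfer; simp add: scaleR_add_right scaleR_add_left)+
  show "A * B * C = A * (B * C)" by transfer (auto intro!: blinfun_eqI)
  show "(A + B) * C = A * C + B * C"
    by transfer (auto intro!: blinfun_eqI simp: blinfun.add_left)
  show "A * (B + C) = A * B + A * C"
    by transfer (auto intro!: blinfun_eqI simp: blinfun.add_left blinfun.add_right)
  show "r *\<^sub>R A * B = r *\<^sub>R (A * B)"
    by transfer (auto intro!: blinfun_eqI simp: blinfun.scaleR_left)
  show "A * r *\<^sub>R B = r *\<^sub>R (A * B)"
    by transfer (auto intro!: blinfun_eqI simp: blinfun.scaleR_left blinfun.scaleR_right)
  show "1 * A = A" "A * 1 = A"
    by (transfer; auto intro!: blinfun_eqI)+
  show "dist A B = norm (A - B)" "sgn A = inverse (norm A) *\<^sub>R A"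
    by (simp_all add: dist_bop_def sgn_bop_def)
  show "norm A = 0 \<longleftrightarrow> A = 0" "norm (r *\<^sub>R A) = \<bar>r\<bar> * norm A"
    by (transfer; simp)+
  show "norm (A + B) \<le> norm A + norm B" by transfer (rule norm_triangle_ineq)
  show "norm (A * B) \<le> norm A * norm B" by transfer (rule norm_blinfun_compose)
  have "norm (id_blinfun :: ell2 \<Rightarrow>\<^sub>L ell2) = 1"
  proof (rule antisym)
    show "norm (id_blinfun :: ell2 \<Rightarrow>\<^sub>L ell2) \<le> 1" by (rule norm_blinfun_bound) auto
    show "1 \<le> norm (id_blinfun :: ell2 \<Rightarrow>\<^sub>L ell2)"
      using norm_blinfun[of id_blinfun "basis_vec 0"] by simp
  qed
  then show "norm (1 :: bop) = 1" by transfer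
  show "(0 :: bop) \<noteq> 1"
  proof
    assume "(0 :: bop) = 1"
    then have "0 = blinfun_apply (id_blinfun :: ell2 \<Rightarrow>\<^sub>L ell2) (basis_vec 0)"
      by transfer (metis blinfun.zero_left)
    then have "norm (basis_vec 0) = 0" by simp
    then show False by simp
  qed
qed (simp_all add: uniformity_bop_def open_bop_def)

end

lemma app_add_right: "A \<cdot> (x + y) = A \<cdot> x + A \<cdot> y"
  and app_diff_right: "A \<cdot> (x - y) = A \<cdot> x - A \<cdot> y"
  and app_scaleC_right: "A \<cdot> (c *\<^sub>C x) = c *\<^sub>C (A \<cdot> x)"
  and app_scaleR_right: "A \<cdot> (r *\<^sub>R x) = r *\<^sub>R (A \<cdot> x)"
  and app_add_left: "(A + B) \<cdot> x = A \<cdot> x + B \<cdot> x"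
  and app_diff_left: "(A - B) \<cdot> x = A \<cdot> x - B \<cdot> x"
  and app_minus_left: "(- A) \<cdot> x = - (A \<cdot> x)"
  and app_scaleR_left: "(r *\<^sub>R A) \<cdot> x = r *\<^sub>R (A \<cdot> x)"
  by (transfer; simp add: blinfun.bilinear_simps)+

lemma app_simps [simp]: "A \<cdot> 0 = 0" "0 \<cdot> x = 0" "1 \<cdot> x = x" "(A * B) \<cdot> x = A \<cdot> B \<cdot> x"
  by (transfer; simp)+

lemma norm_app_le: "norm (A \<cdot> x) \<le> norm A * norm x"
  by transfer (rule norm_blinfun)

lemma bounded_bilinear_app: "bounded_bilinear (\<cdot>)"
  by standard (auto simp: app_add_left app_add_right app_scaleR_left app_scaleR_right
      intro!: exI[of _ 1] norm_app_le)

lemmas bounded_linear_app = bounded_bilinear.bounded_linear_right[OF bounded_bilinear_app]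
lemmas bounded_linear_app_left = bounded_bilinear.bounded_linear_left[OF bounded_bilinear_app]
lemmas tendsto_app [tendsto_intros] = bounded_bilinear.tendsto[OF bounded_bilinear_app]

lemma app_sum_right: "A \<cdot> (\<Sum>i\<in>I. f i) = (\<Sum>i\<in>I. A \<cdot> f i)"
  by (rule linear_sum[OF bounded_linear.linear[OF bounded_linear_app]])

lemma app_sum_left: "(\<Sum>i\<in>I. F i) \<cdot> x = (\<Sum>i\<in>I. F i \<cdot> x)"
  by (rule linear_sum[OF bounded_linear.linear[OF bounded_linear_app_left]])

lemma norm_bop_le:
  assumes "0 \<le> K" "\<And>x. norm (A \<cdot> x) \<le> K * norm x"
  shows "norm A \<le> K"
  using assms by transfer (rule norm_blinfun_bound)

lemma norm_bop_le_ip: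
  assumes "0 \<le> K" "\<And>x y. cmod (ip (A \<cdot> x) y) \<le> K * norm x * norm y"
  shows "norm A \<le> K"
proof (rule norm_bop_le[OF assms(1)])
  fix x
  have "(norm (A \<cdot> x))\<^sup>2 \<le> (K * norm x) * norm (A \<cdot> x)"
    using assms(2)[of x "A \<cdot> x"] by (simp add: ip_self norm_power)
  then show "norm (A \<cdot> x) \<le> K * norm x"
    using assms(1) by (cases "A \<cdot> x = 0") (auto simp: power2_eq_square)
qed

lemma bop_exists:
  assumes "\<And>x y. F (x + y) = F x + F y" "\<And>c x. F (c *\<^sub>C x) = c *\<^sub>C F x"
    "\<And>x. norm (F x) \<le> K * norm x"
  shows "\<exists>A. \<forall>x. A \<cdot> x = F x"
proof -
  have bl: "bounded_linear F"
    by (rule bounded_linear_intro[of _ K]) (use assms in \<open>auto simp: scaleR_scaleC mult.commute\<close>)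
  have "blinfun_apply (Blinfun F) = F" by (rule bounded_linear_Blinfun_apply[OF bl])
  then have "Abs_bop (Blinfun F) \<cdot> x = F x" for x
    by (simp add: app_def Abs_bop_inverse assms(2))
  then show ?thesis by blast
qed

lemma bounded_linear_scaleC: "bounded_linear ((*\<^sub>C) c)"
  by (rule bounded_linear_intro[of _ "cmod c"]) (auto simp: scaleC_add_right scaleC_scaleR)

instance bop :: banach
proof
  fix X :: "nat \<Rightarrow> bop"
  assume X: "Cauchy X"
  have "dist (blinfun_of_bop A) (blinfun_of_bop B) = dist A B" for A B
    by (simp add: dist_norm minus_bop.rep_eq[symmetric] norm_bop.rep_eq)
  note d = this
  have "Cauchy (\<lambda>n. blinfun_of_bop (X n))"
    using X unfolding Cauchy_def d .
  then obtain L where L: "(\<lambda>n. blinfun_of_bop (X n)) \<longlonglongrightarrow> L"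
    by (auto simp: Cauchy_convergent_iff convergent_def)
  have lim: "(\<lambda>n. X n \<cdot> x) \<longlonglongrightarrow> blinfun_apply L x" for x
    unfolding app.rep_eq by (intro tendsto_intros L)
  have "blinfun_apply L (c *\<^sub>C x) = c *\<^sub>C blinfun_apply L x" for c x
  proof (rule LIMSEQ_unique[OF lim])
    show "(\<lambda>n. X n \<cdot> (c *\<^sub>C x)) \<longlonglongrightarrow> c *\<^sub>C blinfun_apply L x"
      unfolding app_scaleC_right by (rule bounded_linear.tendsto[OF bounded_linear_scaleC lim])
  qed
  then have cL: "blinfun_of_bop (Abs_bop L) = L" by (simp add: Abs_bop_inverse)
  have "X \<longlonglongrightarrow> Abs_bop L"
    unfolding tendsto_dist_iff[of X] d[symmetric] cL using L by (simp add: tendsto_dist_iff[symmetric])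
  then show "convergent X" by (auto simp: convergent_def)
qed

lemma bop_eqI_basis:
  assumes "\<And>k. A \<cdot> basis_vec k = B \<cdot> basis_vec k"
  shows "A = B"
proof (rule bop_eqI)
  fix x
  have "(\<lambda>k. A \<cdot> (coord x k *\<^sub>C basis_vec k)) sums (A \<cdot> x)" for A
    by (rule bounded_linear.sums[OF bounded_linear_app coord_expansion])
  from this[of A] this[of B] show "A \<cdot> x = B \<cdot> x"
    by (simp add: app_scaleC_right assms sums_unique2)
qed

text \<open>The type \<open>bop\<close> carries real scaling only; complex multiples are products
  with these central elements, see \<open>scalar_commute\<close>.\<close>

lift_definition scalar :: "complex \<Rightarrow> bop" is "\<lambda>c. Blinfun ((*\<^sub>C) c)"
  by (simp add: bounded_linear_Blinfun_apply[OF bounded_linear_scaleC] mult.commute)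

lemma app_scalar [simp]: "scalar c \<cdot> x = c *\<^sub>C x"
  by transfer (simp add: bounded_linear_Blinfun_apply[OF bounded_linear_scaleC])

lemma scalar_add: "scalar (a + b) = scalar a + scalar b"
  and scalar_diff: "scalar (a - b) = scalar a - scalar b"
  and scalar_minus: "scalar (- a) = - scalar a"
  and scalar_mult: "scalar (a * b) = scalar a * scalar b"
  and scalar_commute: "A * scalar c = scalar c * A"
  by (rule bop_eqI; simp add: app_add_left app_diff_left app_minus_left app_scaleR_left scaleC_add_left
      scaleC_diff_left scaleC_minus_left app_scaleC_right scaleR_scaleC mult.commute)+

lemma scalar_simps [simp]: "scalar 0 = 0" "scalar 1 = 1"
  by (rule bop_eqI; simp)+

lemma scalar_sum: "scalar (\<Sum>i\<in>I. f i) = (\<Sum>i\<in>I. scalar (f i))"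
  by (induction I rule: infinite_finite_induct) (auto simp: scalar_add)

lemma norm_scalar [simp]: "norm (scalar c) = cmod c"
proof (rule antisym)
  show "norm (scalar c) \<le> cmod c" by (rule norm_bop_le) auto
  show "cmod c \<le> norm (scalar c)" using norm_app_le[of "scalar c" "basis_vec 0"] by simp
qed

subsection \<open>Adjoints\<close>

text \<open>The coordinates of \<open>B \<cdot> y\<close> can only be \<open>c y k\<close>, so
  everything rests on their square summability.\<close>

lemma adjoint_exists: "\<exists>B. \<forall>x y. ip (A \<cdot> x) y = ip x (B \<cdot> y)"
proof -
  define c where "c y k = ip y (A \<cdot> basis_vec k)" for y k
  have partial: "(\<Sum>k<N. (cmod (c y k))\<^sup>2) \<le> (norm A * norm y)\<^sup>2" for y N
  proof -
    define S where "S = (\<Sum>k<N. (cmod (c y k))\<^sup>2)"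
    \<comment> \<open>Testing \<open>A\<close> on the truncated vector of these very coefficients
      gives \<open>|x|^2 = <y, A x> \<le> |A| |y| |x|\<close>, with no dependence on
      \<open>N\<close>.\<close>
    define x where "x = (\<Sum>k<N. c y k *\<^sub>C basis_vec k)"
    have "ip x x = (\<Sum>k<N. c y k * cnj (c y k))"
      by (simp add: x_def ip_sum_left ip_scaleC_left if_distrib[of "(*) _"] sum.delta' cong: if_cong)
    then have "complex_of_real ((norm x)\<^sup>2) = of_real S"
      unfolding ip_self by (simp add: S_def mult_cnj_cmod)
    then have nx: "(norm x)\<^sup>2 = S" by (simp only: of_real_eq_iff)
    have "ip y (A \<cdot> x) = (\<Sum>k<N. cnj (c y k) * c y k)"
      by (simp add: x_def app_sum_right app_scaleC_right ip_sum_right ip_scaleC_right c_def)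
    then have "ip y (A \<cdot> x) = of_real S" by (simp add: S_def mult_cnj_cmod)
    then have "S = cmod (ip y (A \<cdot> x))" using nx by (metis abs_of_nonneg norm_of_real zero_le_power2)
    also have "\<dots> \<le> norm y * norm (A \<cdot> x)" by (rule cmod_ip_le)
    also have "\<dots> \<le> norm y * (norm A * norm x)" by (intro mult_left_mono norm_app_le) auto
    finally have "(norm x)\<^sup>2 \<le> (norm A * norm y) * norm x" using nx by (simp add: mult_ac)
    then have "norm x \<le> norm A * norm y"
      by (cases "x = 0") (auto simp: power2_eq_square)
    then have "(norm x)\<^sup>2 \<le> (norm A * norm y)\<^sup>2" by (intro power_mono) auto
    then show ?thesis using nx by (simp add: S_def)
  qed
  have sm: "summable (\<lambda>k. (cmod (c y k))\<^sup>2)" for y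
    by (rule summableI_nonneg_bounded[of _ "(norm A * norm y)\<^sup>2"]) (auto intro: partial)
  define F where "F y = Abs_ell2 (c y)" for y
  have cF: "coord (F y) k = c y k" for y k
    by (simp add: F_def Abs_ell2_inverse sm)
  have "\<exists>B. \<forall>y. B \<cdot> y = F y"
  proof (rule bop_exists[where K = "norm A"])
    show "F (x + y) = F x + F y" for x y by (rule ell2_eqI) (simp add: cF c_def ip_add_left)
    show "F (d *\<^sub>C x) = d *\<^sub>C F x" for d x by (rule ell2_eqI) (simp add: cF c_def ip_scaleC_left)
    show "norm (F y) \<le> norm A * norm y" for y
    proof -
      have "(norm (F y))\<^sup>2 \<le> (norm A * norm y)\<^sup>2"
        using suminf_le_const[OF sm partial, of y] norm_sums[of "F y"] by (simp add: cF sums_iff)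
      then show ?thesis by (simp add: power2_le_iff_abs_le)
    qed
  qed
  then obtain B where B: "\<And>y. B \<cdot> y = F y" by blast
  have "ip (A \<cdot> x) y = ip x (B \<cdot> y)" for x y
  proof -
    have "(\<lambda>k. A \<cdot> (coord x k *\<^sub>C basis_vec k)) sums (A \<cdot> x)"
      by (rule bounded_linear.sums[OF bounded_linear_app coord_expansion])
    moreover have "bounded_linear (\<lambda>z. ip z y)"
      by (rule bounded_linear_intro[of _ "norm y"])
        (auto simp: ip_add_left scaleR_scaleC ip_scaleC_left cmod_ip_le scaleR_conv_of_real)
    ultimately have "(\<lambda>k. ip (A \<cdot> (coord x k *\<^sub>C basis_vec k)) y) sums ip (A \<cdot> x) y"
      by (rule bounded_linear.sums[rotated])
    moreover have "ip (A \<cdot> (coord x k *\<^sub>C basis_vec k)) y = coord x k * cnj (coord (B \<cdot> y) k)" for k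
      by (simp add: app_scaleC_right ip_scaleC_left B cF c_def ip_commute[of y])
    ultimately show ?thesis by (simp add: ip_def[of x] sums_iff)
  qed
  then show ?thesis by blast
qed

definition adj :: "bop \<Rightarrow> bop" where
  "adj A = (SOME B. \<forall>x y. ip (A \<cdot> x) y = ip x (B \<cdot> y))"

lemma ip_app_left: "ip (A \<cdot> x) y = ip x (adj A \<cdot> y)"
  using someI_ex[OF adjoint_exists[of A]] unfolding adj_def by blast

lemma ip_app_right: "ip x (A \<cdot> y) = ip (adj A \<cdot> x) y"
  by (metis ip_app_left ip_commute)

lemma adj_unique:
  assumes "\<And>x y. ip (A \<cdot> x) y = ip x (B \<cdot> y)"
  shows "adj A = B"
proof (rule bop_eqI)
  fix y
  have "ip (adj A \<cdot> y - B \<cdot> y) (adj A \<cdot> y - B \<cdot> y) = 0"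
    by (simp only: ip_diff_right[of "adj A \<cdot> y - B \<cdot> y" "adj A \<cdot> y"] ip_app_left[symmetric] assms[symmetric]) simp
  then show "adj A \<cdot> y = B \<cdot> y" by (simp add: ip_self)
qed

lemma adj_adj [simp]: "adj (adj A) = A"
  by (rule adj_unique) (simp add: ip_app_right)

lemma adj_mult: "adj (A * B) = adj B * adj A"
  and adj_add: "adj (A + B) = adj A + adj B"
  and adj_diff: "adj (A - B) = adj A - adj B"
  and adj_scalar [simp]: "adj (scalar c) = scalar (cnj c)"
  and adj_scaleR: "adj (r *\<^sub>R A) = r *\<^sub>R adj A"
  by (rule adj_unique; simp add: ip_app_left app_add_left app_diff_left app_minus_left app_scaleR_left ip_add_left
      ip_add_right ip_diff_left ip_diff_right ip_minus_left ip_minus_right ip_scaleC_left ip_scaleC_right scaleR_scaleC)+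

lemma adj_one [simp]: "adj 1 = 1"
  by (rule adj_unique) simp

lemma adj_zero [simp]: "adj 0 = 0"
  by (rule adj_unique) simp

lemma adj_sum: "adj (\<Sum>i\<in>I. F i) = (\<Sum>i\<in>I. adj (F i))"
  by (induction I rule: infinite_finite_induct) (auto simp: adj_add)

lemma adj_power: "adj (A ^ n) = adj A ^ n"
  by (induction n) (auto simp: adj_mult power_commutes)

lemma norm_adj [simp]: "norm (adj A) = norm A"
proof -
  have "norm (adj A) \<le> norm A" for A
  proof (rule norm_bop_le_ip)
    fix x y
    have "cmod (ip (adj A \<cdot> x) y) \<le> norm x * norm (A \<cdot> y)"
      unfolding ip_app_right[symmetric] by (rule cmod_ip_le)
    also have "\<dots> \<le> norm x * (norm A * norm y)"
      by (intro mult_left_mono norm_app_le) auto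
    finally show "cmod (ip (adj A \<cdot> x) y) \<le> norm A * norm x * norm y" by (simp add: mult_ac)
  qed auto
  from this[of A] this[of "adj A"] show ?thesis by simp
qed

lemma bounded_linear_adj: "bounded_linear adj"
  by (rule bounded_linear_intro[of _ 1]) (auto simp: adj_add adj_scaleR)

lemmas tendsto_adj [tendsto_intros] = bounded_linear.tendsto[OF bounded_linear_adj]

definition unitary :: "bop \<Rightarrow> bool" where
  "unitary V \<longleftrightarrow> adj V * V = 1 \<and> V * adj V = 1"

lemma unitary_mult: "unitary V \<Longrightarrow> unitary W \<Longrightarrow> unitary (V * W)"
  unfolding unitary_def by (metis adj_mult mult.assoc mult.left_neutral)

lemma unitary_adj: "unitary V \<Longrightarrow> unitary (adj V)"
  by (simp add: unitary_def)

lemma norm_unitary_app: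
  assumes "unitary V"
  shows "norm (V \<cdot> x) = norm x"
proof -
  have "ip (V \<cdot> x) (V \<cdot> x) = ip x ((adj V * V) \<cdot> x)" by (simp add: ip_app_left)
  also have "adj V * V = 1" using assms by (simp add: unitary_def)
  finally have "ip (V \<cdot> x) (V \<cdot> x) = ip x x" by simp
  then have "(norm (V \<cdot> x))\<^sup>2 = (norm x)\<^sup>2" unfolding ip_self of_real_eq_iff .
  then show ?thesis by (simp add: power2_eq_iff_nonneg)
qed

lemma adj_exp: "adj (exp A) = exp (adj (A :: bop))"
  unfolding exp_def
  by (subst bounded_linear.suminf[OF bounded_linear_adj summable_exp_generic])
    (simp add: adj_scaleR adj_power)

lemma unitary_exp:
  assumes "adj A = - A"
  shows "unitary (exp A)"
  using exp_minus_inverse[of A] exp_minus_inverse[of "- A"] by (simp add: unitary_def adj_exp assms)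

section \<open>Continuous functional calculus of a unitary operator\<close>

definition unity_root :: "nat \<Rightarrow> nat \<Rightarrow> complex" where
  "unity_root N j = cis (2 * pi * real j / real N)"

lemma mult_scalar_left: "A * (scalar c * B) = scalar c * (A * B)"
  by (simp only: mult.assoc[symmetric] scalar_commute[of A c])

lemma scalar_mult_scalar: "(scalar a * A) * (scalar b * B) = scalar (a * b) * (A * B)"
  by (simp only: scalar_mult mult.assoc mult_scalar_left[of A b B])

lemma unity_root_circle [simp]: "unity_root N j \<in> circle" "cmod (unity_root N j) = 1"
  by (auto simp: unity_root_def)

lemma unity_root_mult_cnj [simp]:
  "unity_root N j * cnj (unity_root N j) = 1" "cnj (unity_root N j) * unity_root N j = 1"
  by (simp_all add: mult_cnj_cmod)

lemma unity_root_power_swap: "unity_root N j ^ k = unity_root N k ^ j"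
  by (simp add: unity_root_def Complex.DeMoivre mult_ac)

lemma unity_root_power_N: "N > 0 \<Longrightarrow> unity_root N j ^ N = 1"
  by (simp add: unity_root_def Complex.DeMoivre complex_eq_iff)

lemma unity_root_inj: "k < N \<Longrightarrow> l < N \<Longrightarrow> unity_root N k = unity_root N l \<longleftrightarrow> k = l"
  using Complex.bij_betw_roots_unity[of N] unfolding bij_betw_def inj_on_def unity_root_def by auto

lemma unity_root_orthogonal:
  assumes "k < N" "l < N"
  shows "(\<Sum>j<N. unity_root N j ^ k * cnj (unity_root N j) ^ l) = (if k = l then of_nat N else 0)"
proof -
  \<comment> \<open>Exchanging exponent and index,
    \<open>unity_root N j ^ k = unity_root N k ^ j\<close>, turns the sum over \<open>j\<close> into
    a geometric series with ratio \<open>z\<close>.\<close>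
  define z where "z = unity_root N k * cnj (unity_root N l)"
  have "unity_root N j ^ k * cnj (unity_root N j) ^ l = z ^ j" for j
    unfolding z_def power_mult_distrib complex_cnj_power[symmetric]
    by (simp add: unity_root_power_swap[of N j])
  then have sum: "(\<Sum>j<N. unity_root N j ^ k * cnj (unity_root N j) ^ l) = (\<Sum>j<N. z ^ j)" by simp
  show ?thesis
  proof (cases "k = l")
    case True
    then have "z = 1" by (simp add: z_def)
    then show ?thesis using sum True by simp
  next
    case False
    have "z \<noteq> 1"
    proof
      assume "z = 1"
      then have "unity_root N k * cnj (unity_root N l) * unity_root N l = unity_root N l"
        by (simp add: z_def)
      then show False using unity_root_inj assms False by (simp add: mult.assoc)
    qed
    moreover have "z ^ N = 1"
      using assms by (simp add: z_def power_mult_distrib unity_root_power_N complex_cnj_power[symmetric] del: complex_cnj_power)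
    ultimately have "(\<Sum>j<N. z ^ j) = 0" by (simp add: geometric_sum)
    then show ?thesis using sum False by simp
  qed
qed

text \<open>On an eigenvector of \<open>V\<close> with eigenvalue \<open>z\<close> this is the
  geometric sum of the powers of \<open>z / unity_root N j\<close>, peaked at
  \<open>z = unity_root N j\<close>. Its squared modulus is \<open>N\<close> times the Fejer kernel
  centred at that root.\<close>

definition frame_op :: "bop \<Rightarrow> nat \<Rightarrow> nat \<Rightarrow> bop" where
  "frame_op V N j = (\<Sum>k<N. scalar (cnj (unity_root N j) ^ k) * V ^ k)"

lemma unitary_adj_power_mult: "unitary V \<Longrightarrow> adj V ^ k * V ^ k = 1"
proof (induction k)
  case (Suc k)
  have "adj V ^ Suc k * V ^ Suc k = adj V ^ k * (adj V * V) * V ^ k"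
    by (simp only: power_Suc2[of "adj V"] power_Suc[of V] mult.assoc)
  with Suc show ?case by (simp add: unitary_def)
qed simp

lemma adj_frame_op: "adj (frame_op V N j) = (\<Sum>k<N. scalar (unity_root N j ^ k) * adj V ^ k)"
  by (simp add: frame_op_def adj_sum adj_mult adj_power scalar_commute)

lemma frame_op_commute:
  assumes "A * V = V * A"
  shows "A * frame_op V N j = frame_op V N j * A"
  unfolding frame_op_def sum_distrib_left sum_distrib_right
proof (intro sum.cong refl)
  fix k
  show "A * (scalar (cnj (unity_root N j) ^ k) * V ^ k) = scalar (cnj (unity_root N j) ^ k) * V ^ k * A"
    unfolding mult_scalar_left using power_commuting_commutes[OF assms[symmetric], of k]
    by (simp add: mult.assoc)
qed

lemma frame_op_normal:
  assumes "unitary V"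
  shows "adj (frame_op V N j) * frame_op V N j = frame_op V N j * adj (frame_op V N j)"
proof -
  have "adj V * V = V * adj V" using assms by (simp add: unitary_def)
  then have 1: "adj V * frame_op V N j = frame_op V N j * adj V" by (rule frame_op_commute)
  have "V * adj (frame_op V N j) = adj (frame_op V N j) * V"
    using arg_cong[OF 1, of adj] by (simp add: adj_mult)
  from frame_op_commute[OF this[symmetric]] show ?thesis .
qed

text \<open>Summing over the roots of unity first removes all mixed terms
  \<open>adj V ^ k * V ^ l\<close>; each of the \<open>N\<close> diagonal terms is the identity,
  with weight \<open>N\<close>.\<close>

lemma sum_frame_op:
  assumes "unitary V"
  shows "(\<Sum>j<N. adj (frame_op V N j) * frame_op V N j) = scalar (of_nat (N\<^sup>2))"
proof -
  have "(\<Sum>j<N. adj (frame_op V N j) * frame_op V N j) =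
      (\<Sum>j<N. \<Sum>k<N. \<Sum>l<N. scalar (unity_root N j ^ k * cnj (unity_root N j) ^ l) * (adj V ^ k * V ^ l))"
    unfolding adj_frame_op unfolding frame_op_def sum_product
    by (intro sum.cong refl) (rule scalar_mult_scalar)
  also have "\<dots> = (\<Sum>k<N. \<Sum>j<N. \<Sum>l<N. scalar (unity_root N j ^ k * cnj (unity_root N j) ^ l) * (adj V ^ k * V ^ l))"
    by (rule sum.swap)
  also have "\<dots> = (\<Sum>k<N. \<Sum>l<N. \<Sum>j<N. scalar (unity_root N j ^ k * cnj (unity_root N j) ^ l) * (adj V ^ k * V ^ l))"
    by (rule sum.cong[OF refl], rule sum.swap)
  also have "\<dots> = (\<Sum>k<N. \<Sum>l<N. scalar (if k = l then of_nat N else 0) * (adj V ^ k * V ^ l))"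
    by (intro sum.cong refl) (simp add: sum_distrib_right[symmetric] scalar_sum[symmetric] unity_root_orthogonal)
  also have "\<dots> = (\<Sum>k<N. \<Sum>l<N. if k = l then scalar (of_nat N) else 0)"
    by (intro sum.cong refl) (simp add: unitary_adj_power_mult[OF assms])
  also have "\<dots> = (\<Sum>k<N. scalar (of_nat N))"
    by (intro sum.cong refl) simp
  also have "\<dots> = scalar (of_nat (N\<^sup>2))"
    by (simp only: scalar_sum[symmetric]) (simp add: power2_eq_square)
  finally show ?thesis .
qed

lemma sum_norm_frame_op:
  assumes "unitary V"
  shows "(\<Sum>j<N. (norm (frame_op V N j \<cdot> x))\<^sup>2) = (real N * norm x)\<^sup>2"
    and "(\<Sum>j<N. (norm (adj (frame_op V N j) \<cdot> x))\<^sup>2) = (real N * norm x)\<^sup>2"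
proof -
  have "complex_of_real (\<Sum>j<N. (norm (frame_op V N j \<cdot> x))\<^sup>2) =
      ip ((\<Sum>j<N. adj (frame_op V N j) * frame_op V N j) \<cdot> x) x"
    by (simp add: app_sum_left ip_sum_left ip_app_left ip_self[symmetric] del: of_real_power)
  also have "\<dots> = of_real ((real N * norm x)\<^sup>2)"
    unfolding sum_frame_op[OF assms] by (simp add: ip_scaleC_left ip_self power_mult_distrib)
  finally show 1: "(\<Sum>j<N. (norm (frame_op V N j \<cdot> x))\<^sup>2) = (real N * norm x)\<^sup>2"
    by (simp only: of_real_eq_iff)
  have "(norm (adj (frame_op V N j) \<cdot> x))\<^sup>2 = (norm (frame_op V N j \<cdot> x))\<^sup>2" for j
  proof -
    have "ip (adj (frame_op V N j) \<cdot> x) (adj (frame_op V N j) \<cdot> x) =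
        ip x ((frame_op V N j * adj (frame_op V N j)) \<cdot> x)" by (simp add: ip_app_left)
    also have "\<dots> = ip (frame_op V N j \<cdot> x) (frame_op V N j \<cdot> x)"
      unfolding frame_op_normal[OF assms, symmetric] by (simp add: ip_app_left)
    finally show ?thesis unfolding ip_self of_real_eq_iff .
  qed
  then show "(\<Sum>j<N. (norm (adj (frame_op V N j) \<cdot> x))\<^sup>2) = (real N * norm x)\<^sup>2" using 1 by simp
qed

text \<open>
  The operators \<open>adj (frame_op V N j) * frame_op V N j / N\<^sup>2\<close> are positive with sum 1: a discrete
  approximation, located at the roots of unity, of the spectral measure of \<open>V\<close>.
\<close>

definition fc_approx :: "bop \<Rightarrow> nat \<Rightarrow> (complex \<Rightarrow> complex) \<Rightarrow> bop" where
  "fc_approx V N f = (\<Sum>j<N. scalar (f (unity_root N j) / of_nat (N\<^sup>2)) *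
     (adj (frame_op V N j) * frame_op V N j))"

lemma fc_approx_add: "fc_approx V N (\<lambda>z. f z + g z) = fc_approx V N f + fc_approx V N g"
  and fc_approx_diff: "fc_approx V N (\<lambda>z. f z - g z) = fc_approx V N f - fc_approx V N g"
  by (simp_all add: fc_approx_def sum.distrib sum_subtractf add_divide_distrib diff_divide_distrib
      scalar_add scalar_diff algebra_simps)

lemma fc_approx_cmult: "fc_approx V N (\<lambda>z. c * f z) = scalar c * fc_approx V N f"
  by (simp add: fc_approx_def sum_distrib_left scalar_mult[symmetric] mult.assoc[symmetric])

lemma adj_fc_approx: "adj (fc_approx V N f) = fc_approx V N (\<lambda>z. cnj (f z))"
  by (simp add: fc_approx_def adj_sum adj_mult scalar_commute)

lemma fc_approx_1:
  assumes "unitary V" "N > 0"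
  shows "fc_approx V N (\<lambda>_. 1) = 1"
proof -
  have "fc_approx V N (\<lambda>_. 1) = scalar (1 / of_nat (N\<^sup>2)) * scalar (of_nat (N\<^sup>2))"
    unfolding sum_frame_op[OF assms(1), symmetric] by (simp add: fc_approx_def sum_distrib_left)
  then show ?thesis using assms(2) by (simp add: scalar_mult[symmetric] del: of_nat_power)
qed

lemma Cauchy_Schwarz_sum:
  fixes a b :: "'i \<Rightarrow> real"
  assumes "(\<Sum>i\<in>I. (a i)\<^sup>2) \<le> A\<^sup>2" "(\<Sum>i\<in>I. (b i)\<^sup>2) \<le> B\<^sup>2" "A \<ge> 0" "B \<ge> 0"
  shows "(\<Sum>i\<in>I. a i * b i) \<le> A * B"
proof -
  have "(\<Sum>i\<in>I. a i * b i)\<^sup>2 \<le> (\<Sum>i\<in>I. (a i)\<^sup>2) * (\<Sum>i\<in>I. (b i)\<^sup>2)"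
    by (rule Cauchy_Schwarz_ineq_sum)
  also have "\<dots> \<le> A\<^sup>2 * B\<^sup>2"
    by (intro mult_mono assms sum_nonneg) auto
  finally have "(\<Sum>i\<in>I. a i * b i)\<^sup>2 \<le> (A * B)\<^sup>2" by (simp add: power_mult_distrib)
  then show ?thesis by (rule power2_le_imp_le) (use assms in auto)
qed

text \<open>Cauchy-Schwarz over the roots loses nothing: the two square sums are
  \<open>(N |x|)^2\<close> and \<open>(N |y|)^2\<close>, and the factor \<open>1 / N^2\<close> in
  \<open>fc_approx\<close> cancels the \<open>N\<close> exactly.\<close>

lemma norm_fc_approx_le:
  assumes "unitary V" "0 \<le> K" "\<And>z. z \<in> circle \<Longrightarrow> cmod (f z) \<le> K"
  shows "norm (fc_approx V N f) \<le> K"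
proof (cases "N = 0")
  case False
  show ?thesis
  proof (rule norm_bop_le_ip[OF assms(2)])
    fix x y
    let ?S = "\<lambda>j. frame_op V N j"
    have "cmod (ip (fc_approx V N f \<cdot> x) y) =
        cmod (\<Sum>j<N. f (unity_root N j) / of_nat (N\<^sup>2) * ip (?S j \<cdot> x) (?S j \<cdot> y))"
      by (simp add: fc_approx_def app_sum_left ip_sum_left ip_scaleC_left ip_app_left)
    also have "\<dots> \<le> (\<Sum>j<N. K / (real N)\<^sup>2 * (norm (?S j \<cdot> x) * norm (?S j \<cdot> y)))"
      by (rule sum_norm_le)
        (auto simp: norm_mult norm_divide norm_power intro!: mult_mono divide_right_mono assms cmod_ip_le)
    also have "\<dots> = K / (real N)\<^sup>2 * (\<Sum>j<N. norm (?S j \<cdot> x) * norm (?S j \<cdot> y))"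
      by (simp add: sum_distrib_left)
    also have "\<dots> \<le> K / (real N)\<^sup>2 * ((real N * norm x) * (real N * norm y))"
      using assms(2) sum_norm_frame_op[OF assms(1), of N]
      by (intro mult_left_mono Cauchy_Schwarz_sum) auto
    also have "\<dots> = K * norm x * norm y" using False by (simp add: power2_eq_square field_simps)
    finally show "cmod (ip (fc_approx V N f \<cdot> x) y) \<le> K * norm x * norm y" .
  qed
qed (use assms in \<open>simp add: fc_approx_def\<close>)

text \<open>The factor \<open>sqrt N\<close> is the length of the constant sequence 1 in
  Cauchy-Schwarz; estimating term by term would give \<open>N^2\<close> in place of
  \<open>N sqrt N\<close>.\<close>

lemma norm_sum_adj_frame_op_le:
  assumes "unitary V" "0 \<le> K" "\<And>j. j < N \<Longrightarrow> cmod (c j) \<le> K"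
  shows "norm (\<Sum>j<N. scalar (c j) * adj (frame_op V N j)) \<le> K * (real N * sqrt (real N))"
proof (rule norm_bop_le)
  fix x
  let ?S = "\<lambda>j. adj (frame_op V N j)"
  have "norm ((\<Sum>j<N. scalar (c j) * ?S j) \<cdot> x) \<le> (\<Sum>j<N. K * norm (?S j \<cdot> x))"
    unfolding app_sum_left
    by (rule sum_norm_le) (auto intro!: mult_right_mono assms)
  also have "\<dots> = K * (\<Sum>j<N. norm (?S j \<cdot> x) * 1)" by (simp add: sum_distrib_left)
  also have "\<dots> \<le> K * (real N * norm x * sqrt (real N))"
    using assms(2) sum_norm_frame_op[OF assms(1), of N]
    by (intro mult_left_mono Cauchy_Schwarz_sum) auto
  finally show "norm ((\<Sum>j<N. scalar (c j) * ?S j) \<cdot> x) \<le> K * (real N * sqrt (real N)) * norm x"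
    by (simp add: mult_ac)
qed (use assms in auto)

text \<open>\<open>V\<close> acts on the range of \<open>frame_op V N j\<close> almost as the scalar
  \<open>unity_root N j\<close>. The geometric sum telescopes, and for unitary \<open>V\<close> the
  boundary term stays bounded while the sum has \<open>N\<close> terms.\<close>

lemma frame_op_shift:
  assumes "N > 0"
  shows "V * frame_op V N j - scalar (unity_root N j) * frame_op V N j = scalar (unity_root N j) * (V ^ N - 1)"
proof -
  define W where "W = scalar (cnj (unity_root N j)) * V"
  have Wk: "W ^ k = scalar (cnj (unity_root N j) ^ k) * V ^ k" for k
  proof (induction k)
    case (Suc k)
    then show ?case by (simp add: W_def scalar_mult_scalar)
  qed simp
  have V: "V = scalar (unity_root N j) * W"
    by (simp add: W_def mult.assoc[symmetric] scalar_mult[symmetric])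
  have S: "frame_op V N j = (\<Sum>k<N. W ^ k)" by (simp add: frame_op_def Wk)
  have "W * frame_op V N j - frame_op V N j = W ^ N - 1"
    unfolding S sum_distrib_left sum_subtractf[symmetric] power_Suc[symmetric]
    by (simp only: sum_lessThan_telescope) simp
  moreover have "W ^ N = V ^ N"
    unfolding Wk using unity_root_power_N[OF assms] by (simp flip: complex_cnj_power)
  ultimately have "scalar (unity_root N j) * (W * frame_op V N j - frame_op V N j) =
      scalar (unity_root N j) * (V ^ N - 1)" by simp
  then show ?thesis by (subst (1) V) (simp add: right_diff_distrib mult.assoc)
qed

text \<open>The defect \<open>1 - V ^ N\<close> is the same for all roots and can be taken out of
  the sum. What remains is a sum of single frame operators instead of products of two, of size
  \<open>N sqrt N\<close> against the normalisation \<open>1 / N^2\<close>.\<close>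

lemma fc_approx_shift:
  assumes V: "unitary V" and K: "\<And>z. z \<in> circle \<Longrightarrow> cmod (f z) \<le> K" and "N > 0"
  shows "norm (fc_approx V N (\<lambda>z. z * f z) - V * fc_approx V N f) \<le> 2 * K / sqrt (real N)"
proof -
  have K0: "0 \<le> K" using K[of 1] norm_ge_zero[of "f 1"] by (simp del: norm_ge_zero)
  let ?S = "\<lambda>j. frame_op V N j" and ?w = "unity_root N"
  let ?c = "\<lambda>j. f (?w j) * ?w j / of_nat (N\<^sup>2)"
  have "fc_approx V N (\<lambda>z. z * f z) - V * fc_approx V N f =
      (\<Sum>j<N. scalar (f (?w j) / of_nat (N\<^sup>2)) * (scalar (?w j) * ?S j - V * ?S j) * adj (?S j))"
  proof -
    have "scalar (?w j * f (?w j) / of_nat (N\<^sup>2)) * (adj (?S j) * ?S j) -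
        V * (scalar (f (?w j) / of_nat (N\<^sup>2)) * (adj (?S j) * ?S j)) =
        scalar (f (?w j) / of_nat (N\<^sup>2)) * (scalar (?w j) * ?S j - V * ?S j) * adj (?S j)" for j
    proof -
      have a: "scalar (?w j * f (?w j) / of_nat (N\<^sup>2)) = scalar (f (?w j) / of_nat (N\<^sup>2)) * scalar (?w j)"
        by (simp add: scalar_mult[symmetric] mult.commute)
      show ?thesis unfolding a mult_scalar_left[of V] frame_op_normal[OF V] by (simp add: algebra_simps)
    qed
    then show ?thesis unfolding fc_approx_def sum_distrib_left sum_subtractf[symmetric] by simp
  qed
  also have "\<dots> = (\<Sum>j<N. (1 - V ^ N) * (scalar (?c j) * adj (?S j)))"
  proof (intro sum.cong refl)
    fix j
    have "scalar (?w j) * ?S j - V * ?S j = - (scalar (?w j) * (V ^ N - 1))"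
      using frame_op_shift[OF \<open>N > 0\<close>, of V j] by (metis minus_diff_eq)
    also have "\<dots> = scalar (?w j) * (1 - V ^ N)" by (simp add: algebra_simps)
    finally have "scalar (f (?w j) / of_nat (N\<^sup>2)) * (scalar (?w j) * ?S j - V * ?S j) * adj (?S j) =
        scalar (?c j) * ((1 - V ^ N) * adj (?S j))"
      by (simp add: scalar_mult[symmetric] mult.assoc[symmetric])
    then show "scalar (f (?w j) / of_nat (N\<^sup>2)) * (scalar (?w j) * ?S j - V * ?S j) * adj (?S j) =
        (1 - V ^ N) * (scalar (?c j) * adj (?S j))"
      by (simp only: mult_scalar_left)
  qed
  also have "\<dots> = (1 - V ^ N) * (\<Sum>j<N. scalar (?c j) * adj (?S j))"
    by (simp add: sum_distrib_left)
  finally have eq: "fc_approx V N (\<lambda>z. z * f z) - V * fc_approx V N f =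
      (1 - V ^ N) * (\<Sum>j<N. scalar (?c j) * adj (?S j))" .
  have nV: "norm (V ^ N) \<le> 1"
  proof -
    have "norm V \<le> 1" by (rule norm_bop_le) (auto simp: norm_unitary_app[OF V])
    then have "norm V ^ N \<le> 1" by (simp add: power_le_one)
    then show ?thesis using norm_power_ineq[of V N] by linarith
  qed
  have "norm (fc_approx V N (\<lambda>z. z * f z) - V * fc_approx V N f) \<le>
      norm (1 - V ^ N) * norm (\<Sum>j<N. scalar (?c j) * adj (?S j))"
    unfolding eq by (rule norm_mult_ineq)
  also have "\<dots> \<le> 2 * (K / (real N)\<^sup>2 * (real N * sqrt (real N)))"
  proof (intro mult_mono)
    show "norm (1 - V ^ N) \<le> 2" using norm_triangle_ineq4[of 1 "V ^ N"] nV by simp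
    show "norm (\<Sum>j<N. scalar (?c j) * adj (?S j)) \<le> K / (real N)\<^sup>2 * (real N * sqrt (real N))"
      by (rule norm_sum_adj_frame_op_le[OF V])
        (auto simp: K0 norm_mult norm_divide norm_power intro!: divide_right_mono K)
  qed auto
  also have "\<dots> = 2 * K / sqrt (real N)"
    using \<open>N > 0\<close> real_sqrt_mult_self[of "real N"]
    by (simp add: power2_eq_square field_simps)
  finally show ?thesis .
qed

lemma fc_approx_shift_tendsto:
  assumes V: "unitary V" and K: "\<And>z. z \<in> circle \<Longrightarrow> cmod (f z) \<le> K"
  shows "(\<lambda>N. fc_approx V N (\<lambda>z. z * f z) - V * fc_approx V N f) \<longlonglongrightarrow> 0"
    and "(\<lambda>N. fc_approx V N (\<lambda>z. cnj z * f z) - adj V * fc_approx V N f) \<longlonglongrightarrow> 0"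
proof -
  have lim: "(\<lambda>N. 2 * K / sqrt (real N)) \<longlonglongrightarrow> 0" by real_asymp
  have *: "(\<lambda>N. fc_approx V N (\<lambda>z. z * f z) - V * fc_approx V N f) \<longlonglongrightarrow> 0"
    if "\<And>z. z \<in> circle \<Longrightarrow> cmod (f z) \<le> K" for f
    by (rule Lim_null_comparison[OF _ lim])
      (auto intro!: eventually_mono[OF eventually_gt_at_top[of 0]] fc_approx_shift V that)
  show "(\<lambda>N. fc_approx V N (\<lambda>z. z * f z) - V * fc_approx V N f) \<longlonglongrightarrow> 0"
    by (rule *) (rule K)
  have VS: "adj V * frame_op V N j = frame_op V N j * adj V" for N j
    using V by (intro frame_op_commute) (simp add: unitary_def)
  have VS': "adj V * adj (frame_op V N j) = adj (frame_op V N j) * adj V" for N j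
    using arg_cong[OF frame_op_commute[OF refl, of V N j], of adj] by (simp add: adj_mult)
  have com: "adj V * fc_approx V N f = fc_approx V N f * adj V" for N
    unfolding fc_approx_def sum_distrib_left sum_distrib_right
  proof (intro sum.cong refl)
    fix j
    have "adj V * (adj (frame_op V N j) * frame_op V N j) = adj (frame_op V N j) * frame_op V N j * adj V"
      by (simp only: mult.assoc[symmetric] VS') (simp only: mult.assoc VS)
    then show "adj V * (scalar c * (adj (frame_op V N j) * frame_op V N j)) =
        scalar c * (adj (frame_op V N j) * frame_op V N j) * adj V" for c
      by (simp only: mult_scalar_left) (simp only: mult.assoc)
  qed
  \<comment> \<open>The claim for \<open>cnj z\<close> is the adjoint of the one for
    \<open>z\<close> with \<open>cnj (f z)\<close> as test function; \<open>com\<close> restores the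
    order of the factors.\<close>
  have "(\<lambda>N. adj (fc_approx V N (\<lambda>z. z * cnj (f z)) - V * fc_approx V N (\<lambda>z. cnj (f z)))) \<longlonglongrightarrow> adj 0"
    by (intro tendsto_adj *) (auto simp: K)
  then show "(\<lambda>N. fc_approx V N (\<lambda>z. cnj z * f z) - adj V * fc_approx V N f) \<longlonglongrightarrow> 0"
    by (simp add: adj_diff adj_mult adj_fc_approx com)
qed

section \<open>Uniform approximation on the circle as an induction principle\<close>

lemma circle_function_induct [consumes 1, case_names const id cnj add mult lim]:
  assumes "continuous_on circle f"
    and const: "\<And>c. P (\<lambda>_. c)" and id: "P (\<lambda>z. z)" and cnj: "P (\<lambda>z. cnj z)"
    and add: "\<And>f g. continuous_on circle f \<Longrightarrow> continuous_on circle g \<Longrightarrow> P f \<Longrightarrow> P g \<Longrightarrow> P (\<lambda>z. f z + g z)"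
    and mult: "\<And>f g. continuous_on circle f \<Longrightarrow> continuous_on circle g \<Longrightarrow> P f \<Longrightarrow> P g \<Longrightarrow> P (\<lambda>z. f z * g z)"
    and lim: "\<And>f. continuous_on circle f \<Longrightarrow>
      (\<And>e. e > 0 \<Longrightarrow> \<exists>g. continuous_on circle g \<and> P g \<and> (\<forall>z\<in>circle. cmod (f z - g z) \<le> e)) \<Longrightarrow> P f"
  shows "P f"
proof -
  \<comment> \<open>Stone-Weierstrass supplies polynomials in the real and the imaginary part.
    \<open>?Q\<close> carries continuity along because the premises for sums and products ask for
    it.\<close>
  let ?Q = "\<lambda>f. continuous_on circle f \<and> P f"
  have Re: "?Q (\<lambda>z. of_real (Re z))"
  proof -
    have "?Q (\<lambda>z. 1 / 2 * (z + cnj z))"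
      by (intro conjI mult add const id cnj continuous_intros)
    moreover have "(\<lambda>z. 1 / 2 * (z + cnj z)) = (\<lambda>z. of_real (Re z))"
      by (auto simp: complex_eq_iff)
    ultimately show ?thesis by (simp only:)
  qed
  have Im: "?Q (\<lambda>z. of_real (Im z))"
  proof -
    have "?Q (\<lambda>z. - \<i> / 2 * (z + (- 1) * cnj z))"
      by (intro conjI mult add const id cnj continuous_intros)
    moreover have "(\<lambda>z. - \<i> / 2 * (z + (- 1) * cnj z)) = (\<lambda>z. of_real (Im z))"
      by (auto simp: complex_eq_iff)
    ultimately show ?thesis by (simp only:)
  qed
  have poly: "?Q (\<lambda>z. complex_of_real (p z))" if "real_polynomial_function p" for p :: "complex \<Rightarrow> real"
    using that
  proof (induction p rule: real_polynomial_function.induct)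
    case (linear p)
    \<comment> \<open>A real linear functional on the plane is determined by its values at
      \<open>1\<close> and \<open>\<i>\<close>, so the linear generators reduce to \<open>Re\<close>
      and \<open>Im\<close>.\<close>
    have p: "p z = Re z * p 1 + Im z * p \<i>" for z
    proof -
      have "p (Re z *\<^sub>R 1 + Im z *\<^sub>R \<i>) = Re z * p 1 + Im z * p \<i>"
        by (simp only: linear.hyps bounded_linear.linear linear_add linear_cmul real_scaleR_def)
      then show ?thesis by (simp add: scaleR_conv_of_real complex_eq[symmetric] mult.commute[of _ \<i>])
    qed
    have "?Q (\<lambda>z. of_real (Re z) * of_real (p 1) + of_real (Im z) * of_real (p \<i>))"
      using Re Im by (intro conjI mult add const continuous_intros) auto
    moreover have "(\<lambda>z. complex_of_real (p z)) =
        (\<lambda>z. of_real (Re z) * of_real (p 1) + of_real (Im z) * of_real (p \<i>))"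
      by (rule ext) (subst p, simp)
    ultimately show ?case by (simp only:)
  next
    case (const c)
    then show ?case using assms(2) by simp
  next
    case (add f g)
    then show ?case using assms(5)[of "\<lambda>z. of_real (f z)" "\<lambda>z. of_real (g z)"]
      by (auto intro: continuous_on_add)
  next
    case (mult f g)
    then show ?case using assms(6)[of "\<lambda>z. of_real (f z)" "\<lambda>z. of_real (g z)"]
      by (auto intro: continuous_on_mult)
  qed
  show ?thesis
  proof (rule lim[OF assms(1)])
    fix e :: real assume "e > 0"
    then obtain g where g: "polynomial_function g" "\<forall>z\<in>circle. norm (f z - g z) < e"
      using Stone_Weierstrass_polynomial_function[of circle f e] assms(1) compact_sphere by blast
    have "real_polynomial_function (\<lambda>z. Re (g z))" "real_polynomial_function (\<lambda>z. Im (g z))"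
      using g(1) bounded_linear_Re bounded_linear_Im unfolding polynomial_function_def o_def by blast+
    from this[THEN poly] have "?Q (\<lambda>z. of_real (Re (g z)) + \<i> * of_real (Im (g z)))"
      using continuous_on_polymonial_function[OF g(1), of circle]
      by (intro conjI add mult const continuous_intros) auto
    then have "?Q g" by (simp add: complex_eq[symmetric])
    with g(2) show "\<exists>g. continuous_on circle g \<and> P g \<and> (\<forall>z\<in>circle. cmod (f z - g z) \<le> e)"
      by (meson less_imp_le)
  qed
qed

lemma circle_function_bounded:
  assumes "continuous_on circle f"
  obtains K where "0 \<le> K" "\<And>z. z \<in> circle \<Longrightarrow> cmod (f z) \<le> K"
proof -
  have "bounded (f ` circle)"
    by (rule compact_imp_bounded[OF compact_continuous_image[OF assms compact_sphere]])
  then obtain K where "\<forall>y\<in>f ` circle. norm y \<le> K" by (auto simp: bounded_iff)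
  then show thesis by (intro that[of "max K 0"]) (auto simp: le_max_iff_disj)
qed

text \<open>Convergence of \<open>fc_approx V N g\<close> alone does not pass to products, as
  \<open>fc_approx\<close> becomes multiplicative only in the limit. With a further bounded factor
  \<open>f\<close>, possibly discontinuous, the property can be composed; \<open>f = 1\<close>
  recovers the limit.\<close>

definition fc_symbol :: "bop \<Rightarrow> (complex \<Rightarrow> complex) \<Rightarrow> bop \<Rightarrow> bool" where
  "fc_symbol V g A \<longleftrightarrow> (\<forall>f K. (\<forall>z\<in>circle. cmod (f z) \<le> K) \<longrightarrow>
     (\<lambda>N. fc_approx V N (\<lambda>z. g z * f z) - A * fc_approx V N f) \<longlonglongrightarrow> 0)"

lemma fc_symbolD:
  assumes "fc_symbol V g A" "\<And>z. z \<in> circle \<Longrightarrow> cmod (f z) \<le> K"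
  shows "(\<lambda>N. fc_approx V N (\<lambda>z. g z * f z) - A * fc_approx V N f) \<longlonglongrightarrow> 0"
  using assms unfolding fc_symbol_def by blast

lemma fc_symbol_tendsto:
  assumes "unitary V" "fc_symbol V g A"
  shows "(\<lambda>N. fc_approx V N g) \<longlonglongrightarrow> A"
proof -
  have "(\<lambda>N. fc_approx V N (\<lambda>z. g z * 1) - A * fc_approx V N (\<lambda>_. 1)) \<longlonglongrightarrow> 0"
    using assms(2) by (rule fc_symbolD[where K = 1]) simp
  moreover have "\<forall>\<^sub>F N in sequentially. fc_approx V N (\<lambda>z. g z * 1) - A * fc_approx V N (\<lambda>_. 1) = fc_approx V N g - A"
    using eventually_gt_at_top[of 0] by eventually_elim (simp add: fc_approx_1[OF assms(1)])
  ultimately have "(\<lambda>N. fc_approx V N g - A) \<longlonglongrightarrow> 0" by (rule Lim_transform_eventually)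
  then show ?thesis by (simp add: LIM_zero_iff)
qed

lemma fc_symbol_norm_le:
  assumes "unitary V" "fc_symbol V g A" "\<And>z. z \<in> circle \<Longrightarrow> cmod (g z) \<le> K"
  shows "norm A \<le> K"
proof (rule tendsto_upperbound[OF tendsto_norm[OF fc_symbol_tendsto[OF assms(1,2)]]])
  have "0 \<le> K" using assms(3)[of 1] norm_ge_zero[of "g 1"] by (simp del: norm_ge_zero)
  then show "\<forall>\<^sub>F N in sequentially. norm (fc_approx V N g) \<le> K"
    by (intro always_eventually allI norm_fc_approx_le assms)
qed simp

lemma fc_symbol_add:
  assumes "fc_symbol V g A" "fc_symbol V h B"
  shows "fc_symbol V (\<lambda>z. g z + h z) (A + B)"
  unfolding fc_symbol_def
proof (intro allI impI)
  fix f :: "complex \<Rightarrow> complex" and K assume "\<forall>z\<in>circle. cmod (f z) \<le> K"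
  then have "(\<lambda>N. (fc_approx V N (\<lambda>z. g z * f z) - A * fc_approx V N f) +
      (fc_approx V N (\<lambda>z. h z * f z) - B * fc_approx V N f)) \<longlonglongrightarrow> 0 + 0"
    by (intro tendsto_add fc_symbolD[OF assms(1)] fc_symbolD[OF assms(2)]) auto
  then show "(\<lambda>N. fc_approx V N (\<lambda>z. (g z + h z) * f z) - (A + B) * fc_approx V N f) \<longlonglongrightarrow> 0"
    by (simp add: distrib_right fc_approx_add algebra_simps)
qed

lemma fc_symbol_mult:
  assumes "fc_symbol V g A" "fc_symbol V h B" "continuous_on circle h"
  shows "fc_symbol V (\<lambda>z. g z * h z) (A * B)"
  unfolding fc_symbol_def
proof (intro allI impI)
  fix f :: "complex \<Rightarrow> complex" and K assume K: "\<forall>z\<in>circle. cmod (f z) \<le> K"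
  \<comment> \<open>The property of \<open>A\<close> is applied with \<open>h f\<close> as test
    function, so \<open>h\<close> has to be bounded.\<close>
  obtain L where L: "0 \<le> L" "\<And>z. z \<in> circle \<Longrightarrow> cmod (h z) \<le> L"
    using circle_function_bounded[OF assms(3)] by blast
  have "\<forall>z\<in>circle. cmod (h z * f z) \<le> L * K"
    using L K by (auto simp: norm_mult intro!: mult_mono)
  then have 1: "(\<lambda>N. fc_approx V N (\<lambda>z. g z * (h z * f z)) - A * fc_approx V N (\<lambda>z. h z * f z)) \<longlonglongrightarrow> 0"
    by (intro fc_symbolD[OF assms(1)]) blast
  have "(\<lambda>N. A * (fc_approx V N (\<lambda>z. h z * f z) - B * fc_approx V N f)) \<longlonglongrightarrow> A * 0"
    using K by (intro tendsto_mult tendsto_const fc_symbolD[OF assms(2)]) blast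
  from tendsto_add[OF 1 this]
  show "(\<lambda>N. fc_approx V N (\<lambda>z. g z * h z * f z) - A * B * fc_approx V N f) \<longlonglongrightarrow> 0"
    by (simp add: algebra_simps)
qed

lemma fc_symbol_const: "fc_symbol V (\<lambda>_. c) (scalar c)"
  unfolding fc_symbol_def by (simp add: fc_approx_cmult)

lemma fc_symbol_exists:
  assumes V: "unitary V" and "continuous_on circle g"
  shows "\<exists>A. fc_symbol V g A"
  using assms(2)
proof (induction g rule: circle_function_induct)
  case (const c)
  show ?case using fc_symbol_const by blast
next
  case id
  show ?case unfolding fc_symbol_def using fc_approx_shift_tendsto(1)[OF V] by blast
next
  case cnj
  show ?case unfolding fc_symbol_def using fc_approx_shift_tendsto(2)[OF V] by blast
next
  case (add f g)
  then show ?case using fc_symbol_add by blast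
next
  case (mult f g)
  then show ?case using fc_symbol_mult by blast
next
  case (lim g)
  have "\<exists>h B. continuous_on circle h \<and> fc_symbol V h B \<and>
      (\<forall>z\<in>circle. cmod (g z - h z) \<le> inverse (real (Suc n)))" for n
    using lim.IH[of "inverse (real (Suc n))"] by (auto simp del: of_nat_Suc)
  then obtain h B where hB: "\<And>n. fc_symbol V (h n) (B n)" and h: "\<And>n. continuous_on circle (h n)" and hB2:
    "\<And>n z. z \<in> circle \<Longrightarrow> cmod (g z - h n z) \<le> inverse (real (Suc n))" by metis
  \<comment> \<open>The differences of the \<open>B n\<close> belong to the differences of the
    \<open>h n\<close> and are bounded by their sup norms, so uniform convergence of
    \<open>h\<close> makes \<open>B\<close> a Cauchy sequence.\<close>
  have BB: "norm (B m - B n) \<le> inverse (real (Suc m)) + inverse (real (Suc n))" for m n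
  proof (rule fc_symbol_norm_le[OF V])
    have "fc_symbol V (\<lambda>z. h m z + (- 1) * h n z) (B m + scalar (- 1) * B n)"
      by (intro fc_symbol_add fc_symbol_mult fc_symbol_const hB h)
    then show "fc_symbol V (\<lambda>z. h m z - h n z) (B m - B n)"
      by (simp add: scalar_minus)
    fix z assume "z \<in> circle"
    then have "cmod (g z - h n z) \<le> inverse (real (Suc n))" "cmod (g z - h m z) \<le> inverse (real (Suc m))"
      using hB2 by auto
    moreover have "cmod (h m z - h n z) \<le> cmod (g z - h n z) + cmod (g z - h m z)"
      using norm_triangle_ineq4[of "g z - h n z" "g z - h m z"] by simp
    ultimately show "cmod (h m z - h n z) \<le> inverse (real (Suc m)) + inverse (real (Suc n))"
      by linarith
  qed
  have inv0: "(\<lambda>n. inverse (real (Suc n))) \<longlonglongrightarrow> 0" by (rule LIMSEQ_inverse_real_of_nat)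
  have "Cauchy B"
    unfolding Cauchy_def
  proof (intro allI impI)
    fix e :: real assume "e > 0"
    then have "\<forall>\<^sub>F n in sequentially. inverse (real (Suc n)) < e / 2"
      using inv0 by (intro order_tendstoD) auto
    then obtain M where M: "\<And>n. n \<ge> M \<Longrightarrow> inverse (real (Suc n)) < e / 2"
      by (auto simp: eventually_at_top_linorder)
    have "dist (B m) (B n) < e" if "m \<ge> M" "n \<ge> M" for m n
      using BB[of m n] M[OF that(1)] M[OF that(2)] unfolding dist_norm by linarith
    then show "\<exists>M. \<forall>m\<ge>M. \<forall>n\<ge>M. dist (B m) (B n) < e" by blast
  qed
  then obtain A where A: "B \<longlonglongrightarrow> A" by (auto simp: Cauchy_convergent_iff convergent_def)
  have "fc_symbol V g A"
    unfolding fc_symbol_def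
  proof (intro allI impI)
    fix f :: "complex \<Rightarrow> complex" and K assume K: "\<forall>z\<in>circle. cmod (f z) \<le> K"
    have K0: "0 \<le> K" using K[rule_format, of 1] norm_ge_zero[of "f 1"] by (simp del: norm_ge_zero)
    show "(\<lambda>N. fc_approx V N (\<lambda>z. g z * f z) - A * fc_approx V N f) \<longlonglongrightarrow> 0"
      unfolding tendsto_iff
    proof (intro allI impI)
      fix e :: real assume e: "e > 0"
      have "(\<lambda>n. inverse (real (Suc n)) * K + norm (B n - A) * K) \<longlonglongrightarrow> 0 * K + norm (A - A) * K"
        by (intro tendsto_intros A inv0)
      then have "\<forall>\<^sub>F n in sequentially. inverse (real (Suc n)) * K + norm (B n - A) * K < e / 2"
        using e by (intro order_tendstoD) auto
      \<comment> \<open>\<open>n\<close> is fixed before \<open>N\<close>: of the three terms below,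
        the first and the last are small for every \<open>N\<close>, and the middle one tends to
        0.\<close>
      then obtain n where n: "inverse (real (Suc n)) * K + norm (B n - A) * K < e / 2"
        by (auto simp: eventually_at_top_linorder)
      have "(\<lambda>N. fc_approx V N (\<lambda>z. h n z * f z) - B n * fc_approx V N f) \<longlonglongrightarrow> 0"
        using K by (intro fc_symbolD[OF hB]) blast
      then have "\<forall>\<^sub>F N in sequentially. dist (fc_approx V N (\<lambda>z. h n z * f z) - B n * fc_approx V N f) 0 < e / 2"
        by (rule tendstoD) (use e in simp)
      then show "\<forall>\<^sub>F N in sequentially. dist (fc_approx V N (\<lambda>z. g z * f z) - A * fc_approx V N f) 0 < e"
      proof eventually_elim
        case (elim N)
        have 1: "norm (fc_approx V N (\<lambda>z. (g z - h n z) * f z)) \<le> inverse (real (Suc n)) * K"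
          using hB2 K K0 by (intro norm_fc_approx_le[OF V]) (auto simp: norm_mult simp del: of_nat_Suc intro!: mult_mono)
        have "norm ((B n - A) * fc_approx V N f) \<le> norm (B n - A) * norm (fc_approx V N f)"
          by (rule norm_mult_ineq)
        also have "\<dots> \<le> norm (B n - A) * K"
          using K K0 by (intro mult_left_mono norm_fc_approx_le[OF V]) auto
        finally have 2: "norm ((B n - A) * fc_approx V N f) \<le> norm (B n - A) * K" .
        have "fc_approx V N (\<lambda>z. g z * f z) - A * fc_approx V N f = fc_approx V N (\<lambda>z. (g z - h n z) * f z) +
            (fc_approx V N (\<lambda>z. h n z * f z) - B n * fc_approx V N f) + (B n - A) * fc_approx V N f"
          by (simp add: left_diff_distrib fc_approx_diff)
        then have "norm (fc_approx V N (\<lambda>z. g z * f z) - A * fc_approx V N f) \<le>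
            norm (fc_approx V N (\<lambda>z. (g z - h n z) * f z)) +
            norm (fc_approx V N (\<lambda>z. h n z * f z) - B n * fc_approx V N f) + norm ((B n - A) * fc_approx V N f)"
          by (simp only:) (rule norm_triangle_le[OF add_right_mono[OF norm_triangle_ineq]])
        with 1 2 n elim show ?case by (simp add: dist_norm)
      qed
    qed
  qed
  then show ?case by blast
qed

section \<open>The functional calculus and its characterisation\<close>

definition fc :: "bop \<Rightarrow> (complex \<Rightarrow> complex) \<Rightarrow> bop" where
  "fc V f = lim (\<lambda>N. fc_approx V N f)"

lemma fc_symbol_fc:
  assumes "unitary V" "continuous_on circle f"
  shows "fc_symbol V f (fc V f)"
proof -
  obtain A where A: "fc_symbol V f A" using fc_symbol_exists[OF assms] by blast
  have "fc V f = A" unfolding fc_def by (rule limI[OF fc_symbol_tendsto[OF assms(1) A]])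
  with A show ?thesis by simp
qed

lemma fc_eqI: "unitary V \<Longrightarrow> fc_symbol V f A \<Longrightarrow> fc V f = A"
  unfolding fc_def by (rule limI[OF fc_symbol_tendsto])

context
  fixes V assumes V: "unitary V"
begin

lemma fc_const: "fc V (\<lambda>_. c) = scalar c"
  by (rule fc_eqI[OF V fc_symbol_const])

lemma fc_id: "fc V (\<lambda>z. z) = V"
  by (rule fc_eqI[OF V]) (unfold fc_symbol_def, use fc_approx_shift_tendsto(1)[OF V] in blast)

lemma fc_cnj_id: "fc V (\<lambda>z. cnj z) = adj V"
  by (rule fc_eqI[OF V]) (unfold fc_symbol_def, use fc_approx_shift_tendsto(2)[OF V] in blast)

lemma fc_add:
  "continuous_on circle f \<Longrightarrow> continuous_on circle g \<Longrightarrow> fc V (\<lambda>z. f z + g z) = fc V f + fc V g"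
  by (rule fc_eqI[OF V]) (intro fc_symbol_add fc_symbol_fc V)

lemma fc_mult:
  "continuous_on circle f \<Longrightarrow> continuous_on circle g \<Longrightarrow> fc V (\<lambda>z. f z * g z) = fc V f * fc V g"
  by (rule fc_eqI[OF V]) (intro fc_symbol_mult fc_symbol_fc V)

lemma fc_cmult: "continuous_on circle f \<Longrightarrow> fc V (\<lambda>z. c * f z) = scalar c * fc V f"
  using fc_mult[of "\<lambda>_. c" f] by (simp add: fc_const)

lemma fc_diff:
  "continuous_on circle f \<Longrightarrow> continuous_on circle g \<Longrightarrow> fc V (\<lambda>z. f z - g z) = fc V f - fc V g"
  using fc_add[of f "\<lambda>z. (- 1) * g z"] fc_cmult[of g "- 1"]
  by (simp add: scalar_minus continuous_on_minus)

lemma fc_cnj: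
  assumes "continuous_on circle f"
  shows "fc V (\<lambda>z. cnj (f z)) = adj (fc V f)"
  unfolding fc_def[of V "\<lambda>z. cnj (f z)"] adj_fc_approx[symmetric]
  by (rule limI[OF tendsto_adj[OF fc_symbol_tendsto[OF V fc_symbol_fc[OF V assms]]]])

lemma norm_fc_le:
  "continuous_on circle f \<Longrightarrow> (\<And>z. z \<in> circle \<Longrightarrow> cmod (f z) \<le> K) \<Longrightarrow> norm (fc V f) \<le> K"
  by (rule fc_symbol_norm_le[OF V fc_symbol_fc[OF V]])

lemma fc_cong:
  assumes "continuous_on circle f" "\<And>z. z \<in> circle \<Longrightarrow> f z = g z"
  shows "fc V f = fc V g"
proof -
  have "continuous_on circle g" using assms continuous_on_cong by metis
  then have "continuous_on circle (\<lambda>z. f z - g z)"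
    by (intro continuous_on_diff assms(1))
  then have "norm (fc V (\<lambda>z. f z - g z)) \<le> 0"
    by (rule norm_fc_le) (simp add: assms(2))
  then show ?thesis using fc_diff[OF assms(1) \<open>continuous_on circle g\<close>] by simp
qed

text \<open>Agreement on constants, \<open>z\<close> and \<open>cnj z\<close> spreads to all
  continuous functions by \<open>circle_function_induct\<close>. It serves twice: to compute the
  calculus of a diagonal operator, and for the uniqueness that the definite description in
  \<open>cfc\<close> demands.\<close>

lemma fc_unique:
  assumes const: "\<And>c. F (\<lambda>_. c) = scalar c" and id: "F (\<lambda>z. z) = V" and cnj: "F (\<lambda>z. cnj z) = adj V"
    and add: "\<And>f g. continuous_on circle f \<Longrightarrow> continuous_on circle g \<Longrightarrow> F (\<lambda>z. f z + g z) = F f + F g"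
    and mult: "\<And>f g. continuous_on circle f \<Longrightarrow> continuous_on circle g \<Longrightarrow> F (\<lambda>z. f z * g z) = F f * F g"
    and norm: "\<And>f K. continuous_on circle f \<Longrightarrow> (\<And>z. z \<in> circle \<Longrightarrow> cmod (f z) \<le> K) \<Longrightarrow> norm (F f) \<le> K"
    and "continuous_on circle f"
  shows "F f = fc V f"
  using assms(7)
proof (induction f rule: circle_function_induct)
  case (lim f)
  have F_diff: "F (\<lambda>z. f z - g z) = F f - F g" if "continuous_on circle f" "continuous_on circle g" for f g
    using add[of f "\<lambda>z. (- 1) * g z"] mult[of "\<lambda>_. - 1" g] const[of "- 1"] that
    by (simp add: scalar_minus continuous_on_minus)
  have "norm (F f - fc V f) \<le> e" if e: "e > 0" for e
  proof -
    obtain g where g: "continuous_on circle g" "F g = fc V g" "\<forall>z\<in>circle. cmod (f z - g z) \<le> e / 2"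
      using lim.IH[OF half_gt_zero[OF e]] by blast
    have "continuous_on circle (\<lambda>z. f z - g z)" using lim.hyps g by (intro continuous_intros)
    then have "norm (F (\<lambda>z. f z - g z)) \<le> e / 2" "norm (fc V (\<lambda>z. f z - g z)) \<le> e / 2"
      using g(3) by (blast intro: norm norm_fc_le)+
    then have "norm ((F f - F g) - (fc V f - fc V g)) \<le> e"
      unfolding F_diff[OF lim.hyps g(1)] fc_diff[OF lim.hyps g(1)]
      using norm_triangle_ineq4[of "F f - F g" "fc V f - fc V g"] by linarith
    then show ?thesis by (simp add: g(2))
  qed
  then have "norm (F f - fc V f) \<le> 0" by (rule field_le_epsilon[of _ 0, simplified])
  then show ?case by simp
qed (simp_all add: const id cnj add mult fc_const fc_id fc_cnj_id fc_add fc_mult)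

end

section \<open>Diagonal operators and divided differences\<close>

definition diag_op :: "(nat \<Rightarrow> complex) \<Rightarrow> bop" where
  "diag_op d = (SOME A. \<forall>x n. coord (A \<cdot> x) n = d n * coord x n)"

lemma norm_le_coordwise:
  assumes "\<And>n. cmod (coord y n) \<le> K * cmod (coord x n)" "0 \<le> K"
  shows "norm y \<le> K * norm x"
proof -
  have "(norm y)\<^sup>2 \<le> K\<^sup>2 * (norm x)\<^sup>2"
  proof (rule sums_le[OF _ norm_sums sums_mult[OF norm_sums]])
    show "(cmod (coord y n))\<^sup>2 \<le> K\<^sup>2 * (cmod (coord x n))\<^sup>2" for n
      using power_mono[OF assms(1), of n 2] by (simp add: power_mult_distrib)
  qed
  then have "(norm y)\<^sup>2 \<le> (K * norm x)\<^sup>2" by (simp add: power_mult_distrib)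
  then show ?thesis using assms(2) by (simp add: power2_le_iff_abs_le)
qed

lemma coord_diag_op:
  assumes "\<And>n. cmod (d n) \<le> K"
  shows "coord (diag_op d \<cdot> x) n = d n * coord x n"
proof -
  have sm: "summable (\<lambda>n. (cmod (d n * coord x n))\<^sup>2)" for x
    by (rule square_summable_mult[OF summable_coord assms])
  define F where "F x = Abs_ell2 (\<lambda>n. d n * coord x n)" for x
  have cF: "coord (F x) n = d n * coord x n" for x n
    by (simp add: F_def Abs_ell2_inverse sm)
  have "\<exists>A. \<forall>x. A \<cdot> x = F x"
  proof (rule bop_exists)
    show "F (x + y) = F x + F y" "F (c *\<^sub>C x) = c *\<^sub>C F x" for x y c
      by (rule ell2_eqI; simp add: cF algebra_simps)+
    have "0 \<le> K" using assms[of 0] norm_ge_zero[of "d 0"] by linarith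
    then show "norm (F x) \<le> K * norm x" for x
      using assms by (intro norm_le_coordwise) (auto simp: cF norm_mult intro!: mult_right_mono)
  qed
  then have "\<exists>A. \<forall>x n. coord (A \<cdot> x) n = d n * coord x n" by (metis cF)
  then show ?thesis unfolding diag_op_def by (rule someI2_ex) blast
qed

lemma norm_diag_op_app_le:
  assumes "\<And>n. cmod (d n) \<le> K"
  shows "norm (diag_op d \<cdot> x) \<le> K * norm x"
proof -
  have "0 \<le> K" using assms[of 0] norm_ge_zero[of "d 0"] by linarith
  then show ?thesis
    using assms by (intro norm_le_coordwise)
      (auto simp: coord_diag_op[of d K, OF assms] norm_mult intro!: mult_right_mono)
qed

lemma diag_op_basis:
  assumes "\<And>n. cmod (d n) \<le> K"
  shows "diag_op d \<cdot> basis_vec k = d k *\<^sub>C basis_vec k"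
  by (rule ell2_eqI) (simp add: coord_diag_op[of d K, OF assms])

locale circle_diagonal =
  fixes l :: "nat \<Rightarrow> complex"
  assumes circle: "\<And>n. l n \<in> circle"
begin

lemma cmod_l [simp]: "cmod (l n) = 1"
  using circle[of n] by simp

definition U where "U = diag_op l"

lemma coord_U: "coord (U \<cdot> x) n = l n * coord x n"
  unfolding U_def by (rule coord_diag_op[of l 1]) simp

lemma U_basis: "U \<cdot> basis_vec k = l k *\<^sub>C basis_vec k"
  unfolding U_def by (rule diag_op_basis[of l 1]) simp

lemma adj_U: "adj U = diag_op (\<lambda>n. cnj (l n))"
proof (rule adj_unique)
  show "ip (U \<cdot> x) y = ip x (diag_op (\<lambda>n. cnj (l n)) \<cdot> y)" for x y
    by (simp add: ip_def coord_U coord_diag_op[of "\<lambda>n. cnj (l n)" 1] mult_ac)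
qed

lemma unitary_U: "unitary U"
proof -
  have "coord ((adj U * U) \<cdot> x) n = coord x n" "coord ((U * adj U) \<cdot> x) n = coord x n" for x n
    by (simp_all add: adj_U coord_U coord_diag_op[of "\<lambda>n. cnj (l n)" 1] mult.assoc[symmetric] mult_cnj_cmod)
  then have "(adj U * U) \<cdot> x = 1 \<cdot> x" "(U * adj U) \<cdot> x = 1 \<cdot> x" for x
    by (simp_all add: ell2_eqI)
  then show ?thesis unfolding unitary_def by (blast intro: bop_eqI)
qed

text \<open>Applying \<open>f\<close> to the diagonal entries has all the properties that
  characterise the calculus.\<close>

lemma coord_fc_U:
  assumes "continuous_on circle f"
  shows "coord (fc U f \<cdot> x) n = f (l n) * coord x n"
proof -
  let ?F = "\<lambda>f. diag_op (\<lambda>n. f (l n))"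
  have c: "coord (?F f \<cdot> x) n = f (l n) * coord x n" if f: "continuous_on circle f" for f x n
  proof -
    obtain K where "\<And>z. z \<in> circle \<Longrightarrow> cmod (f z) \<le> K" using circle_function_bounded[OF f] by blast
    then show ?thesis using circle by (intro coord_diag_op[of _ K]) blast
  qed
  have "?F f = fc U f"
  proof (rule fc_unique[OF unitary_U _ _ _ _ _ _ assms])
    show "?F (\<lambda>_. a) = scalar a" for a
      using c[of "\<lambda>_. a"] by (intro bop_eqI ell2_eqI) simp
    show "?F (\<lambda>z. z) = U" by (simp add: U_def)
    show "?F cnj = adj U" by (simp add: adj_U)
    show "?F (\<lambda>z. f z + g z) = ?F f + ?F g" if "continuous_on circle f" "continuous_on circle g" for f g
      using that c[of "\<lambda>z. f z + g z"]
      by (intro bop_eqI ell2_eqI) (simp add: c app_add_left distrib_right continuous_on_add)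
    show "?F (\<lambda>z. f z * g z) = ?F f * ?F g" if "continuous_on circle f" "continuous_on circle g" for f g
      using that c[of "\<lambda>z. f z * g z"]
      by (intro bop_eqI ell2_eqI) (simp add: c mult.assoc continuous_on_mult)
    show "norm (?F f) \<le> K" if "continuous_on circle f" "\<And>z. z \<in> circle \<Longrightarrow> cmod (f z) \<le> K" for f K
    proof (rule norm_bop_le)
      show "0 \<le> K" using that(2)[OF circle[of 0]] norm_ge_zero[of "f (l 0)"] by linarith
      show "norm (?F f \<cdot> x) \<le> K * norm x" for x
        by (rule norm_diag_op_app_le) (use that circle in blast)
    qed
  qed
  then show ?thesis using c[OF assms, of x n] by simp
qed

lemma fc_U_basis:
  "continuous_on circle f \<Longrightarrow> fc U f \<cdot> basis_vec k = f (l k) *\<^sub>C basis_vec k"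
  by (rule ell2_eqI) (simp add: coord_fc_U)

end

section \<open>Operators compared on a block of coordinates\<close>

definition supp_on :: "nat set \<Rightarrow> ell2 \<Rightarrow> bool" where
  "supp_on S x \<longleftrightarrow> (\<forall>n. n \<notin> S \<longrightarrow> coord x n = 0)"

lemma supp_on_UNIV [simp]: "supp_on UNIV x"
  by (simp add: supp_on_def)

lemma supp_on_intros [intro]:
  "supp_on S x \<Longrightarrow> supp_on S y \<Longrightarrow> supp_on S (x + y)" "supp_on S x \<Longrightarrow> supp_on S (c *\<^sub>C x)"
  "k \<in> S \<Longrightarrow> supp_on S (basis_vec k)" "supp_on S 0"
  by (auto simp: supp_on_def)

text \<open>A local substitute for the norm of \<open>A - B\<close>: the perturbation is small on
  each chosen block without being small on the whole space.\<close>

definition close_on :: "nat set \<Rightarrow> real \<Rightarrow> bop \<Rightarrow> bop \<Rightarrow> bool" where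
  "close_on S e A B \<longleftrightarrow> (\<forall>x. supp_on S x \<longrightarrow> norm (A \<cdot> x - B \<cdot> x) \<le> e * norm x)"

lemma close_onD: "close_on S e A B \<Longrightarrow> supp_on S x \<Longrightarrow> norm (A \<cdot> x - B \<cdot> x) \<le> e * norm x"
  by (simp add: close_on_def)

lemma close_on_mono: "close_on S d A B \<Longrightarrow> d \<le> e \<Longrightarrow> close_on S e A B"
  unfolding close_on_def by (meson mult_right_mono norm_ge_zero order_trans)

lemma close_on_add:
  assumes "close_on S d A A'" "close_on S e B B'"
  shows "close_on S (d + e) (A + B) (A' + B')"
  unfolding close_on_def
proof (intro allI impI)
  fix x assume x: "supp_on S x"
  have "(A + B) \<cdot> x - (A' + B') \<cdot> x = (A \<cdot> x - A' \<cdot> x) + (B \<cdot> x - B' \<cdot> x)"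
    by (simp add: app_add_left)
  then show "norm ((A + B) \<cdot> x - (A' + B') \<cdot> x) \<le> (d + e) * norm x"
    using norm_triangle_mono[OF close_onD[OF assms(1) x] close_onD[OF assms(2) x]]
    by (simp add: distrib_right)
qed

text \<open>\<open>A B - A' B' = A (B - B') + (A - A') B'\<close>. With this splitting it is the
  unperturbed factor \<open>B'\<close> that has to preserve the block, and in the application it is
  diagonal.\<close>

lemma close_on_mult:
  assumes A: "close_on S d A A'" and B: "close_on S e B B'" and S: "\<And>x. supp_on S x \<Longrightarrow> supp_on S (B' \<cdot> x)"
    and d: "0 \<le> d"
  shows "close_on S (norm A * e + d * norm B') (A * B) (A' * B')"
  unfolding close_on_def
proof (intro allI impI)
  fix x assume x: "supp_on S x"
  have 1: "norm (A \<cdot> (B \<cdot> x - B' \<cdot> x)) \<le> norm A * (e * norm x)"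
    by (rule order_trans[OF norm_app_le]) (intro mult_left_mono close_onD[OF B x] norm_ge_zero)
  have 2: "norm (A \<cdot> B' \<cdot> x - A' \<cdot> B' \<cdot> x) \<le> d * (norm B' * norm x)"
    by (rule order_trans[OF close_onD[OF A S[OF x]]]) (intro mult_left_mono norm_app_le d)
  have eq: "(A * B) \<cdot> x - (A' * B') \<cdot> x = A \<cdot> (B \<cdot> x - B' \<cdot> x) + (A \<cdot> B' \<cdot> x - A' \<cdot> B' \<cdot> x)"
    by (simp add: app_diff_right)
  show "norm ((A * B) \<cdot> x - (A' * B') \<cdot> x) \<le> (norm A * e + d * norm B') * norm x"
    unfolding eq using norm_triangle_mono[OF 1 2] by (simp only: distrib_right mult.assoc)
qed

text \<open>\<open>adj V - adj U = - adj V (V - U) adj U\<close>: the factor \<open>adj U\<close>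
  keeps vectors in the block and \<open>adj V\<close> is isometric, so no constant is lost.\<close>

lemma close_on_adj:
  assumes V: "unitary V" and U: "unitary U" and "close_on S e V U" and S: "\<And>x. supp_on S x \<Longrightarrow> supp_on S (adj U \<cdot> x)"
  shows "close_on S e (adj V) (adj U)"
  unfolding close_on_def
proof (intro allI impI)
  fix x assume x: "supp_on S x"
  have "adj V \<cdot> V \<cdot> adj U \<cdot> x = (adj V * V) \<cdot> adj U \<cdot> x" "U \<cdot> adj U \<cdot> x = (U * adj U) \<cdot> x" by simp_all
  then have "adj V \<cdot> x - adj U \<cdot> x = - (adj V \<cdot> (V \<cdot> adj U \<cdot> x - U \<cdot> adj U \<cdot> x))"
    using V U by (simp add: unitary_def app_diff_right del: app_simps(4))
  then have "norm (adj V \<cdot> x - adj U \<cdot> x) = norm (V \<cdot> adj U \<cdot> x - U \<cdot> adj U \<cdot> x)"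
    using norm_unitary_app[OF unitary_adj[OF V]] by simp
  also have "\<dots> \<le> e * norm (adj U \<cdot> x)" by (rule close_onD[OF assms(3) S[OF x]])
  also have "norm (adj U \<cdot> x) = norm x" by (rule norm_unitary_app[OF unitary_adj[OF U]])
  finally show "norm (adj V \<cdot> x - adj U \<cdot> x) \<le> e * norm x" .
qed

lemma close_on_norm_diff:
  assumes "norm (A - B) \<le> e"
  shows "close_on S e A B"
  unfolding close_on_def app_diff_left[symmetric]
  by (meson assms mult_right_mono norm_app_le norm_ge_zero order_trans)

lemma close_on_trans:
  assumes "close_on S d A B" "close_on S e B C"
  shows "close_on S (d + e) A C"
  unfolding close_on_def
proof (intro allI impI)
  fix x assume x: "supp_on S x"
  have "A \<cdot> x - C \<cdot> x = (A \<cdot> x - B \<cdot> x) + (B \<cdot> x - C \<cdot> x)" by simp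
  then show "norm (A \<cdot> x - C \<cdot> x) \<le> (d + e) * norm x"
    using norm_triangle_mono[OF close_onD[OF assms(1) x] close_onD[OF assms(2) x]] by (simp add: distrib_right)
qed

text \<open>The threshold \<open>\<delta>\<close> depends on \<open>f\<close> only, not on the unitaries or on the coordinate block \<open>S\<close>.\<close>

definition block_continuous :: "(complex \<Rightarrow> complex) \<Rightarrow> bool" where
  "block_continuous f \<longleftrightarrow> (\<forall>e>0. \<exists>\<delta>>0. \<forall>V l S. unitary V \<longrightarrow> circle_diagonal l \<longrightarrow>
     close_on S \<delta> V (circle_diagonal.U l) \<longrightarrow> close_on S e (fc V f) (fc (circle_diagonal.U l) f))"

lemma block_continuousI:
  assumes "\<And>e. e > 0 \<Longrightarrow> \<exists>\<delta>>0. \<forall>V l S. unitary V \<longrightarrow> circle_diagonal l \<longrightarrow>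
     close_on S \<delta> V (circle_diagonal.U l) \<longrightarrow> close_on S e (fc V f) (fc (circle_diagonal.U l) f)"
  shows "block_continuous f"
  using assms unfolding block_continuous_def by blast

lemma block_continuousE:
  assumes "block_continuous f" "e > 0"
  obtains \<delta> where "\<delta> > 0" "\<And>V l S. unitary V \<Longrightarrow> circle_diagonal l \<Longrightarrow>
     close_on S \<delta> V (circle_diagonal.U l) \<Longrightarrow> close_on S e (fc V f) (fc (circle_diagonal.U l) f)"
  using assms unfolding block_continuous_def by blast

text \<open>All constants in the induction are sup norms of functions on the circle, and these bound
  the calculus of every unitary at once. This is what makes \<delta> independent of
  \<open>V\<close>, \<open>l\<close> and \<open>S\<close>.\<close>

lemma block_continuous_fc:
  assumes "continuous_on circle f"
  shows "block_continuous f"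
  using assms
proof (induction f rule: circle_function_induct)
  case (const c)
  show ?case
    by (intro block_continuousI exI[of _ 1]) (simp add: fc_const circle_diagonal.unitary_U close_on_def)
next
  case id
  show ?case
    unfolding block_continuous_def by (metis fc_id circle_diagonal.unitary_U)
next
  case cnj
  show ?case
  proof (rule block_continuousI)
    fix e :: real assume "e > 0"
    have "close_on S e (fc V cnj) (fc (circle_diagonal.U l) cnj)"
      if V: "unitary V" and l: "circle_diagonal l" and c: "close_on S e V (circle_diagonal.U l)" for V l S
    proof -
      interpret circle_diagonal l by fact
      have "supp_on S (adj U \<cdot> x)" if "supp_on S x" for x
        using that by (auto simp: supp_on_def adj_U coord_diag_op[of "\<lambda>n. cnj (l n)" 1])
      from close_on_adj[OF V unitary_U c this] show ?thesis by (simp add: fc_cnj_id V unitary_U)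
    qed
    then show "\<exists>\<delta>>0. \<forall>V l S. unitary V \<longrightarrow> circle_diagonal l \<longrightarrow>
        close_on S \<delta> V (circle_diagonal.U l) \<longrightarrow> close_on S e (fc V cnj) (fc (circle_diagonal.U l) cnj)"
      using \<open>e > 0\<close> by blast
  qed
next
  case (add f g)
  show ?case
  proof (rule block_continuousI)
    fix e :: real assume e: "e > 0"
    obtain d1 where d1: "d1 > 0" "\<And>V l S. unitary V \<Longrightarrow> circle_diagonal l \<Longrightarrow>
        close_on S d1 V (circle_diagonal.U l) \<Longrightarrow> close_on S (e / 2) (fc V f) (fc (circle_diagonal.U l) f)"
      using block_continuousE[OF add.IH(1) half_gt_zero[OF e]] by blast
    obtain d2 where d2: "d2 > 0" "\<And>V l S. unitary V \<Longrightarrow> circle_diagonal l \<Longrightarrow>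
        close_on S d2 V (circle_diagonal.U l) \<Longrightarrow> close_on S (e / 2) (fc V g) (fc (circle_diagonal.U l) g)"
      using block_continuousE[OF add.IH(2) half_gt_zero[OF e]] by blast
    have "close_on S e (fc V (\<lambda>z. f z + g z)) (fc (circle_diagonal.U l) (\<lambda>z. f z + g z))"
      if V: "unitary V" and l: "circle_diagonal l" and c: "close_on S (min d1 d2) V (circle_diagonal.U l)" for V l S
      using close_on_add[OF d1(2)[OF V l close_on_mono[OF c]] d2(2)[OF V l close_on_mono[OF c]]]
      by (simp add: fc_add[OF V add.hyps] fc_add[OF circle_diagonal.unitary_U[OF l] add.hyps])
    then show "\<exists>\<delta>>0. \<forall>V l S. unitary V \<longrightarrow> circle_diagonal l \<longrightarrow> close_on S \<delta> V (circle_diagonal.U l) \<longrightarrow>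
        close_on S e (fc V (\<lambda>z. f z + g z)) (fc (circle_diagonal.U l) (\<lambda>z. f z + g z))"
      using d1(1) d2(1) by (intro exI[of _ "min d1 d2"]) simp
  qed
next
  case (mult f g)
  obtain K where K: "0 \<le> K" "\<And>z. z \<in> circle \<Longrightarrow> cmod (f z) \<le> K"
    using circle_function_bounded[OF mult.hyps(1)] by blast
  obtain L where L: "0 \<le> L" "\<And>z. z \<in> circle \<Longrightarrow> cmod (g z) \<le> L"
    using circle_function_bounded[OF mult.hyps(2)] by blast
  show ?case
  proof (rule block_continuousI)
    fix e :: real assume e: "e > 0"
    \<comment> \<open>Chosen for \<open>K e' + e' L \<le> e\<close>; the summand 1 keeps the
      denominator positive.\<close>
    define e' where "e' = e / (K + L + 1)"
    have e': "e' > 0" using e K L by (simp add: e'_def)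
    obtain d1 where d1: "d1 > 0" "\<And>V l S. unitary V \<Longrightarrow> circle_diagonal l \<Longrightarrow>
        close_on S d1 V (circle_diagonal.U l) \<Longrightarrow> close_on S e' (fc V f) (fc (circle_diagonal.U l) f)"
      using block_continuousE[OF mult.IH(1) e'] by blast
    obtain d2 where d2: "d2 > 0" "\<And>V l S. unitary V \<Longrightarrow> circle_diagonal l \<Longrightarrow>
        close_on S d2 V (circle_diagonal.U l) \<Longrightarrow> close_on S e' (fc V g) (fc (circle_diagonal.U l) g)"
      using block_continuousE[OF mult.IH(2) e'] by blast
    have "close_on S e (fc V (\<lambda>z. f z * g z)) (fc (circle_diagonal.U l) (\<lambda>z. f z * g z))"
      if V: "unitary V" and l: "circle_diagonal l" and c: "close_on S (min d1 d2) V (circle_diagonal.U l)" for V l S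
    proof -
      interpret circle_diagonal l by fact
      have "close_on S (norm (fc V f) * e' + e' * norm (fc U g)) (fc V f * fc V g) (fc U f * fc U g)"
      proof (rule close_on_mult)
        show "supp_on S (fc U g \<cdot> x)" if "supp_on S x" for x
          using that by (simp add: supp_on_def coord_fc_U[OF mult.hyps(2)])
        show "close_on S e' (fc V f) (fc U f)" by (rule d1(2)[OF V l close_on_mono[OF c]]) simp
        show "close_on S e' (fc V g) (fc U g)" by (rule d2(2)[OF V l close_on_mono[OF c]]) simp
      qed (use e' in simp)
      moreover have "norm (fc V f) * e' + e' * norm (fc U g) \<le> e"
      proof -
        have "norm (fc V f) * e' + e' * norm (fc U g) \<le> K * e' + e' * L"
          using e' by (intro add_mono mult_left_mono mult_right_mono norm_fc_le V unitary_U mult.hyps K L) auto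
        also have "\<dots> \<le> (K + L + 1) * e'" using e' by (simp add: algebra_simps)
        also have "\<dots> = e" using K(1) L(1) by (simp add: e'_def)
        finally show ?thesis .
      qed
      ultimately show ?thesis
        unfolding fc_mult[OF V mult.hyps] fc_mult[OF unitary_U mult.hyps] by (rule close_on_mono)
    qed
    then show "\<exists>\<delta>>0. \<forall>V l S. unitary V \<longrightarrow> circle_diagonal l \<longrightarrow> close_on S \<delta> V (circle_diagonal.U l) \<longrightarrow>
        close_on S e (fc V (\<lambda>z. f z * g z)) (fc (circle_diagonal.U l) (\<lambda>z. f z * g z))"
      using d1(1) d2(1) by (intro exI[of _ "min d1 d2"]) simp
  qed
next
  case (lim f)
  show ?case
  proof (rule block_continuousI)
    fix e :: real assume "e > 0"
    then have e3: "e / 3 > 0" by simp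
    from lim.IH[OF this] obtain g
      where g: "continuous_on circle g" "block_continuous g" "\<forall>z\<in>circle. cmod (f z - g z) \<le> e / 3"
      by (elim exE conjE)
    obtain d where d: "d > 0" "\<And>V l S. unitary V \<Longrightarrow> circle_diagonal l \<Longrightarrow>
        close_on S d V (circle_diagonal.U l) \<Longrightarrow> close_on S (e / 3) (fc V g) (fc (circle_diagonal.U l) g)"
      using block_continuousE[OF g(2) e3] by blast
    have diff: "norm (fc W f - fc W g) \<le> e / 3" if W: "unitary W" for W
    proof -
      have "continuous_on circle (\<lambda>z. f z - g z)" using lim.hyps g(1) by (intro continuous_intros)
      then have "norm (fc W (\<lambda>z. f z - g z)) \<le> e / 3" by (rule norm_fc_le[OF W]) (use g(3) in blast)
      then show ?thesis by (simp only: fc_diff[OF W lim.hyps g(1)])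
    qed
    have "close_on S e (fc V f) (fc (circle_diagonal.U l) f)"
      if V: "unitary V" and l: "circle_diagonal l" and c: "close_on S d V (circle_diagonal.U l)" for V l S
    proof -
      interpret circle_diagonal l by fact
      have "norm (fc U g - fc U f) \<le> e / 3" using diff[OF unitary_U] by (subst norm_minus_commute)
      note close_on_trans[OF close_on_trans[OF close_on_norm_diff[OF diff[OF V]] d(2)[OF V l c]] close_on_norm_diff[OF this]]
      then show ?thesis by simp
    qed
    then show "\<exists>\<delta>>0. \<forall>V l S. unitary V \<longrightarrow> circle_diagonal l \<longrightarrow> close_on S \<delta> V (circle_diagonal.U l) \<longrightarrow>
        close_on S e (fc V f) (fc (circle_diagonal.U l) f)"
      using d(1) by blast
  qed
qed

text \<open>If \<open>x\<close> is an eigenvector of a diagonal \<open>U\<close> with eigenvalue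
  \<open>w\<close>, this reads \<open>(f(V) - f(U)) x = p(V) (V - U) x\<close>. The function
  \<open>p\<close> depends on \<open>w\<close> and not on \<open>V\<close>, so the calculus of one
  operator replaces a double operator integral.\<close>

lemma fc_divided_difference:
  assumes V: "unitary V" and f: "continuous_on circle f" and p: "continuous_on circle p"
    and fp: "\<And>z. z \<in> circle \<Longrightarrow> f z - f w = p z * (z - w)"
  shows "fc V f \<cdot> x - f w *\<^sub>C x = fc V p \<cdot> (V \<cdot> x - w *\<^sub>C x)"
proof -
  have "fc V (\<lambda>z. f z - f w) = fc V (\<lambda>z. p z * (z - w))"
    using f fp by (intro fc_cong[OF V]) (auto intro!: continuous_intros)
  moreover have "fc V (\<lambda>z. f z - f w) = fc V f - scalar (f w)"
    using fc_diff[OF V f continuous_on_const] by (simp add: fc_const[OF V])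
  moreover have "fc V (\<lambda>z. p z * (z - w)) = fc V p * fc V (\<lambda>z. z - w)"
    by (intro fc_mult V p continuous_intros)
  moreover have "fc V (\<lambda>z. z - w) = V - scalar w"
    by (subst fc_diff[OF V]) (auto intro!: continuous_intros simp: fc_id[OF V] fc_const[OF V])
  ultimately have "fc V f - scalar (f w) = fc V p * (V - scalar w)" by simp
  from arg_cong[OF this, of "\<lambda>A. A \<cdot> x"] show ?thesis by (simp add: app_diff_left)
qed

section \<open>Hilbert-Schmidt operators and differentiation\<close>

text \<open>Cauchy-Schwarz between the coordinates of \<open>x\<close> and the norms of the columns
  gives both convergence and the norm bound.\<close>

lemma bop_of_columns_exists:
  assumes "summable (\<lambda>k. (norm (d k))\<^sup>2)"
  shows "\<exists>A. (\<forall>k. A \<cdot> basis_vec k = d k) \<and> norm A \<le> sqrt (\<Sum>k. (norm (d k))\<^sup>2)"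
proof -
  define s where "s = sqrt (\<Sum>k. (norm (d k))\<^sup>2)"
  have s: "s \<ge> 0" "s\<^sup>2 = (\<Sum>k. (norm (d k))\<^sup>2)"
    by (simp_all add: s_def suminf_nonneg assms)
  have part: "(\<Sum>k<N. cmod (coord x k) * norm (d k)) \<le> norm x * s" for x N
  proof (rule Cauchy_Schwarz_sum)
    show "(\<Sum>k<N. (cmod (coord x k))\<^sup>2) \<le> (norm x)\<^sup>2" by (rule sum_coord_le) simp
    show "(\<Sum>k<N. (norm (d k))\<^sup>2) \<le> s\<^sup>2" unfolding s(2) by (rule sum_le_suminf[OF assms]) auto
  qed (use s in auto)
  have sm: "summable (\<lambda>k. cmod (coord x k) * norm (d k))" for x
    by (rule summableI_nonneg_bounded[OF _ part]) auto
  have sm': "summable (\<lambda>k. norm (coord x k *\<^sub>C d k))" for x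
    using sm by simp
  define F where "F x = (\<Sum>k. coord x k *\<^sub>C d k)" for x
  have F_le: "norm (F x) \<le> s * norm x" for x
  proof -
    have "norm (F x) \<le> (\<Sum>k. norm (coord x k *\<^sub>C d k))"
      unfolding F_def by (rule summable_norm[OF sm'])
    also have "\<dots> \<le> norm x * s"
      using suminf_le_const[OF sm part, of x] by simp
    finally show ?thesis by (simp add: mult.commute)
  qed
  have "\<exists>A. \<forall>x. A \<cdot> x = F x"
  proof (rule bop_exists)
    show "F (x + y) = F x + F y" for x y
      by (simp add: F_def scaleC_add_left suminf_add[OF summable_norm_cancel[OF sm'] summable_norm_cancel[OF sm']])
    show "F (c *\<^sub>C x) = c *\<^sub>C F x" for c x
      unfolding F_def
      by (subst bounded_linear.suminf[OF bounded_linear_scaleC summable_norm_cancel[OF sm']]) simp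
    show "norm (F x) \<le> s * norm x" for x by (rule F_le)
  qed
  then obtain A where A: "\<And>x. A \<cdot> x = F x" by blast
  have "F (basis_vec k) = d k" for k
  proof -
    have "(\<lambda>n. coord (basis_vec k) n *\<^sub>C d n) sums (\<Sum>n\<in>{k}. coord (basis_vec k) n *\<^sub>C d n)"
      by (rule sums_finite) auto
    then show ?thesis by (simp add: F_def sums_iff)
  qed
  moreover have "norm A \<le> s"
    by (rule norm_bop_le[OF s(1)]) (simp add: A F_le)
  ultimately show ?thesis using A unfolding s_def by (intro exI[of _ A]) simp
qed

text \<open>One half of basis independence: Bessel passes from the vectors
  \<open>A \<cdot> v e\<close> to the columns of \<open>adj A\<close>, and exchanging rows and
  columns leads back to those of \<open>A\<close>. Cutting at \<open>k < N\<close> keeps the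
  interchange of sums elementary.\<close>

lemma sum_norm_orthonormal_le:
  assumes "summable (\<lambda>k. (norm (A \<cdot> basis_vec k))\<^sup>2)" "finite F"
    and on: "\<And>e e'. e \<in> F \<Longrightarrow> e' \<in> F \<Longrightarrow> ip (v e) (v e') = (if e = e' then 1 else 0)"
  shows "(\<Sum>e\<in>F. (norm (A \<cdot> v e))\<^sup>2) \<le> (\<Sum>k. (norm (A \<cdot> basis_vec k))\<^sup>2)"
proof -
  have part: "(\<Sum>k<N. \<Sum>e\<in>F. (cmod (coord (A \<cdot> v e) k))\<^sup>2) \<le> (\<Sum>k. (norm (A \<cdot> basis_vec k))\<^sup>2)" for N
  proof -
    have "(\<Sum>e\<in>F. (cmod (coord (A \<cdot> v e) k))\<^sup>2) \<le> (norm (adj A \<cdot> basis_vec k))\<^sup>2" for k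
    proof -
      have "coord (A \<cdot> v e) k = ip (v e) (adj A \<cdot> basis_vec k)" for e
        unfolding ip_app_left[symmetric] by simp
      then have "cmod (coord (A \<cdot> v e) k) = cmod (ip (adj A \<cdot> basis_vec k) (v e))" for e
        using ip_commute[of "v e"] by (metis complex_mod_cnj)
      then show ?thesis using orthonormal_Bessel[OF assms(2) on, of "adj A \<cdot> basis_vec k"] by simp
    qed
    then have "(\<Sum>k<N. \<Sum>e\<in>F. (cmod (coord (A \<cdot> v e) k))\<^sup>2) \<le> (\<Sum>k<N. (norm (adj A \<cdot> basis_vec k))\<^sup>2)"
      by (rule sum_mono)
    also have "\<dots> = (\<Sum>j. \<Sum>k<N. (cmod (coord (adj A \<cdot> basis_vec k) j))\<^sup>2)"
      by (subst suminf_sum[OF summable_coord]) (use norm_sums in \<open>auto simp: sums_iff\<close>)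
    also have "\<dots> \<le> (\<Sum>j. (norm (A \<cdot> basis_vec j))\<^sup>2)"
    proof (rule suminf_le[OF _ summable_sum[OF summable_coord] assms(1)])
      fix j
      have "coord (adj A \<cdot> basis_vec k) j = cnj (coord (A \<cdot> basis_vec j) k)" for k
        using ip_app_right[of "basis_vec k" A "basis_vec j"] by simp
      then have "(\<Sum>k<N. (cmod (coord (adj A \<cdot> basis_vec k) j))\<^sup>2) = (\<Sum>k<N. (cmod (coord (A \<cdot> basis_vec j) k))\<^sup>2)"
        by simp
      also have "\<dots> \<le> (norm (A \<cdot> basis_vec j))\<^sup>2" by (rule sum_coord_le) simp
      finally show "(\<Sum>k<N. (cmod (coord (adj A \<cdot> basis_vec k) j))\<^sup>2) \<le> (norm (A \<cdot> basis_vec j))\<^sup>2" .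
    qed
    finally show ?thesis .
  qed
  have "(\<lambda>k. \<Sum>e\<in>F. (cmod (coord (A \<cdot> v e) k))\<^sup>2) sums (\<Sum>e\<in>F. (norm (A \<cdot> v e))\<^sup>2)"
    by (intro sums_sum norm_sums)
  then show ?thesis unfolding sums_def by (rule LIMSEQ_le_const2) (use part in blast)
qed

text \<open>The factor \<open>E\<close> stands on the left, so that on a vector \<open>x\<close> the
  remainder is controlled by \<open>X ^ k\<close> applied to \<open>x\<close>. This brings in the
  columns of \<open>Z\<close>, which are square summable, instead of its operator norm.\<close>

lemma exp_remainder:
  fixes X :: "'a :: {real_normed_algebra_1, banach}"
  shows "\<exists>E. norm E \<le> exp (norm X) \<and> exp X = (\<Sum>n<k. inverse (fact n) *\<^sub>R X ^ n) + E * X ^ k"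
proof -
  have le: "norm (inverse (fact (n + k)) *\<^sub>R X ^ n) \<le> inverse (fact n) *\<^sub>R norm X ^ n" for n
  proof -
    have "norm (X ^ n) \<le> norm X ^ n" by (rule norm_power_ineq)
    moreover have "inverse (fact (n + k)) \<le> (inverse (fact n) :: real)"
      by (intro le_imp_inverse_le fact_mono) auto
    ultimately show ?thesis by (simp add: mult_mono)
  qed
  have sm: "summable (\<lambda>n. norm (inverse (fact (n + k)) *\<^sub>R X ^ n))"
    by (rule summable_comparison_test'[OF summable_exp_generic[of "norm X"]]) (use le in simp)
  define E where "E = (\<Sum>n. inverse (fact (n + k)) *\<^sub>R X ^ n)"
  have "E * X ^ k = (\<Sum>n. inverse (fact (n + k)) *\<^sub>R X ^ (n + k))"
    unfolding E_def by (subst suminf_mult2[OF summable_norm_cancel[OF sm]]) (simp add: power_add)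
  then have "exp X = (\<Sum>n<k. inverse (fact n) *\<^sub>R X ^ n) + E * X ^ k"
    by (simp add: exp_first_terms[of X k])
  moreover have "norm E \<le> exp (norm X)"
  proof -
    have "norm E \<le> (\<Sum>n. norm (inverse (fact (n + k)) *\<^sub>R X ^ n))"
      unfolding E_def by (rule summable_norm[OF sm])
    also have "\<dots> \<le> (\<Sum>n. inverse (fact n) *\<^sub>R norm X ^ n)"
      by (rule suminf_le[OF le sm summable_exp_generic])
    finally show ?thesis by (simp add: exp_def)
  qed
  ultimately show ?thesis by blast
qed

section \<open>Hilbert-Schmidt differentiability of the perturbed calculus\<close>

locale perturbation = circle_diagonal +
  fixes Z :: bop and f :: "complex \<Rightarrow> complex" and p :: "nat \<Rightarrow> complex \<Rightarrow> complex" and C :: real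
  assumes selfadj: "adj Z = Z"
    and hs: "summable (\<lambda>k. (norm (Z \<cdot> basis_vec k))\<^sup>2)"
    and f: "continuous_on circle f"
    and p: "\<And>k. continuous_on circle (p k)"
    and p_le: "\<And>k z. z \<in> circle \<Longrightarrow> cmod (p k z) \<le> C"
    and fp: "\<And>k z. z \<in> circle \<Longrightarrow> f z - f (l k) = p k z * (z - l k)"
begin

definition X where "X t = scalar (\<i> * of_real t) * Z"
definition V where "V t = exp (X t) * U"
definition G where "G t = fc (V t) f - fc U f"
text \<open>Formal derivative at 0 of the formula \<open>G_column\<close>:
  \<open>fc (V t) (p k)\<close> is replaced by \<open>fc U (p k)\<close> and
  \<open>(V t - U) / t\<close> by \<open>\<i> Z U\<close>.\<close>

definition dcol where "dcol k = fc U (p k) \<cdot> \<i> *\<^sub>C (Z \<cdot> l k *\<^sub>C basis_vec k)"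
definition D where "D = (SOME A. \<forall>k. A \<cdot> basis_vec k = dcol k)"

lemma X_app: "X t \<cdot> x = (\<i> * of_real t) *\<^sub>C (Z \<cdot> x)"
  by (simp add: X_def)

lemma norm_X: "norm (X t) \<le> \<bar>t\<bar> * norm Z"
  using norm_mult_ineq[of "scalar (\<i> * of_real t)" Z] by (simp add: X_def norm_mult)

lemma unitary_V: "unitary (V t)"
proof -
  have "adj (X t) = - X t" by (simp add: X_def adj_mult selfadj scalar_commute scalar_minus)
  then show ?thesis unfolding V_def by (intro unitary_mult unitary_exp unitary_U)
qed

lemma C_nonneg: "0 \<le> C"
  using p_le[of 1 0] norm_ge_zero[of "p 0 1"] by (simp del: norm_ge_zero)

lemma G_column: "G t \<cdot> basis_vec k = fc (V t) (p k) \<cdot> (V t \<cdot> basis_vec k - U \<cdot> basis_vec k)"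
  using fc_divided_difference[OF unitary_V f p[of k] fp[of _ k], of t "basis_vec k"]
  by (simp add: G_def app_diff_left fc_U_basis[OF f] U_basis)

lemma fc_V_p_le: "norm (fc (V t) (p k) \<cdot> x) \<le> C * norm x"
  using norm_app_le[of "fc (V t) (p k)" x] mult_right_mono[OF norm_fc_le[OF unitary_V p p_le], of "norm x" t k]
  by simp

lemma fc_U_p_le: "norm (fc U (p k) \<cdot> x) \<le> C * norm x"
  using norm_app_le[of "fc U (p k)" x] mult_right_mono[OF norm_fc_le[OF unitary_U p p_le], of "norm x" k]
  by simp

lemma V_diff_U: "V t \<cdot> x - U \<cdot> x = (exp (X t) - 1) \<cdot> U \<cdot> x"
  by (simp add: V_def app_diff_left)

lemma norm_exp_diff_le: "norm ((exp (X t) - 1) \<cdot> x) \<le> exp (\<bar>t\<bar> * norm Z) * (\<bar>t\<bar> * norm (Z \<cdot> x))"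
proof -
  obtain E where E: "norm E \<le> exp (norm (X t))" "exp (X t) = (\<Sum>n<1. inverse (fact n) *\<^sub>R X t ^ n) + E * X t ^ 1"
    using exp_remainder[of "X t" 1] by blast
  have "norm E \<le> exp (\<bar>t\<bar> * norm Z)" using E(1) norm_X[of t] by (meson exp_le_cancel_iff order_trans)
  then have "norm E * norm (X t \<cdot> x) \<le> exp (\<bar>t\<bar> * norm Z) * norm (X t \<cdot> x)"
    by (rule mult_right_mono) simp
  moreover have "(exp (X t) - 1) \<cdot> x = E \<cdot> X t \<cdot> x" unfolding E(2) by simp
  ultimately have "norm ((exp (X t) - 1) \<cdot> x) \<le> exp (\<bar>t\<bar> * norm Z) * norm (X t \<cdot> x)"
    using norm_app_le[of E "X t \<cdot> x"] by simp
  then show ?thesis by (simp add: X_app norm_mult)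
qed

text \<open>Proportional to a column of \<open>Z\<close>, with constants independent of
  \<open>k\<close>: from this come both the square summability of \<open>G t\<close> and the
  majorant for the limit.\<close>

lemma norm_G_column_le:
  "norm (G t \<cdot> basis_vec k) \<le> C * (exp (\<bar>t\<bar> * norm Z) * (\<bar>t\<bar> * norm (Z \<cdot> basis_vec k)))"
proof -
  have "norm (V t \<cdot> basis_vec k - U \<cdot> basis_vec k) \<le> exp (\<bar>t\<bar> * norm Z) * (\<bar>t\<bar> * norm (Z \<cdot> U \<cdot> basis_vec k))"
    unfolding V_diff_U by (rule norm_exp_diff_le)
  also have "norm (Z \<cdot> U \<cdot> basis_vec k) = norm (Z \<cdot> basis_vec k)"
    by (simp add: U_basis app_scaleC_right)
  finally have "C * norm (V t \<cdot> basis_vec k - U \<cdot> basis_vec k) \<le>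
      C * (exp (\<bar>t\<bar> * norm Z) * (\<bar>t\<bar> * norm (Z \<cdot> basis_vec k)))"
    by (rule mult_left_mono[OF _ C_nonneg])
  then show ?thesis unfolding G_column using fc_V_p_le order_trans by blast
qed

lemma G_hs: "summable (\<lambda>k. (norm (G t \<cdot> basis_vec k))\<^sup>2)"
proof (rule summable_comparison_test')
  show "summable (\<lambda>k. (C * exp (\<bar>t\<bar> * norm Z) * \<bar>t\<bar>)\<^sup>2 * (norm (Z \<cdot> basis_vec k))\<^sup>2)"
    by (intro summable_mult hs)
  show "norm ((norm (G t \<cdot> basis_vec k))\<^sup>2) \<le> (C * exp (\<bar>t\<bar> * norm Z) * \<bar>t\<bar>)\<^sup>2 * (norm (Z \<cdot> basis_vec k))\<^sup>2" for k
    using power_mono[OF norm_G_column_le[of t k], of 2] by (simp add: power_mult_distrib mult_ac)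
qed

lemma norm_dcol_le: "norm (dcol k) \<le> C * norm (Z \<cdot> basis_vec k)"
  using fc_U_p_le[of k "\<i> *\<^sub>C (Z \<cdot> l k *\<^sub>C basis_vec k)"] by (simp add: dcol_def app_scaleC_right norm_mult)

lemma dcol_hs: "summable (\<lambda>k. (norm (dcol k))\<^sup>2)"
proof (rule summable_comparison_test')
  show "summable (\<lambda>k. C\<^sup>2 * (norm (Z \<cdot> basis_vec k))\<^sup>2)"
    by (intro summable_mult hs)
  show "norm ((norm (dcol k))\<^sup>2) \<le> C\<^sup>2 * (norm (Z \<cdot> basis_vec k))\<^sup>2" for k
    using power_mono[OF norm_dcol_le[of k], of 2] by (simp add: power_mult_distrib)
qed

lemma D_column: "D \<cdot> basis_vec k = dcol k"
  unfolding D_def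
  by (rule someI2_ex[of "\<lambda>A. \<forall>k. A \<cdot> basis_vec k = dcol k"]) (use bop_of_columns_exists[OF dcol_hs] in blast)+

text \<open>The difference splits in two. One part is \<open>fc (V t) (p k)\<close> applied to the
  error of the first order expansion of \<open>V t\<close>, of order \<open>t\<close>. The other is
  \<open>fc (V t) (p k) - fc U (p k)\<close> at the fixed vector \<open>y\<close>, which tends to 0
  by \<open>block_continuous\<close> with all coordinates as block.\<close>

lemma column_derivative:
  "((\<lambda>t. (1 / t) *\<^sub>R (G t \<cdot> basis_vec k) - D \<cdot> basis_vec k) \<longlongrightarrow> 0) (at 0)"
proof (rule tendstoI)
  fix e :: real assume e: "e > 0"
  define y where "y = \<i> *\<^sub>C (Z \<cdot> U \<cdot> basis_vec k)"
  define M where "M = exp (norm Z)"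
  have M: "M > 0" by (simp add: M_def)
  \<comment> \<open>Gives \<open>e1 * norm y \<le> e / 2\<close>, also for
    \<open>y = 0\<close>.\<close>
  define e1 where "e1 = e / (2 * (norm y + 1))"
  have e1: "e1 > 0" using e by (simp add: e1_def add_nonneg_pos)
  obtain \<delta> where \<delta>: "\<delta> > 0" "\<And>V l S. unitary V \<Longrightarrow> circle_diagonal l \<Longrightarrow>
      close_on S \<delta> V (circle_diagonal.U l) \<Longrightarrow> close_on S e1 (fc V (p k)) (fc (circle_diagonal.U l) (p k))"
    using block_continuousE[OF block_continuous_fc[OF p] e1] by blast
  define K where "K = C * (M * (norm Z * norm (Z \<cdot> U \<cdot> basis_vec k)))"
  have K: "K \<ge> 0" using C_nonneg M by (simp add: K_def)
  have "\<forall>\<^sub>F t in at 0. t \<noteq> 0 \<and> \<bar>t\<bar> < 1 \<and> \<bar>t\<bar> * (M * norm Z) < \<delta> \<and> \<bar>t\<bar> * K < e / 2"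
  proof (intro eventually_conj)
    show "\<forall>\<^sub>F t in at 0. (t::real) \<noteq> 0" by (rule eventually_neq_at_within)
    have lim: "((\<lambda>t::real. \<bar>t\<bar> * c) \<longlongrightarrow> \<bar>0\<bar> * c) (at 0)" for c by (intro tendsto_intros)
    show "\<forall>\<^sub>F t in at 0. \<bar>t::real\<bar> < 1" using order_tendstoD(2)[OF lim[of 1], of 1] by simp
    show "\<forall>\<^sub>F t in at 0. \<bar>t::real\<bar> * (M * norm Z) < \<delta>" using order_tendstoD(2)[OF lim] \<delta>(1) by simp
    show "\<forall>\<^sub>F t in at 0. \<bar>t::real\<bar> * K < e / 2" by (rule order_tendstoD(2)[OF lim]) (use e in simp)
  qed
  then show "\<forall>\<^sub>F t in at 0. dist ((1 / t) *\<^sub>R (G t \<cdot> basis_vec k) - D \<cdot> basis_vec k) 0 < e"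
  proof eventually_elim
    case (elim t)
    then have t: "t \<noteq> 0" "\<bar>t\<bar> < 1" "\<bar>t\<bar> * (M * norm Z) < \<delta>" "\<bar>t\<bar> * K < e / 2" by auto
    have tZ: "exp (\<bar>t\<bar> * norm Z) \<le> M" using t(2) by (simp add: M_def mult_left_le_one_le)
    obtain E where E: "norm E \<le> exp (norm (X t))" "exp (X t) = (\<Sum>n<2. inverse (fact n) *\<^sub>R X t ^ n) + E * X t ^ 2"
      using exp_remainder[of "X t" 2] by blast
    have nE: "norm E \<le> M"
      using E(1) norm_X[of t] tZ by (meson exp_le_cancel_iff order_trans)
    have ex: "(exp (X t) - 1) \<cdot> x = X t \<cdot> x + E \<cdot> X t \<cdot> X t \<cdot> x" for x
      unfolding E(2) by (simp add: numeral_2_eq_2 app_add_left)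
    let ?u = "U \<cdot> basis_vec k"
    have r: "(1 / t) *\<^sub>R (V t \<cdot> basis_vec k - U \<cdot> basis_vec k) - y = (1 / t) *\<^sub>R (E \<cdot> X t \<cdot> X t \<cdot> ?u)"
    proof -
      have "(1 / t) *\<^sub>R (X t \<cdot> ?u) = y"
        using t(1) by (intro ell2_eqI) (simp add: X_app y_def app_scaleC_right)
      then show ?thesis unfolding V_diff_U ex by (simp add: scaleR_add_right)
    qed
    have "norm ((1 / t) *\<^sub>R (E \<cdot> X t \<cdot> X t \<cdot> ?u)) \<le> \<bar>t\<bar> * (M * (norm Z * norm (Z \<cdot> ?u)))"
    proof -
      have "norm (E \<cdot> X t \<cdot> X t \<cdot> ?u) \<le> M * norm (X t \<cdot> X t \<cdot> ?u)"
        using norm_app_le[of E "X t \<cdot> X t \<cdot> ?u"] mult_right_mono[OF nE, of "norm (X t \<cdot> X t \<cdot> ?u)"] by simp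
      also have "norm (X t \<cdot> X t \<cdot> ?u) \<le> norm (X t) * norm (X t \<cdot> ?u)" by (rule norm_app_le)
      also have "\<dots> \<le> (\<bar>t\<bar> * norm Z) * (\<bar>t\<bar> * norm (Z \<cdot> ?u))"
        by (rule mult_mono[OF norm_X]) (auto simp: X_app norm_mult)
      finally have "norm (E \<cdot> X t \<cdot> X t \<cdot> ?u) \<le> M * ((\<bar>t\<bar> * norm Z) * (\<bar>t\<bar> * norm (Z \<cdot> ?u)))"
        using M by simp
      then show ?thesis using t(1) by (simp add: field_simps)
    qed
    then have "norm ((1 / t) *\<^sub>R (V t \<cdot> basis_vec k - U \<cdot> basis_vec k) - y) \<le> \<bar>t\<bar> * (M * (norm Z * norm (Z \<cdot> ?u)))"
      unfolding r .
    then have "C * norm ((1 / t) *\<^sub>R (V t \<cdot> basis_vec k - U \<cdot> basis_vec k) - y) \<le> \<bar>t\<bar> * K"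
      using mult_left_mono[OF _ C_nonneg] unfolding K_def by (metis mult.left_commute)
    then have 1: "norm (fc (V t) (p k) \<cdot> ((1 / t) *\<^sub>R (V t \<cdot> basis_vec k - U \<cdot> basis_vec k) - y)) < e / 2"
      using fc_V_p_le t(4) by (meson le_less_trans)
    have "norm (fc (V t) (p k) \<cdot> y - fc U (p k) \<cdot> y) \<le> e1 * norm y"
    proof (rule close_onD[OF \<delta>(2)[OF unitary_V circle_diagonal_axioms] supp_on_UNIV], unfold close_on_def, intro allI impI)
      fix x
      have "norm (V t \<cdot> x - U \<cdot> x) \<le> exp (\<bar>t\<bar> * norm Z) * (\<bar>t\<bar> * norm (Z \<cdot> U \<cdot> x))"
        unfolding V_diff_U by (rule norm_exp_diff_le)
      also have "\<dots> \<le> M * (\<bar>t\<bar> * (norm Z * norm (U \<cdot> x)))"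
        by (intro mult_mono mult_left_mono tZ norm_app_le) (use M in auto)
      also have "norm (U \<cdot> x) = norm x" by (rule norm_unitary_app[OF unitary_U])
      also have "M * (\<bar>t\<bar> * (norm Z * norm x)) = (\<bar>t\<bar> * (M * norm Z)) * norm x" by (simp add: mult_ac)
      also have "\<dots> \<le> \<delta> * norm x" using t(3) by (intro mult_right_mono) auto
      finally show "norm (V t \<cdot> x - U \<cdot> x) \<le> \<delta> * norm x" .
    qed
    also have "e1 * norm y \<le> e / 2"
    proof -
      have "e1 * norm y = e / 2 * (norm y / (norm y + 1))" by (simp add: e1_def)
      also have "\<dots> \<le> e / 2 * 1"
        using e by (intro mult_left_mono) (auto simp: divide_le_eq add_nonneg_pos)
      finally show ?thesis by simp
    qed
    finally have 2: "norm (fc (V t) (p k) \<cdot> y - fc U (p k) \<cdot> y) \<le> e / 2" .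
    have "D \<cdot> basis_vec k = fc U (p k) \<cdot> y"
      by (simp add: D_column dcol_def y_def U_basis)
    then have "(1 / t) *\<^sub>R (G t \<cdot> basis_vec k) - D \<cdot> basis_vec k =
        fc (V t) (p k) \<cdot> ((1 / t) *\<^sub>R (V t \<cdot> basis_vec k - U \<cdot> basis_vec k) - y) +
        (fc (V t) (p k) \<cdot> y - fc U (p k) \<cdot> y)"
      by (simp add: G_column app_diff_right app_scaleR_right)
    then show ?case
      using 1 2 norm_triangle_ineq[of "fc (V t) (p k) \<cdot> ((1 / t) *\<^sub>R (V t \<cdot> basis_vec k - U \<cdot> basis_vec k) - y)"
        "fc (V t) (p k) \<cdot> y - fc U (p k) \<cdot> y"] by simp
  qed
qed

text \<open>Tannery's theorem over the columns. For nonzero \<open>t\<close> with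
  \<open>|t| < 1\<close> the majorant is \<open>M^2\<close> times the squared norm of a column of
  \<open>Z\<close>; the factor is the same for all columns because \<open>C\<close> bounds all
  \<open>p k\<close> together.\<close>

lemma hs_derivative:
  "((\<lambda>t. \<Sum>k. (norm ((1 / t) *\<^sub>R (G t \<cdot> basis_vec k) - D \<cdot> basis_vec k))\<^sup>2) \<longlongrightarrow> 0) (at 0)"
proof -
  define M where "M = C * exp (norm Z) + C"
  have bound: "(norm ((1 / t) *\<^sub>R (G t \<cdot> basis_vec k) - D \<cdot> basis_vec k))\<^sup>2 \<le> M\<^sup>2 * (norm (Z \<cdot> basis_vec k))\<^sup>2"
    if t: "t \<noteq> 0" "\<bar>t\<bar> < 1" for t k
  proof -
    have "norm ((1 / t) *\<^sub>R (G t \<cdot> basis_vec k)) \<le> C * exp (norm Z) * norm (Z \<cdot> basis_vec k)"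
    proof -
      have "norm (G t \<cdot> basis_vec k) \<le> C * (exp (\<bar>t\<bar> * norm Z) * (\<bar>t\<bar> * norm (Z \<cdot> basis_vec k)))"
        by (rule norm_G_column_le)
      also have "\<dots> \<le> C * (exp (norm Z) * (\<bar>t\<bar> * norm (Z \<cdot> basis_vec k)))"
        using t C_nonneg by (intro mult_left_mono mult_right_mono) (auto simp: mult_left_le_one_le)
      finally show ?thesis using t by (simp add: field_simps)
    qed
    moreover have "norm (D \<cdot> basis_vec k) \<le> C * norm (Z \<cdot> basis_vec k)"
      unfolding D_column by (rule norm_dcol_le)
    ultimately have "norm ((1 / t) *\<^sub>R (G t \<cdot> basis_vec k) - D \<cdot> basis_vec k) \<le> M * norm (Z \<cdot> basis_vec k)"
      using norm_triangle_ineq4[of "(1 / t) *\<^sub>R (G t \<cdot> basis_vec k)" "D \<cdot> basis_vec k"]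
      by (simp add: M_def distrib_right)
    from power_mono[OF this, of 2] show ?thesis by (simp add: power_mult_distrib)
  qed
  have ev: "\<forall>\<^sub>F t in at 0. t \<noteq> 0 \<and> \<bar>t::real\<bar> < 1"
  proof (intro eventually_conj)
    have "((\<lambda>t::real. \<bar>t\<bar>) \<longlongrightarrow> \<bar>0\<bar>) (at 0)" by (intro tendsto_intros)
    from order_tendstoD(2)[OF this, of 1] show "\<forall>\<^sub>F t in at 0. \<bar>t::real\<bar> < 1" by simp
  qed (rule eventually_neq_at_within)
  have "((\<lambda>t. \<Sum>k. (norm ((1 / t) *\<^sub>R (G t \<cdot> basis_vec k) - D \<cdot> basis_vec k))\<^sup>2) \<longlongrightarrow> (\<Sum>k::nat. (0::real))) (at 0)"
  proof (rule tannerys_theorem[THEN conjunct2, THEN conjunct2])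
    show "((\<lambda>t. (norm ((1 / t) *\<^sub>R (G t \<cdot> basis_vec k) - D \<cdot> basis_vec k))\<^sup>2) \<longlongrightarrow> 0) (at 0)" for k
      using tendsto_power[OF tendsto_norm[OF column_derivative[of k]], of 2] by simp
    show "summable (\<lambda>k. M\<^sup>2 * (norm (Z \<cdot> basis_vec k))\<^sup>2)" by (intro summable_mult hs)
    show "\<forall>\<^sub>F (k, t) in at_top \<times>\<^sub>F at 0.
        norm ((norm ((1 / t) *\<^sub>R (G t \<cdot> basis_vec k) - D \<cdot> basis_vec k))\<^sup>2) \<le> M\<^sup>2 * (norm (Z \<cdot> basis_vec k))\<^sup>2"
      using eventually_prodI[OF eventually_True ev] by eventually_elim (auto intro: bound)
  qed simp
  then show ?thesis by simp
qed

end

section \<open>Trace duality\<close>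

text \<open>Gram-Schmidt for the semi-inner product \<open><P x, y>\<close>. As \<open>P\<close> may
  have a kernel, a vector with \<open>P \<cdot> z = 0\<close> adds nothing to the family, and the
  expansion is one of \<open>P \<cdot> x i\<close> and not of \<open>x i\<close>.\<close>

lemma semidefinite_Gram_Schmidt:
  assumes adjP: "adj P = P" and pos: "\<And>x. 0 \<le> Re (ip (P \<cdot> x) x)" and "finite I"
  shows "\<exists>r v. (\<forall>a<r. \<forall>b<r. ip (P \<cdot> v a) (v b) = (if a = b then 1 else 0)) \<and>
    (\<forall>i\<in>I. P \<cdot> x i = (\<Sum>a<(r::nat). ip (P \<cdot> x i) (v a) *\<^sub>C (P \<cdot> v a)))"
  using \<open>finite I\<close>
proof (induction I rule: finite_induct)
  case empty
  show ?case by (intro exI[of _ 0]) simp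
next
  case (insert j I)
  then obtain r v where on: "\<And>a b. a < r \<Longrightarrow> b < r \<Longrightarrow> ip (P \<cdot> v a) (v b) = (if a = b then 1 else 0)"
    and sp: "\<And>i. i \<in> I \<Longrightarrow> P \<cdot> x i = (\<Sum>a<(r::nat). ip (P \<cdot> x i) (v a) *\<^sub>C (P \<cdot> v a))" by blast
  define z where "z = x j - (\<Sum>a<r. ip (P \<cdot> x j) (v a) *\<^sub>C v a)"
  have Pz: "P \<cdot> z = P \<cdot> x j - (\<Sum>a<r. ip (P \<cdot> x j) (v a) *\<^sub>C (P \<cdot> v a))"
    by (simp add: z_def app_diff_right app_sum_right app_scaleC_right)
  have herm: "ip (P \<cdot> x) y = cnj (ip (P \<cdot> y) x)" for x y
    by (metis adjP ip_app_left ip_commute)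
  have zv: "ip (P \<cdot> z) (v b) = 0" if "b < r" for b
  proof -
    have "(\<Sum>a<r. ip (P \<cdot> x j) (v a) * ip (P \<cdot> v a) (v b)) = (\<Sum>a<r. if a = b then ip (P \<cdot> x j) (v b) else 0)"
      using on that by (intro sum.cong) auto
    then show ?thesis using that by (simp add: Pz ip_diff_left ip_sum_left ip_scaleC_left)
  qed
  show ?case
  proof (cases "P \<cdot> z = 0")
    case True
    then have "P \<cdot> x j = (\<Sum>a<r. ip (P \<cdot> x j) (v a) *\<^sub>C (P \<cdot> v a))" by (simp add: Pz)
    then show ?thesis using on sp by (intro exI[of _ r] exI[of _ v]) auto
  next
    case False
    define c where "c = Re (ip (P \<cdot> z) z)"
    have zz: "ip (P \<cdot> z) z = of_real c"
      using herm[of z z] by (auto simp: c_def complex_eq_iff)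
    \<comment> \<open>A positive form that vanishes at \<open>z\<close> forces
      \<open>P \<cdot> z = 0\<close>: otherwise moving from \<open>z\<close> against
      \<open>w = P \<cdot> z\<close> would make the form negative to first order.\<close>
    have "c \<noteq> 0"
    proof
      assume "c = 0"
      define w where "w = P \<cdot> z"
      define d where "d = Re (ip (P \<cdot> w) w)"
      have "0 \<le> - 2 * s * (norm w)\<^sup>2 + s\<^sup>2 * d" for s
      proof -
        have 1: "ip (P \<cdot> z) (s *\<^sub>R w) = of_real (s * (norm w)\<^sup>2)" "ip (P \<cdot> (s *\<^sub>R w)) (s *\<^sub>R w) = of_real (s\<^sup>2) * ip (P \<cdot> w) w"
          by (simp_all add: w_def scaleR_scaleC app_scaleC_right ip_scaleC_left ip_scaleC_right ip_self power2_eq_square)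
        have "ip (P \<cdot> (z - s *\<^sub>R w)) (z - s *\<^sub>R w) =
            ip (P \<cdot> z) z - ip (P \<cdot> z) (s *\<^sub>R w) - cnj (ip (P \<cdot> z) (s *\<^sub>R w)) + ip (P \<cdot> (s *\<^sub>R w)) (s *\<^sub>R w)"
          by (simp add: app_diff_right ip_diff_left ip_diff_right herm[of "s *\<^sub>R w" z])
        then have "Re (ip (P \<cdot> (z - s *\<^sub>R w)) (z - s *\<^sub>R w)) = - 2 * s * (norm w)\<^sup>2 + s\<^sup>2 * d"
          unfolding 1 zz \<open>c = 0\<close> by (simp add: d_def)
        then show ?thesis using pos[of "z - s *\<^sub>R w"] by simp
      qed
      note q = this
      have "d \<ge> 0" using pos by (simp add: d_def)
      have w0: "(norm w)\<^sup>2 > 0" using False by (simp add: w_def)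
      \<comment> \<open>Small enough for the quadratic term \<open>s^2 d\<close> to be at most half
        of the linear term \<open>2 s |w|^2\<close>; the 1 covers \<open>d = 0\<close>.\<close>
      define s where "s = (norm w)\<^sup>2 / (d + 1)"
      have "s > 0" using w0 \<open>d \<ge> 0\<close> by (simp add: s_def)
      have "s * d \<le> (norm w)\<^sup>2" using w0 \<open>d \<ge> 0\<close> by (simp add: s_def field_simps)
      then have "s * (s * d) \<le> s * (norm w)\<^sup>2" using \<open>s > 0\<close> by simp
      moreover have "s * (norm w)\<^sup>2 > 0" using \<open>s > 0\<close> w0 by simp
      ultimately show False using q[of s] by (simp add: power2_eq_square)
    qed
    then have c: "c > 0" using pos[of z] by (simp add: c_def)
    define n where "n = complex_of_real (1 / sqrt c)"
    have nn: "n * cnj n * of_real c = 1" "cnj n * of_real c * n = 1"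
      using c by (simp_all add: n_def flip: of_real_mult)
    define v' where "v' = v(r := n *\<^sub>C z)"
    have v': "v' r = n *\<^sub>C z" "\<And>a. a < r \<Longrightarrow> v' a = v a" by (auto simp: v'_def)
    have vz: "ip (P \<cdot> v a) z = 0" if "a < r" for a using zv[OF that] herm[of "v a" z] by simp
    have "ip (P \<cdot> v' a) (v' b) = (if a = b then 1 else 0)" if "a < Suc r" "b < Suc r" for a b
      using that on zv vz nn zz
      by (auto simp: less_Suc_eq v' app_scaleC_right ip_scaleC_left ip_scaleC_right mult_ac)
    moreover have "P \<cdot> x i = (\<Sum>a<Suc r. ip (P \<cdot> x i) (v' a) *\<^sub>C (P \<cdot> v' a))" if "i \<in> insert j I" for i
    proof (cases "i = j")
      case True
      have "ip (P \<cdot> x j) z = ip (P \<cdot> z) z"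
        by (simp add: Pz ip_diff_left ip_sum_left ip_scaleC_left vz)
      then have "ip (P \<cdot> x j) (v' r) *\<^sub>C (P \<cdot> v' r) = (cnj n * of_real c * n) *\<^sub>C (P \<cdot> z)"
        by (simp add: v' ip_scaleC_right zz app_scaleC_right)
      then have "ip (P \<cdot> x j) (v' r) *\<^sub>C (P \<cdot> v' r) = P \<cdot> z" by (simp add: nn)
      then show ?thesis using True by (simp add: v' Pz)
    next
      case False
      then have i: "i \<in> I" using that by blast
      have "ip (P \<cdot> x i) z = 0"
        by (subst sp[OF i]) (simp add: ip_sum_left ip_scaleC_left vz)
      then have "ip (P \<cdot> x i) (v' r) = 0" by (simp add: v' ip_scaleC_right)
      then show ?thesis using sp[OF i] by (simp add: v')
    qed
    ultimately show ?thesis by blast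
  qed
qed

text \<open>Stands in for the polar decomposition. With \<open>v\<close> orthonormal for the form
  \<open><P x, y>\<close>, expand each \<open>A \<cdot> x i\<close> along the
  \<open>A \<cdot> v a\<close>. Cauchy-Schwarz over \<open>i\<close> leaves
  \<open>|P v| |A v| = |P v|^2\<close> for each \<open>a\<close>, and these add up to at most the
  trace of \<open>P\<close> by Bessel for the same form.\<close>

lemma trace_duality:
  assumes adjP: "adj P = P" and pos: "\<And>x. 0 \<le> Re (ip (P \<cdot> x) x)" and PA: "P * P = adj A * A"
    and sm: "summable (\<lambda>k. Re (ip (P \<cdot> basis_vec k) (basis_vec k)))"
    and "finite I"
    and x: "\<And>i j. i \<in> I \<Longrightarrow> j \<in> I \<Longrightarrow> ip (x i) (x j) = (if i = j then 1 else 0)"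
    and y: "\<And>i j. i \<in> I \<Longrightarrow> j \<in> I \<Longrightarrow> ip (y i) (y j) = (if i = j then 1 else 0)"
  shows "(\<Sum>i\<in>I. cmod (ip (A \<cdot> x i) (y i))) \<le> (\<Sum>k. Re (ip (P \<cdot> basis_vec k) (basis_vec k)))"
proof -
  obtain r v where on: "\<And>a b. a < r \<Longrightarrow> b < r \<Longrightarrow> ip (P \<cdot> v a) (v b) = (if a = b then 1 else 0)"
    and sp: "\<And>i. i \<in> I \<Longrightarrow> P \<cdot> x i = (\<Sum>a<(r::nat). ip (P \<cdot> x i) (v a) *\<^sub>C (P \<cdot> v a))"
    using semidefinite_Gram_Schmidt[OF adjP pos \<open>finite I\<close>, of x] by metis
  have herm: "ip (P \<cdot> x) y = cnj (ip (P \<cdot> y) x)" for x y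
    by (metis adjP ip_app_left ip_commute)
  have norm_eq: "norm (A \<cdot> w) = norm (P \<cdot> w)" for w
  proof -
    have "ip (A \<cdot> w) (A \<cdot> w) = ip w ((adj A * A) \<cdot> w)" by (simp add: ip_app_left)
    also have "\<dots> = ip (P \<cdot> w) (P \<cdot> w)" unfolding PA[symmetric] by (simp add: ip_app_left adjP)
    finally have "(norm (A \<cdot> w))\<^sup>2 = (norm (P \<cdot> w))\<^sup>2" unfolding ip_self of_real_eq_iff .
    then show ?thesis by (simp add: power2_eq_iff_nonneg)
  qed
  \<comment> \<open>By \<open>norm_eq\<close> the operators \<open>A\<close> and \<open>P\<close>
    have the same kernel, so \<open>A\<close> inherits the expansion of
    \<open>P \<cdot> x i\<close>.\<close>
  have Ax: "A \<cdot> x i = (\<Sum>a<r. ip (P \<cdot> x i) (v a) *\<^sub>C (A \<cdot> v a))" if "i \<in> I" for i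
  proof -
    have "norm (A \<cdot> (x i - (\<Sum>a<r. ip (P \<cdot> x i) (v a) *\<^sub>C v a))) = 0"
      unfolding norm_eq using sp[OF that] by (simp add: app_diff_right app_sum_right app_scaleC_right)
    then show ?thesis by (simp add: app_diff_right app_sum_right app_scaleC_right)
  qed
  have bessel: "(\<Sum>a<r. (cmod (ip (P \<cdot> w) (v a)))\<^sup>2) \<le> Re (ip (P \<cdot> w) w)" for w
  proof -
    define q where "q = (\<Sum>a<r. ip (P \<cdot> w) (v a) *\<^sub>C v a)"
    define S where "S = (\<Sum>a<r. (cmod (ip (P \<cdot> w) (v a)))\<^sup>2)"
    have wq: "ip (P \<cdot> w) q = of_real S"
      by (simp add: q_def S_def ip_sum_right ip_scaleC_right mult_cnj_cmod)
    have Pq: "P \<cdot> q = (\<Sum>a<r. ip (P \<cdot> w) (v a) *\<^sub>C (P \<cdot> v a))"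
      by (simp add: q_def app_sum_right app_scaleC_right)
    have "ip (P \<cdot> q) (v b) = ip (P \<cdot> w) (v b)" if "b < r" for b
    proof -
      have "(\<Sum>a<r. ip (P \<cdot> w) (v a) * ip (P \<cdot> v a) (v b)) = (\<Sum>a<r. if a = b then ip (P \<cdot> w) (v b) else 0)"
        using on that by (intro sum.cong) auto
      then show ?thesis using that by (simp add: Pq ip_sum_left ip_scaleC_left)
    qed
    then have "ip (P \<cdot> q) q = of_real S"
      by (subst (2) q_def) (simp add: S_def ip_sum_right ip_scaleC_right mult_cnj_cmod)
    moreover have "ip (P \<cdot> q) w = of_real S" using wq herm[of q w] by simp
    ultimately have "ip (P \<cdot> (w - q)) (w - q) = ip (P \<cdot> w) w - of_real S"
      using wq by (simp add: app_diff_right ip_diff_left ip_diff_right)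
    then show ?thesis using pos[of "w - q"] by (simp add: S_def)
  qed
  have "(\<Sum>i\<in>I. cmod (ip (A \<cdot> x i) (y i))) \<le>
      (\<Sum>i\<in>I. \<Sum>a<r. cmod (ip (P \<cdot> v a) (x i)) * cmod (ip (A \<cdot> v a) (y i)))"
  proof (rule sum_mono)
    fix i assume i: "i \<in> I"
    have "cmod (ip (P \<cdot> x i) (v a)) = cmod (ip (P \<cdot> v a) (x i))" for a
      by (subst herm) simp
    then show "cmod (ip (A \<cdot> x i) (y i)) \<le> (\<Sum>a<r. cmod (ip (P \<cdot> v a) (x i)) * cmod (ip (A \<cdot> v a) (y i)))"
      unfolding Ax[OF i] ip_sum_left ip_scaleC_left
      by (intro order_trans[OF norm_sum]) (simp add: norm_mult)
  qed
  also have "\<dots> = (\<Sum>a<r. \<Sum>i\<in>I. cmod (ip (P \<cdot> v a) (x i)) * cmod (ip (A \<cdot> v a) (y i)))"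
    by (rule sum.swap)
  also have "\<dots> \<le> (\<Sum>a<r. (norm (P \<cdot> v a))\<^sup>2)"
  proof (rule sum_mono)
    fix a
    have "(\<Sum>i\<in>I. cmod (ip (P \<cdot> v a) (x i)) * cmod (ip (A \<cdot> v a) (y i))) \<le> norm (P \<cdot> v a) * norm (A \<cdot> v a)"
      by (intro Cauchy_Schwarz_sum orthonormal_Bessel \<open>finite I\<close> x y) auto
    then show "(\<Sum>i\<in>I. cmod (ip (P \<cdot> v a) (x i)) * cmod (ip (A \<cdot> v a) (y i))) \<le> (norm (P \<cdot> v a))\<^sup>2"
      by (simp add: norm_eq power2_eq_square)
  qed
  also have "\<dots> = (\<Sum>k. \<Sum>a<r. (cmod (coord (P \<cdot> v a) k))\<^sup>2)"
    by (subst suminf_sum[OF summable_coord]) (use norm_sums in \<open>auto simp: sums_iff\<close>)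
  also have "\<dots> \<le> (\<Sum>k. Re (ip (P \<cdot> basis_vec k) (basis_vec k)))"
  proof (rule suminf_le[OF _ summable_sum[OF summable_coord] sm])
    fix k
    have "cmod (coord (P \<cdot> v a) k) = cmod (ip (P \<cdot> basis_vec k) (v a))" for a
      unfolding ip_basis_right[symmetric] by (subst herm) simp
    then show "(\<Sum>a<r. (cmod (coord (P \<cdot> v a) k))\<^sup>2) \<le> Re (ip (P \<cdot> basis_vec k) (basis_vec k))"
      using bessel[of "basis_vec k"] by simp
  qed
  finally show ?thesis .
qed

section \<open>Second order asymptotics on a coordinate block\<close>

text \<open>\<open>Z\<close> maps the vector \<open>k\<close> to a multiple of the vector
  \<open>i0\<close>, which belongs to the eigenvalue 1 of \<open>U\<close>. There
  \<open>q(V) - q(U)\<close> is again given by a divided difference, \<open>q1\<close>, applied to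
  \<open>V - U\<close>. The summand \<open>q / 2\<close> comes from the quadratic term of the
  exponential. Every remaining term contains three factors of size \<open>t\<close>.\<close>

lemma (in perturbation) second_order_expansion:
  assumes k: "l k = w" "p k = q" and i: "l i0 = 1"
    and q1: "continuous_on circle q1" "\<And>z. z \<in> circle \<Longrightarrow> q z - q 1 = q1 z * (z - 1)"
      "\<And>z. z \<in> circle \<Longrightarrow> cmod (q1 z) \<le> C1"
    and M: "exp (norm Z) \<le> M"
    and S: "i0 \<in> S" "\<And>y. supp_on S y \<Longrightarrow> supp_on S (Z \<cdot> y)" "\<And>y. supp_on S y \<Longrightarrow> norm (Z \<cdot> y) \<le> t * c * norm y"
    and Z0: "Z \<cdot> basis_vec i0 = t *\<^sub>R v" and Zk: "Z \<cdot> basis_vec k = (of_real t * \<beta>) *\<^sub>C basis_vec i0"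
    and t: "0 < t" and \<beta>: "cmod \<beta> \<le> 1" and c: "0 \<le> c" "norm v \<le> c"
  shows "norm ((G 1 - D) \<cdot> basis_vec k + (of_real (t\<^sup>2) * w * \<beta>) *\<^sub>C (fc (V 1) (\<lambda>z. q1 z + q z / 2) \<cdot> v))
    \<le> t ^ 3 * ((C1 + C) * M * c\<^sup>2)"
proof -
  let ?X = "X 1" and ?e = basis_vec
  have X: "?X \<cdot> x = \<i> *\<^sub>C (Z \<cdot> x)" for x by (simp add: X_app)
  have nX: "norm ?X \<le> norm Z" using norm_X[of 1] by simp
  have M0: "M > 0" using M exp_gt_zero[of "norm Z"] by linarith
  have C1: "0 \<le> C1" using q1(3)[of 1] norm_ge_zero[of "q1 1"] by (simp del: norm_ge_zero)
  have q: "continuous_on circle q" using p[of k] k by simp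
  have w: "cmod w = 1" using k(1) by auto
  \<comment> \<open>On \<open>i0\<close> the operator \<open>V - U\<close> is expanded to first
    order, with remainder \<open>E2\<close>; on \<open>k\<close> the exponential is expanded to
    second order, with remainder \<open>E3\<close>.\<close>
  obtain E2 where E2: "norm E2 \<le> exp (norm ?X)" "exp ?X = (\<Sum>n<2. inverse (fact n) *\<^sub>R ?X ^ n) + E2 * ?X ^ 2"
    using exp_remainder[of ?X 2] by blast
  obtain E3 where E3: "norm E3 \<le> exp (norm ?X)" "exp ?X = (\<Sum>n<3. inverse (fact n) *\<^sub>R ?X ^ n) + E3 * ?X ^ 3"
    using exp_remainder[of ?X 3] by blast
  have nE: "norm E2 \<le> M" "norm E3 \<le> M"
    using E2(1) E3(1) nX M by (meson exp_le_cancel_iff order_trans)+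
  have ex2: "(exp ?X - 1) \<cdot> x = ?X \<cdot> x + E2 \<cdot> ?X \<cdot> ?X \<cdot> x" for x
    unfolding E2(2) by (simp add: numeral_2_eq_2 app_add_left)
  have ex3: "(exp ?X - 1) \<cdot> x = ?X \<cdot> x + (1 / 2) *\<^sub>R (?X \<cdot> ?X \<cdot> x) + E3 \<cdot> ?X \<cdot> ?X \<cdot> ?X \<cdot> x" for x
    unfolding E3(2) by (simp add: numeral_3_eq_3 app_add_left app_scaleR_left inverse_eq_divide)
  have sv: "supp_on S v"
  proof -
    have "v = (1 / t) *\<^sub>R (Z \<cdot> ?e i0)" using t by (simp add: Z0)
    moreover have "supp_on S (Z \<cdot> ?e i0)" using S(1) by (intro S(2)) auto
    ultimately show ?thesis by (metis scaleR_scaleC supp_on_intros(2))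
  qed
  have nXv: "norm (?X \<cdot> v) \<le> t * c\<^sup>2"
  proof -
    have "norm (?X \<cdot> v) \<le> (t * c) * norm v" using S(3)[OF sv] by (simp add: X)
    also have "\<dots> \<le> (t * c) * c" using c t by (intro mult_left_mono) auto
    finally show ?thesis by (simp add: power2_eq_square)
  qed
  have X0: "?X \<cdot> ?e i0 = (\<i> * of_real t) *\<^sub>C v"
    by (simp add: X Z0 scaleR_scaleC)
  have Xk: "?X \<cdot> ?e k = (\<i> * of_real t * \<beta>) *\<^sub>C ?e i0"
    by (simp add: X Zk mult.assoc)
  \<comment> \<open>Two factors \<open>\<i>\<close> give a minus sign; hence the main term stands
    with a plus on the left of the claim.\<close>
  have XXk: "?X \<cdot> ?X \<cdot> ?e k = (- of_real (t\<^sup>2) * \<beta>) *\<^sub>C v"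
    unfolding Xk by (simp add: app_scaleC_right X0 power2_eq_square mult_ac)
  have V0: "fc (V 1) q \<cdot> ?e i0 - fc U q \<cdot> ?e i0 = fc (V 1) q1 \<cdot> (?X \<cdot> ?e i0 + E2 \<cdot> ?X \<cdot> ?X \<cdot> ?e i0)"
  proof -
    have "fc (V 1) q \<cdot> ?e i0 - q 1 *\<^sub>C ?e i0 = fc (V 1) q1 \<cdot> (V 1 \<cdot> ?e i0 - 1 *\<^sub>C ?e i0)"
      by (rule fc_divided_difference[OF unitary_V q q1(1,2)])
    moreover have "V 1 \<cdot> ?e i0 - 1 *\<^sub>C ?e i0 = (exp ?X - 1) \<cdot> ?e i0"
      using V_diff_U[of 1 "?e i0"] by (simp add: U_basis i)
    ultimately show ?thesis using ex2[of "?e i0"] by (simp add: fc_U_basis[OF q] i)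
  qed
  let ?err = "w *\<^sub>C ((\<i> * of_real t * \<beta>) *\<^sub>C (fc (V 1) q1 \<cdot> E2 \<cdot> ?X \<cdot> ?X \<cdot> ?e i0) + fc (V 1) q \<cdot> E3 \<cdot> ?X \<cdot> ?X \<cdot> ?X \<cdot> ?e k)"
  have R: "(G 1 - D) \<cdot> ?e k = w *\<^sub>C (fc (V 1) q \<cdot> (exp ?X - 1) \<cdot> ?e k - fc U q \<cdot> ?X \<cdot> ?e k)"
    unfolding app_diff_left[of "G 1"] G_column D_column dcol_def V_diff_U
    by (simp add: U_basis k app_scaleC_right scaleC_diff_right X mult.commute)
  have "fc (V 1) q \<cdot> (exp ?X - 1) \<cdot> ?e k - fc U q \<cdot> ?X \<cdot> ?e k =
      (fc (V 1) q \<cdot> ?X \<cdot> ?e k - fc U q \<cdot> ?X \<cdot> ?e k) + (1 / 2) *\<^sub>R (fc (V 1) q \<cdot> ?X \<cdot> ?X \<cdot> ?e k)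
        + fc (V 1) q \<cdot> E3 \<cdot> ?X \<cdot> ?X \<cdot> ?X \<cdot> ?e k"
    unfolding ex3 by (simp add: app_add_right app_scaleR_right)
  also have "fc (V 1) q \<cdot> ?X \<cdot> ?e k - fc U q \<cdot> ?X \<cdot> ?e k =
      (\<i> * of_real t * \<beta>) *\<^sub>C (fc (V 1) q1 \<cdot> (?X \<cdot> ?e i0 + E2 \<cdot> ?X \<cdot> ?X \<cdot> ?e i0))"
    unfolding Xk app_scaleC_right scaleC_diff_right[symmetric] V0 ..
  also have "\<dots> = (- of_real (t\<^sup>2) * \<beta>) *\<^sub>C (fc (V 1) q1 \<cdot> v) +
      (\<i> * of_real t * \<beta>) *\<^sub>C (fc (V 1) q1 \<cdot> E2 \<cdot> ?X \<cdot> ?X \<cdot> ?e i0)"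
    by (rule ell2_eqI) (simp add: app_add_right X0 app_scaleC_right power2_eq_square algebra_simps)
  also have "(1 / 2) *\<^sub>R (fc (V 1) q \<cdot> ?X \<cdot> ?X \<cdot> ?e k) = (- of_real (t\<^sup>2) * \<beta>) *\<^sub>C ((1 / 2) *\<^sub>C (fc (V 1) q \<cdot> v))"
    unfolding XXk by (rule ell2_eqI) (simp add: app_scaleC_right)
  finally have "(G 1 - D) \<cdot> ?e k = w *\<^sub>C ((- of_real (t\<^sup>2) * \<beta>) *\<^sub>C (fc (V 1) q1 \<cdot> v) +
      (- of_real (t\<^sup>2) * \<beta>) *\<^sub>C ((1 / 2) *\<^sub>C (fc (V 1) q \<cdot> v))) + ?err"
    unfolding R by (simp add: scaleC_add_right algebra_simps)
  moreover have "fc (V 1) (\<lambda>z. q1 z + q z / 2) \<cdot> v = fc (V 1) q1 \<cdot> v + (1 / 2) *\<^sub>C (fc (V 1) q \<cdot> v)"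
  proof -
    have "fc (V 1) (\<lambda>z. q1 z + (1 / 2) * q z) = fc (V 1) q1 + scalar (1 / 2) * fc (V 1) q"
    proof -
      have "fc (V 1) (\<lambda>z. q1 z + (1 / 2) * q z) = fc (V 1) q1 + fc (V 1) (\<lambda>z. (1 / 2) * q z)"
        by (intro fc_add unitary_V q1 q continuous_intros)
      then show ?thesis unfolding fc_cmult[OF unitary_V q] .
    qed
    then show ?thesis by (simp add: app_add_left)
  qed
  ultimately have "(G 1 - D) \<cdot> ?e k + (of_real (t\<^sup>2) * w * \<beta>) *\<^sub>C (fc (V 1) (\<lambda>z. q1 z + q z / 2) \<cdot> v) = ?err"
    by (intro ell2_eqI) (simp add: algebra_simps)
  moreover have "norm ?err \<le> t ^ 3 * ((C1 + C) * M * c\<^sup>2)"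
  proof -
    have "norm (fc (V 1) q1 \<cdot> E2 \<cdot> ?X \<cdot> ?X \<cdot> ?e i0) \<le> C1 * (M * (t * (t * c\<^sup>2)))"
    proof -
      have "norm (?X \<cdot> ?X \<cdot> ?e i0) = t * norm (?X \<cdot> v)" using t by (simp add: X0 app_scaleC_right norm_mult)
      also have "\<dots> \<le> t * (t * c\<^sup>2)" using nXv t by simp
      finally have "norm (E2 \<cdot> ?X \<cdot> ?X \<cdot> ?e i0) \<le> M * (t * (t * c\<^sup>2))"
        using norm_app_le[of E2 "?X \<cdot> ?X \<cdot> ?e i0"] mult_mono[OF nE(1)] M0 t
        by (meson norm_ge_zero order_trans less_imp_le)
      moreover have "norm (fc (V 1) q1 \<cdot> x) \<le> C1 * norm x" for x
        using norm_app_le[of "fc (V 1) q1" x] mult_right_mono[OF norm_fc_le[OF unitary_V q1(1,3)], of "norm x"]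
        by (meson norm_ge_zero order_trans)
      ultimately show ?thesis using mult_left_mono[OF _ C1] order_trans by blast
    qed
    then have "t * cmod \<beta> * norm (fc (V 1) q1 \<cdot> E2 \<cdot> ?X \<cdot> ?X \<cdot> ?e i0) \<le> (t * 1) * (C1 * (M * (t * (t * c\<^sup>2))))"
      using t \<beta> by (intro mult_mono) auto
    then have 1: "norm ((\<i> * of_real t * \<beta>) *\<^sub>C (fc (V 1) q1 \<cdot> E2 \<cdot> ?X \<cdot> ?X \<cdot> ?e i0)) \<le> t ^ 3 * (C1 * M * c\<^sup>2)"
      using t by (simp add: norm_mult power3_eq_cube mult_ac)
    have "norm (?X \<cdot> ?X \<cdot> ?X \<cdot> ?e k) \<le> t\<^sup>2 * (t * c\<^sup>2)"
    proof -
      have "norm (?X \<cdot> ?X \<cdot> ?X \<cdot> ?e k) = (t\<^sup>2 * cmod \<beta>) * norm (?X \<cdot> v)"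
        unfolding XXk by (simp add: app_scaleC_right norm_mult norm_power)
      also have "\<dots> \<le> (t\<^sup>2 * 1) * (t * c\<^sup>2)"
        using nXv t \<beta> by (intro mult_mono) auto
      finally show ?thesis by simp
    qed
    then have "norm (E3 \<cdot> ?X \<cdot> ?X \<cdot> ?X \<cdot> ?e k) \<le> M * (t\<^sup>2 * (t * c\<^sup>2))"
      using norm_app_le[of E3 "?X \<cdot> ?X \<cdot> ?X \<cdot> ?e k"] mult_mono[OF nE(2)] M0
      by (meson norm_ge_zero order_trans less_imp_le)
    then have "C * norm (E3 \<cdot> ?X \<cdot> ?X \<cdot> ?X \<cdot> ?e k) \<le> C * (M * (t\<^sup>2 * (t * c\<^sup>2)))"
      by (rule mult_left_mono[OF _ C_nonneg])
    then have "norm (fc (V 1) q \<cdot> E3 \<cdot> ?X \<cdot> ?X \<cdot> ?X \<cdot> ?e k) \<le> C * (M * (t\<^sup>2 * (t * c\<^sup>2)))"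
      using fc_V_p_le[of 1 k] k(2) order_trans by metis
    then have 2: "norm (fc (V 1) q \<cdot> E3 \<cdot> ?X \<cdot> ?X \<cdot> ?X \<cdot> ?e k) \<le> t ^ 3 * (C * M * c\<^sup>2)"
      by (simp add: power3_eq_cube power2_eq_square mult_ac)
    have "norm ?err \<le> t ^ 3 * (C1 * M * c\<^sup>2) + t ^ 3 * (C * M * c\<^sup>2)"
      using 1 2 w by (simp add: norm_triangle_mono)
    then show ?thesis by (simp add: algebra_simps)
  qed
  ultimately show ?thesis by simp
qed

text \<open>
  The threshold \<open>\<delta>\<close> is chosen before the perturbation, so that the scales of the blocks of \<open>Z\<close>
  can be chosen one after the other.
\<close>

lemma second_order_asymptotics:
  assumes q: "continuous_on circle q"
    and q1: "continuous_on circle q1" "\<And>z. z \<in> circle \<Longrightarrow> q z - q 1 = q1 z * (z - 1)"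
    and C: "0 \<le> C" and c: "0 \<le> c" and e: "e > 0"
  shows "\<exists>\<delta>>0. \<forall>l Z f p k i0 S t v \<beta>. perturbation l Z f p C \<longrightarrow> norm Z \<le> B \<longrightarrow> 0 < t \<longrightarrow> t \<le> \<delta> \<longrightarrow>
    p k = q \<longrightarrow> l i0 = 1 \<longrightarrow> i0 \<in> S \<longrightarrow>
    (\<forall>y. supp_on S y \<longrightarrow> supp_on S (Z \<cdot> y) \<and> norm (Z \<cdot> y) \<le> t * c * norm y) \<longrightarrow>
    Z \<cdot> basis_vec i0 = t *\<^sub>R v \<longrightarrow> Z \<cdot> basis_vec k = (of_real t * \<beta>) *\<^sub>C basis_vec i0 \<longrightarrow>
    cmod \<beta> \<le> 1 \<longrightarrow> norm v \<le> c \<longrightarrow>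
    norm ((perturbation.G l Z f 1 - perturbation.D l Z p) \<cdot> basis_vec k +
      (of_real (t\<^sup>2) * l k * \<beta>) *\<^sub>C (fc (circle_diagonal.U l) (\<lambda>z. q1 z + q z / 2) \<cdot> v)) \<le> e * t\<^sup>2"
proof -
  obtain C1 where C1: "0 \<le> C1" "\<And>z. z \<in> circle \<Longrightarrow> cmod (q1 z) \<le> C1"
    using circle_function_bounded[OF q1(1)] by blast
  define M where "M = exp B"
  define e1 where "e1 = e / (2 * (c + 1))"
  have e1: "e1 > 0" using e c by (simp add: e1_def)
  have cont: "continuous_on circle (\<lambda>z. q1 z + q z / 2)" by (intro continuous_intros q q1) auto
  obtain d1 where d1: "d1 > 0" "\<And>W l S. unitary W \<Longrightarrow> circle_diagonal l \<Longrightarrow>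
      close_on S d1 W (circle_diagonal.U l) \<Longrightarrow>
      close_on S e1 (fc W (\<lambda>z. q1 z + q z / 2)) (fc (circle_diagonal.U l) (\<lambda>z. q1 z + q z / 2))"
    using block_continuousE[OF block_continuous_fc[OF cont] e1] by blast
  define K where "K = (C1 + C) * M * c\<^sup>2"
  have K: "K \<ge> 0" using C1 C by (simp add: K_def M_def)
  \<comment> \<open>The first bound keeps \<open>V 1\<close> within \<open>d1\<close> of
    \<open>U\<close> on the block, the second makes the cubic remainder at most half of
    \<open>e t^2\<close>. The added 1s exclude division by 0.\<close>
  define \<delta> where "\<delta> = min (d1 / (M * c + 1)) (e / (2 * (K + 1)))"
  have M: "M > 0" by (simp add: M_def)
  have Mc: "M * c + 1 > 0" using M c by (simp add: add_nonneg_pos)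
  have "\<delta> > 0" using d1 K e Mc by (simp add: \<delta>_def)
  moreover have "norm ((perturbation.G l Z f 1 - perturbation.D l Z p) \<cdot> basis_vec k +
      (of_real (t\<^sup>2) * l k * \<beta>) *\<^sub>C (fc (circle_diagonal.U l) (\<lambda>z. q1 z + q z / 2) \<cdot> v)) \<le> e * t\<^sup>2"
    if pert: "perturbation l Z f p C" and Z: "norm Z \<le> B" and t: "0 < t" "t \<le> \<delta>"
      and k: "p k = q" and i: "l i0 = 1" and S: "i0 \<in> S"
        "\<forall>y. supp_on S y \<longrightarrow> supp_on S (Z \<cdot> y) \<and> norm (Z \<cdot> y) \<le> t * c * norm y"
      and Z0: "Z \<cdot> basis_vec i0 = t *\<^sub>R v" and Zk: "Z \<cdot> basis_vec k = (of_real t * \<beta>) *\<^sub>C basis_vec i0"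
      and \<beta>: "cmod \<beta> \<le> 1" and v: "norm v \<le> c"
    for l Z f p k i0 S t v \<beta>
  proof -
    interpret perturbation l Z f p C by fact
    let ?h = "\<lambda>z. q1 z + q z / 2"
    have eZ: "exp (norm Z) \<le> M" using Z by (simp add: M_def)
    have sv: "supp_on S v"
    proof -
      have "v = (1 / t) *\<^sub>R (Z \<cdot> basis_vec i0)" using t by (simp add: Z0)
      moreover have "supp_on S (Z \<cdot> basis_vec i0)" using S by auto
      ultimately show ?thesis by (metis scaleR_scaleC supp_on_intros(2))
    qed
    have 1: "norm ((G 1 - D) \<cdot> basis_vec k + (of_real (t\<^sup>2) * l k * \<beta>) *\<^sub>C (fc (V 1) ?h \<cdot> v)) \<le> t ^ 3 * K"
      unfolding K_def
      by (rule second_order_expansion[OF refl k i q1 C1(2) eZ _ _ _ Z0 Zk t(1) \<beta> c v, of S]) (use S in auto)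
    \<comment> \<open>\<open>norm Z\<close> enters through the constant \<open>M\<close> alone; the
      smallness comes from \<open>Z\<close> on the block \<open>S\<close>, which contains
      \<open>v\<close>.\<close>
    have "norm (fc (V 1) ?h \<cdot> v - fc U ?h \<cdot> v) \<le> e1 * norm v"
    proof (rule close_onD[OF d1(2)[OF unitary_V circle_diagonal_axioms] sv], unfold close_on_def, intro allI impI)
      fix y assume y: "supp_on S y"
      have Uy: "supp_on S (U \<cdot> y)" using y by (simp add: supp_on_def coord_U)
      have "norm (V 1 \<cdot> y - U \<cdot> y) \<le> exp (\<bar>1\<bar> * norm Z) * (\<bar>1\<bar> * norm (Z \<cdot> U \<cdot> y))"
        unfolding V_diff_U by (rule norm_exp_diff_le)
      also have "\<dots> \<le> M * (t * c * norm (U \<cdot> y))"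
      proof -
        have "norm (Z \<cdot> U \<cdot> y) \<le> t * c * norm (U \<cdot> y)" using S(2) Uy by blast
        then show ?thesis using eZ M by (simp add: mult_mono)
      qed
      also have "\<dots> = t * (M * c) * norm y" by (simp add: norm_unitary_app[OF unitary_U] mult_ac)
      also have "\<dots> \<le> d1 * norm y"
      proof (rule mult_right_mono)
        have "t * (M * c + 1) \<le> d1"
          using t(2) Mc by (simp add: \<delta>_def pos_le_divide_eq)
        then show "t * (M * c) \<le> d1" using t(1) by (simp add: algebra_simps)
      qed simp
      finally show "norm (V 1 \<cdot> y - U \<cdot> y) \<le> d1 * norm y" .
    qed
    also have "\<dots> \<le> e1 * c" using v e1 by simp
    also have "\<dots> \<le> e / 2" using e c by (simp add: e1_def field_simps)
    finally have 2: "norm (fc (V 1) ?h \<cdot> v - fc U ?h \<cdot> v) \<le> e / 2" .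
    let ?s = "of_real (t\<^sup>2) * l k * \<beta>"
    have s: "cmod ?s \<le> t\<^sup>2" using \<beta> mult_left_mono[of "cmod \<beta>" 1 "t\<^sup>2"] by (simp add: norm_mult norm_power)
    have 3: "norm (?s *\<^sub>C (fc U ?h \<cdot> v) - ?s *\<^sub>C (fc (V 1) ?h \<cdot> v)) \<le> t\<^sup>2 * (e / 2)"
      unfolding scaleC_diff_right[symmetric] norm_scaleC
      using 2 s by (intro mult_mono) (auto simp: norm_minus_commute)
    have "t ^ 3 * K \<le> t\<^sup>2 * (e / 2)"
    proof -
      have "t * (2 * (K + 1)) \<le> e" using t(2) K by (simp add: \<delta>_def pos_le_divide_eq)
      then have "t * K \<le> e / 2" using t(1) by (simp add: algebra_simps)
      then have "t\<^sup>2 * (t * K) \<le> t\<^sup>2 * (e / 2)" by (rule mult_left_mono) simp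
      then show ?thesis by (simp add: power3_eq_cube power2_eq_square mult_ac)
    qed
    moreover have eq: "(G 1 - D) \<cdot> basis_vec k + ?s *\<^sub>C (fc U ?h \<cdot> v) =
        ((G 1 - D) \<cdot> basis_vec k + ?s *\<^sub>C (fc (V 1) ?h \<cdot> v)) + (?s *\<^sub>C (fc U ?h \<cdot> v) - ?s *\<^sub>C (fc (V 1) ?h \<cdot> v))"
      by simp
    ultimately have "norm ((G 1 - D) \<cdot> basis_vec k + ?s *\<^sub>C (fc U ?h \<cdot> v)) \<le> t\<^sup>2 * (e / 2) + t\<^sup>2 * (e / 2)"
      unfolding eq using norm_triangle_mono[OF 1 3] by linarith
    then show ?thesis by (simp add: mult.commute)
  qed
  ultimately show ?thesis by blast
qed

section \<open>The function\<close>

text \<open>At 0 the difference quotient from the right is \<open>g x / x\<close>, so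
  \<open>lim\<close> is what matches it with the zero function on the left.\<close>

lemma one_sided_derivative:
  fixes g g' :: "real \<Rightarrow> real"
  assumes pos: "\<And>x. x > 0 \<Longrightarrow> (g has_real_derivative g' x) (at x)"
    and lim: "((\<lambda>x. g x / x) \<longlongrightarrow> 0) (at_right 0)"
  shows "((\<lambda>x. if x > 0 then g x else 0) has_real_derivative (if x > 0 then g' x else 0)) (at x)"
proof -
  consider "x > 0" | "x < 0" | "x = 0" by linarith
  then show ?thesis
  proof cases
    case 1
    have "((\<lambda>x. if x > 0 then g x else 0) has_real_derivative g' x) (at x)"
      by (rule has_field_derivative_transform_within_open[OF pos[OF 1], of "{0<..}"]) (use 1 in auto)
    then show ?thesis using 1 by simp
  next
    case 2
    have "((\<lambda>x. if x > 0 then g x else 0) has_real_derivative 0) (at x)"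
      by (rule has_field_derivative_transform_within_open[OF DERIV_const[of 0], of "{..<0}"]) (use 2 in auto)
    then show ?thesis using 2 by simp
  next
    case 3
    have "((\<lambda>y. ((if y > 0 then g y else 0) - 0) / (y - 0)) \<longlongrightarrow> 0) (at 0)"
      unfolding filterlim_at_split
    proof
      show "((\<lambda>y. ((if y > 0 then g y else 0) - 0) / (y - 0)) \<longlongrightarrow> 0) (at_left 0)"
        by (rule tendsto_eventually) (auto simp: eventually_at_filter)
      show "((\<lambda>y. ((if y > 0 then g y else 0) - 0) / (y - 0)) \<longlongrightarrow> 0) (at_right 0)"
        by (rule Lim_transform_eventually[OF lim]) (auto simp: eventually_at_filter)
    qed
    then show ?thesis using 3 by (simp add: has_field_derivative_iff)
  qed
qed

text \<open>Since \<open>3 > exp 1\<close>, the inner logarithm exceeds 1 and the outer one is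
  positive for every \<open>x > 0\<close>, not only near 0.\<close>

definition wgt :: "real \<Rightarrow> real" where
  "wgt x = ln (ln (3 + 1 / x)) powr (- 1 / 2)"

definition phi :: "real \<Rightarrow> real" where
  "phi x = (if x > 0 then x\<^sup>2 * wgt x else 0)"

definition phi1 :: "real \<Rightarrow> real" where
  "phi1 x = (if x > 0 then 2 * x * ln (ln (3 + 1 / x)) powr (- 1 / 2) +
     x / (3 * x + 1) * ln (ln (3 + 1 / x)) powr (- 3 / 2) / (2 * ln (3 + 1 / x)) else 0)"

text \<open>Each summand has a negative power of the double logarithm and so vanishes at 0. The
  first, twice the weight, is the slow one; the others carry at least one more factor
  \<open>1 / ln\<close>, so that differentiating the weight does no harm.\<close>

definition phi2 :: "real \<Rightarrow> real" where
  "phi2 x = (if x > 0 then 2 * ln (ln (3 + 1 / x)) powr (- 1 / 2) +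
     ln (ln (3 + 1 / x)) powr (- 3 / 2) / (ln (3 + 1 / x) * (3 * x + 1)) +
     ln (ln (3 + 1 / x)) powr (- 3 / 2) / (2 * ln (3 + 1 / x) * (3 * x + 1)\<^sup>2) +
     3 * ln (ln (3 + 1 / x)) powr (- 5 / 2) / (4 * (ln (3 + 1 / x))\<^sup>2 * (3 * x + 1)\<^sup>2) +
     ln (ln (3 + 1 / x)) powr (- 3 / 2) / (2 * (ln (3 + 1 / x))\<^sup>2 * (3 * x + 1)\<^sup>2) else 0)"

lemma ln_3_gt: "x > 0 \<Longrightarrow> 1 < ln (3 + 1 / x :: real)" "x > 0 \<Longrightarrow> 0 < ln (ln (3 + 1 / x :: real))"
proof -
  assume x: "x > 0"
  have "ln (exp 1) < ln (3 + 1 / x)"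
  proof (subst ln_less_cancel_iff)
    show "exp 1 < 3 + 1 / x" using exp_le x by (smt (verit) divide_pos_pos)
  qed (use x in \<open>auto simp: add_pos_pos\<close>)
  then show "1 < ln (3 + 1 / x)" by simp
  then show "0 < ln (ln (3 + 1 / x))" by simp
qed

lemma wgt_pos: "x > 0 \<Longrightarrow> 0 < wgt x"
  using ln_3_gt[of x] by (simp add: wgt_def)

lemma wgt_mono:
  assumes "0 < x" "x \<le> y"
  shows "wgt x \<le> wgt y"
proof -
  have "ln (3 + 1 / y) \<le> ln (3 + 1 / x)"
    using assms by (subst ln_le_cancel_iff) (auto simp: frac_le add_pos_pos)
  then have "ln (ln (3 + 1 / y)) \<le> ln (ln (3 + 1 / x))"
    using ln_3_gt[of x] ln_3_gt[of y] assms by (subst ln_le_cancel_iff) auto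
  then show ?thesis
    unfolding wgt_def using ln_3_gt[of y] assms by (intro powr_mono2') auto
qed

lemma DERIV_ln3:
  assumes "x > 0"
  shows "((\<lambda>x. ln (3 + 1 / x)) has_real_derivative - 1 / (x * (3 * x + 1))) (at x)"
proof -
  have n: "3 + 1 / x > 0"
    using assms by (auto simp: add_pos_pos)
  have 1: "((\<lambda>x. 3 + 1 / x) has_real_derivative - 1 / x\<^sup>2) (at x)"
    using assms by (auto intro!: derivative_eq_intros simp: power2_eq_square)
  have 2: "((\<lambda>x. ln (3 + 1 / x)) has_real_derivative 1 / (3 + 1 / x) * (- 1 / x\<^sup>2)) (at x)"
    by (rule DERIV_chain2[OF DERIV_ln_divide[OF n] 1])
  moreover have "1 / (3 + 1 / x) * (- 1 / x\<^sup>2) = - 1 / (x * (3 * x + 1))"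
    using assms by (simp add: power2_eq_square divide_simps add_pos_pos)
  ultimately show ?thesis by simp
qed

lemma DERIV_lnln:
  assumes "x > 0"
  shows "((\<lambda>x. ln (ln (3 + 1 / x)) powr a) has_real_derivative
    - a * ln (ln (3 + 1 / x)) powr (a - 1) / (ln (3 + 1 / x) * (x * (3 * x + 1)))) (at x)"
proof -
  have n: "ln (ln (3 + 1 / x)) > 0" "ln (3 + 1 / x) > 0"
    using ln_3_gt[OF assms] by auto
  have "((\<lambda>x. ln (ln (3 + 1 / x))) has_real_derivative 1 / ln (3 + 1 / x) * (- 1 / (x * (3 * x + 1)))) (at x)"
    by (rule DERIV_chain2[OF DERIV_ln_divide[OF n(2)] DERIV_ln3[OF assms]])
  from DERIV_fun_powr[OF this n(1), of a] show ?thesis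
    by (rule DERIV_cong) simp
qed

lemma DERIV_phi: "(phi has_real_derivative phi1 x) (at x)"
proof -
  have "((\<lambda>x. x\<^sup>2 * wgt x / x) \<longlongrightarrow> 0) (at_right 0)"
    unfolding wgt_def by real_asymp
  moreover have "((\<lambda>x. x\<^sup>2 * wgt x) has_real_derivative
      2 * x * ln (ln (3 + 1 / x)) powr (- 1 / 2) +
      x / (3 * x + 1) * ln (ln (3 + 1 / x)) powr (- 3 / 2) / (2 * ln (3 + 1 / x))) (at x)" if "x > 0" for x
    unfolding wgt_def
  proof (rule DERIV_cong[OF DERIV_mult[OF DERIV_power[OF DERIV_ident, of 2] DERIV_lnln[OF that, of "- 1 / 2"]]])
    \<comment> \<open>Naming the powers of the double logarithm leaves an identity between rational
      functions.\<close>
    define A where "A = ln (ln (3 + 1 / x)) powr (- 1 / 2)"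
    define B where "B = ln (ln (3 + 1 / x)) powr (- 3 / 2)"
    define H where "H = ln (3 + 1 / x)"
    define y where "y = 3 * x + 1"
    have pos: "y > 0" "H > 0" using that ln_3_gt[OF that] by (auto simp: y_def H_def)
    have e: "- 1 / 2 - 1 = (- 3 / 2 :: real)" by simp
    have "of_nat 2 * (1 * x ^ (2 - Suc 0)) * A + - (- 1 / 2) * B / (H * (x * y)) * x\<^sup>2 =
        2 * x * A + x / y * B / (2 * H)"
      using pos that by (simp add: power2_eq_square divide_simps)
    then show "of_nat 2 * (1 * x ^ (2 - Suc 0)) * ln (ln (3 + 1 / x)) powr (- 1 / 2) +
        - (- 1 / 2) * ln (ln (3 + 1 / x)) powr (- 1 / 2 - 1) / (ln (3 + 1 / x) * (x * (3 * x + 1))) * x\<^sup>2 =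
        2 * x * ln (ln (3 + 1 / x)) powr (- 1 / 2) +
        x / (3 * x + 1) * ln (ln (3 + 1 / x)) powr (- 3 / 2) / (2 * ln (3 + 1 / x))"
      unfolding e A_def B_def H_def y_def .
  qed
  ultimately show ?thesis
    unfolding phi_def[abs_def] phi1_def by (intro one_sided_derivative)
qed

lemma DERIV_phi1: "(phi1 has_real_derivative phi2 x) (at x)"
proof -
  have "((\<lambda>x::real. (2 * x * ln (ln (3 + 1 / x)) powr (- 1 / 2) +
     x / (3 * x + 1) * ln (ln (3 + 1 / x)) powr (- 3 / 2) / (2 * ln (3 + 1 / x))) / x) \<longlongrightarrow> 0) (at_right 0)"
    by real_asymp
  moreover have "((\<lambda>x. 2 * x * ln (ln (3 + 1 / x)) powr (- 1 / 2) +
     x / (3 * x + 1) * ln (ln (3 + 1 / x)) powr (- 3 / 2) / (2 * ln (3 + 1 / x))) has_real_derivative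
     2 * ln (ln (3 + 1 / x)) powr (- 1 / 2) +
     ln (ln (3 + 1 / x)) powr (- 3 / 2) / (ln (3 + 1 / x) * (3 * x + 1)) +
     ln (ln (3 + 1 / x)) powr (- 3 / 2) / (2 * ln (3 + 1 / x) * (3 * x + 1)\<^sup>2) +
     3 * ln (ln (3 + 1 / x)) powr (- 5 / 2) / (4 * (ln (3 + 1 / x))\<^sup>2 * (3 * x + 1)\<^sup>2) +
     ln (ln (3 + 1 / x)) powr (- 3 / 2) / (2 * (ln (3 + 1 / x))\<^sup>2 * (3 * x + 1)\<^sup>2)) (at x)" if x: "x > 0" for x
  proof -
    have h: "ln (3 + 1 / x) > 0" using ln_3_gt[OF x] by simp
    have 1: "((\<lambda>x. x / (3 * x + 1)) has_real_derivative 1 / (3 * x + 1)\<^sup>2) (at x)"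
      using x by (auto intro!: derivative_eq_intros simp: power2_eq_square)
    have 2: "((\<lambda>x. 2 * ln (3 + 1 / x)) has_real_derivative 2 * (- 1 / (x * (3 * x + 1)))) (at x)"
      by (rule DERIV_cmult[OF DERIV_ln3[OF x]])
    have 3: "((\<lambda>x. 2 * x) has_real_derivative 2 * 1) (at x)"
      by (rule DERIV_cmult[OF DERIV_ident])
    define A where "A = ln (ln (3 + 1 / x)) powr (- 1 / 2)"
    define B where "B = ln (ln (3 + 1 / x)) powr (- 3 / 2)"
    define E where "E = ln (ln (3 + 1 / x)) powr (- 5 / 2)"
    define H where "H = ln (3 + 1 / x)"
    define y where "y = 3 * x + 1"
    have y: "y > 0" "H > 0" using x h by (auto simp: y_def H_def)
    have e: "- 1 / 2 - 1 = (- 3 / 2 :: real)" "- 3 / 2 - 1 = (- 5 / 2 :: real)" by simp_all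
    have "((\<lambda>x. 2 * x * ln (ln (3 + 1 / x)) powr (- 1 / 2) +
     x / (3 * x + 1) * ln (ln (3 + 1 / x)) powr (- 3 / 2) / (2 * ln (3 + 1 / x))) has_real_derivative
      (2 * 1 * A + (- (- 1 / 2) * B / (H * (x * y))) * (2 * x)) +
      ((1 / y\<^sup>2 * B + (- (- 3 / 2) * E / (H * (x * y))) * (x / y)) * (2 * H) -
        (x / y * B) * (2 * (- 1 / (x * y)))) / ((2 * H) * (2 * H))) (at x)"
      unfolding A_def B_def E_def H_def y_def
      using DERIV_add[OF DERIV_mult[OF 3 DERIV_lnln[OF x, of "- 1 / 2"]]
        DERIV_divide[OF DERIV_mult[OF 1 DERIV_lnln[OF x, of "- 3 / 2"]] 2]] h
      unfolding e by simp
    moreover have "(2 * 1 * A + (- (- 1 / 2) * B / (H * (x * y))) * (2 * x)) +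
      ((1 / y\<^sup>2 * B + (- (- 3 / 2) * E / (H * (x * y))) * (x / y)) * (2 * H) -
        (x / y * B) * (2 * (- 1 / (x * y)))) / ((2 * H) * (2 * H)) =
      2 * A + B / (H * y) + B / (2 * H * y\<^sup>2) + 3 * E / (4 * H\<^sup>2 * y\<^sup>2) + B / (2 * H\<^sup>2 * y\<^sup>2)"
      using y x by (simp add: divide_simps power2_eq_square) (simp add: algebra_simps)
    ultimately show ?thesis unfolding A_def B_def E_def H_def y_def by (rule DERIV_cong)
  qed
  ultimately show ?thesis
    unfolding phi1_def[abs_def] phi2_def by (intro one_sided_derivative)
qed

lemma continuous_phi2: "continuous_on UNIV phi2"
proof -
  define g where "g x = 2 * ln (ln (3 + 1 / x)) powr (- 1 / 2) +
     ln (ln (3 + 1 / x)) powr (- 3 / 2) / (ln (3 + 1 / x) * (3 * x + 1)) +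
     ln (ln (3 + 1 / x)) powr (- 3 / 2) / (2 * ln (3 + 1 / x) * (3 * x + 1)\<^sup>2) +
     3 * ln (ln (3 + 1 / x)) powr (- 5 / 2) / (4 * (ln (3 + 1 / x))\<^sup>2 * (3 * x + 1)\<^sup>2) +
     ln (ln (3 + 1 / x)) powr (- 3 / 2) / (2 * (ln (3 + 1 / x))\<^sup>2 * (3 * x + 1)\<^sup>2)" for x :: real
  have phi2: "phi2 x = (if x > 0 then g x else 0)" for x by (simp add: phi2_def g_def)
  have "isCont phi2 x" for x
  proof -
    consider "x > 0" | "x < 0" | "x = 0" by linarith
    then show ?thesis
    proof cases
      case 1
      have "isCont g x"
        unfolding g_def using 1 ln_3_gt[OF 1]
        by (intro continuous_intros) (auto simp: add_pos_pos less_imp_neq[symmetric])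
      moreover have "\<forall>\<^sub>F y in nhds x. phi2 y = g y"
        using eventually_nhds_in_open[of "{0<..}" x] 1 by (auto simp: phi2 elim!: eventually_mono)
      ultimately show ?thesis using isCont_cong by blast
    next
      case 2
      have "\<forall>\<^sub>F y in nhds x. phi2 y = 0"
        using eventually_nhds_in_open[of "{..<0}" x] 2 by (auto simp: phi2 elim!: eventually_mono)
      then show ?thesis using isCont_cong[of phi2 "\<lambda>_. 0"] by simp
    next
      case 3
      have "(g \<longlongrightarrow> 0) (at_right 0)" unfolding g_def by real_asymp
      then have "(phi2 \<longlongrightarrow> 0) (at_right 0)"
        by (rule Lim_transform_eventually) (auto simp: eventually_at_filter phi2)
      moreover have "(phi2 \<longlongrightarrow> 0) (at_left 0)"
        by (rule tendsto_eventually) (auto simp: eventually_at_filter phi2)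
      ultimately show ?thesis unfolding isCont_def 3 by (simp add: filterlim_at_split phi2)
    qed
  qed
  then show ?thesis by (simp add: continuous_on_eq_continuous_at)
qed

section \<open>Differentiation along the circle\<close>

lemma Im_on_circle:
  assumes "z \<in> circle"
  shows "complex_of_real (Im z) = (z - 1 / z) / (2 * \<i>)"
proof -
  have "z \<noteq> 0" "z * cnj z = 1" using assms by (auto simp: mult_cnj_cmod)
  then have "1 / z = cnj z" by (simp add: field_simps)
  then show ?thesis by (simp add: complex_eq_iff)
qed

text \<open>Derivative of the right side of \<open>Im_on_circle\<close>, a function holomorphic away
  from 0 that agrees with \<open>Im\<close> on the circle; \<open>Im\<close> itself has no complex
  derivative in the plane.\<close>

definition Im_deriv :: "complex \<Rightarrow> complex" where
  "Im_deriv z = (1 + 1 / z\<^sup>2) / (2 * \<i>)"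

text \<open>The chain rule through Caratheodory's slope function \<open>s\<close>, which avoids
  dividing by \<open>Im w - Im z\<close>.\<close>

lemma has_derivative_Im_circle:
  assumes "(g has_real_derivative d) (at (Im z))" "z \<in> circle"
  shows "((\<lambda>w. of_real (g (Im w))) has_field_derivative of_real d * Im_deriv z) (at z within circle)"
proof -
  obtain s where s: "\<And>x. g x - g (Im z) = s x * (x - Im z)" "isCont s (Im z)" "s (Im z) = d"
    using assms(1) unfolding CARAT_DERIV by blast
  let ?X = "\<lambda>w. (w - 1 / w) / (2 * \<i>)"
  have z: "z \<noteq> 0" using assms(2) by auto
  have "(?X has_field_derivative Im_deriv z) (at z within circle)"
    using z unfolding Im_deriv_def by (auto intro!: derivative_eq_intros simp: power2_eq_square)
  then have 1: "((\<lambda>w. (?X w - ?X z) / (w - z)) \<longlongrightarrow> Im_deriv z) (at z within circle)"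
    by (simp add: has_field_derivative_iff)
  have "((\<lambda>w. s (Im w)) \<longlongrightarrow> s (Im z)) (at z within circle)"
    by (rule isCont_tendsto_compose[OF s(2)]) (intro tendsto_intros)
  then have 2: "((\<lambda>w. complex_of_real (s (Im w))) \<longlongrightarrow> of_real d) (at z within circle)"
    unfolding s(3) by (rule tendsto_of_real)
  have "\<forall>\<^sub>F w in at z within circle. complex_of_real (s (Im w)) * ((?X w - ?X z) / (w - z)) =
      (of_real (g (Im w)) - of_real (g (Im z))) / (w - z)"
  proof -
    have "complex_of_real (s (Im w)) * ((?X w - ?X z) / (w - z)) =
      (of_real (g (Im w)) - of_real (g (Im z))) / (w - z)" if "w \<in> circle" for w
      unfolding Im_on_circle[OF that, symmetric] Im_on_circle[OF assms(2), symmetric]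
      by (simp add: s(1) flip: of_real_diff)
    then show ?thesis unfolding eventually_at_filter by (intro always_eventually) blast
  qed
  from Lim_transform_eventually[OF tendsto_mult[OF 2 1] this]
  show ?thesis by (simp add: has_field_derivative_iff)
qed

definition circle_fun :: "complex \<Rightarrow> complex" where
  "circle_fun z = of_real (phi (Im z))"

definition circle_fun1 :: "complex \<Rightarrow> complex" where
  "circle_fun1 z = of_real (phi1 (Im z)) * Im_deriv z"

lemma circle_fun_derivative:
  "z \<in> circle \<Longrightarrow> (circle_fun has_field_derivative circle_fun1 z) (at z within circle)"
  unfolding circle_fun_def[abs_def] circle_fun1_def by (rule has_derivative_Im_circle[OF DERIV_phi])

lemma C2_circle_fun: "C2_circle circle_fun"
proof -
  define f2 where "f2 z = of_real (phi2 (Im z)) * Im_deriv z * Im_deriv z +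
      (- 2 / z ^ 3) / (2 * \<i>) * of_real (phi1 (Im z))" for z
  have "(circle_fun1 has_field_derivative f2 z) (at z within circle)" if z: "z \<in> circle" for z
  proof -
    have z0: "z \<noteq> 0" using z by auto
    have "(Im_deriv has_field_derivative (- 2 / z ^ 3) / (2 * \<i>)) (at z within circle)"
      using z0 unfolding Im_deriv_def[abs_def]
      by (auto intro!: derivative_eq_intros simp: power2_eq_square power3_eq_cube field_simps)
    from DERIV_mult[OF has_derivative_Im_circle[OF DERIV_phi1 z] this] show ?thesis
      unfolding circle_fun1_def[abs_def] f2_def by simp
  qed
  moreover have "continuous_on circle f2"
  proof -
    have c: "continuous_on UNIV phi1"
      by (rule DERIV_continuous_on) (use DERIV_phi1 in blast)
    have "continuous_on circle (\<lambda>z. phi2 (Im z))" "continuous_on circle (\<lambda>z. phi1 (Im z))"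
      by (rule continuous_on_compose2[OF continuous_phi2] continuous_on_compose2[OF c]; auto intro: continuous_intros)+
    then show ?thesis unfolding f2_def Im_deriv_def by (intro continuous_intros) auto
  qed
  ultimately show ?thesis unfolding C2_circle_def using circle_fun_derivative by blast
qed

lemma continuous_circle_fun: "continuous_on circle circle_fun"
  unfolding continuous_on_eq_continuous_within
  using circle_fun_derivative DERIV_continuous by blast

text \<open>The bound on \<open>circle_fun1\<close> concerns the diagonal value of the divided
  difference, so that one constant bounds \<open>div1\<close> everywhere.\<close>

lemma circle_fun_Lipschitz:
  obtains C where "0 \<le> C" "\<And>z w. z \<in> circle \<Longrightarrow> w \<in> circle \<Longrightarrow> cmod (circle_fun z - circle_fun w) \<le> C * cmod (z - w)"
    "\<And>z. z \<in> circle \<Longrightarrow> cmod (circle_fun1 z) \<le> C"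
proof -
  have "continuous_on {-1..1} phi1"
    by (rule DERIV_continuous_on) (use DERIV_phi1 has_field_derivative_at_within in blast)
  then have "bounded (phi1 ` {-1..1})" by (intro compact_imp_bounded compact_continuous_image) auto
  then obtain C where "\<forall>y\<in>phi1 ` {-1..1}. norm y \<le> C" unfolding bounded_iff by blast
  then have C: "\<And>x. x \<in> {-1..1} \<Longrightarrow> \<bar>phi1 x\<bar> \<le> C" by auto
  have C0: "0 \<le> C" using C[of 0] by simp
  have Im: "Im z \<in> {-1..1}" if "z \<in> circle" for z
    using abs_Im_le_cmod[of z] that by (auto simp: abs_le_iff)
  have "cmod (circle_fun z - circle_fun w) \<le> C * cmod (z - w)" if "z \<in> circle" "w \<in> circle" for z w
  proof -
    have "norm (phi (Im z) - phi (Im w)) \<le> C * norm (Im z - Im w)"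
      by (rule field_differentiable_bound[of "{-1..1}" phi phi1])
        (use C Im that in \<open>auto intro: has_field_derivative_at_within[OF DERIV_phi]\<close>)
    also have "\<dots> \<le> C * cmod (z - w)"
      using abs_Im_le_cmod[of "z - w"] C0 by (simp add: mult_left_mono)
    finally show ?thesis by (simp add: circle_fun_def flip: of_real_diff)
  qed
  moreover have "cmod (circle_fun1 z) \<le> C" if "z \<in> circle" for z
  proof -
    have "cmod (Im_deriv z) \<le> 1"
      using that norm_triangle_ineq[of 1 "1 / z\<^sup>2"] by (simp add: Im_deriv_def norm_divide norm_mult norm_power)
    then have "\<bar>phi1 (Im z)\<bar> * cmod (Im_deriv z) \<le> C * 1"
      using C[OF Im[OF that]] C0 by (intro mult_mono) auto
    then show ?thesis by (simp add: circle_fun1_def norm_mult)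
  qed
  ultimately show thesis using that C0 by blast
qed

section \<open>Divided differences on the circle\<close>

definition div_diff :: "(complex \<Rightarrow> complex) \<Rightarrow> complex \<Rightarrow> complex \<Rightarrow> complex \<Rightarrow> complex" where
  "div_diff g d w z = (if z = w then d else (g z - g w) / (z - w))"

text \<open>Both sides vanish at \<open>z = w\<close>, whatever \<open>d\<close> is; the choice of
  \<open>d\<close> decides about continuity.\<close>

lemma div_diff_mult: "g z - g w = div_diff g d w z * (z - w)"
  by (simp add: div_diff_def)

lemma continuous_div_diff:
  assumes "continuous_on S g" "(g has_field_derivative d) (at w within S)"
  shows "continuous_on S (div_diff g d w)"
  unfolding continuous_on_eq_continuous_within
proof
  fix z assume z: "z \<in> S"
  show "continuous (at z within S) (div_diff g d w)"
  proof (cases "z = w")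
    case True
    have "(div_diff g d w \<longlongrightarrow> d) (at w within S)"
      by (rule Lim_transform_eventually[OF assms(2)[unfolded has_field_derivative_iff]])
        (auto simp: eventually_at_filter div_diff_def)
    then show ?thesis using True by (simp add: continuous_within div_diff_def)
  next
    case False
    have "(g \<longlongrightarrow> g z) (at z within S)" using assms(1) z by (simp add: continuous_on)
    then have "((\<lambda>y. (g y - g w) / (y - w)) \<longlongrightarrow> (g z - g w) / (z - w)) (at z within S)"
      using False by (intro tendsto_intros) auto
    moreover have "\<forall>\<^sub>F y in at z within S. (g y - g w) / (y - w) = div_diff g d w y"
    proof -
      have "\<forall>\<^sub>F y in nhds z. y \<in> - {w}" using False by (intro eventually_nhds_in_open) auto
      then have "\<forall>\<^sub>F y in at z within S. y \<in> - {w}" by (rule filter_leD[OF at_within_le_nhds])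
      then show ?thesis by eventually_elim (simp add: div_diff_def)
    qed
    ultimately show ?thesis using False
      by (simp add: continuous_within div_diff_def[of g d w z] Lim_transform_eventually)
  qed
qed

definition div1 :: "complex \<Rightarrow> complex \<Rightarrow> complex" where
  "div1 w = div_diff circle_fun (circle_fun1 w) w"

lemma continuous_div1: "w \<in> circle \<Longrightarrow> continuous_on circle (div1 w)"
  unfolding div1_def by (intro continuous_div_diff continuous_circle_fun circle_fun_derivative)

text \<open>Near 1, and so away from \<open>w\<close>, the divided difference is a quotient of
  differentiable functions. With the second base point at 1 and \<open>w \<noteq> 1\<close>, the
  continuity of \<open>div2\<close> rests on first derivatives.\<close>

lemma div1_derivative_1:
  assumes "w \<in> circle" "w \<noteq> 1"
  shows "\<exists>d. (div1 w has_field_derivative d) (at 1 within circle)"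
proof -
  have "((\<lambda>z. (circle_fun z - circle_fun w) / (z - w)) has_field_derivative
      ((circle_fun1 1 - 0) * (1 - w) - (circle_fun 1 - circle_fun w) * (1 - 0)) / ((1 - w) * (1 - w))) (at 1 within circle)"
    using assms(2) by (intro DERIV_divide DERIV_diff circle_fun_derivative DERIV_const DERIV_ident) auto
  then have "(div1 w has_field_derivative
      ((circle_fun1 1 - 0) * (1 - w) - (circle_fun 1 - circle_fun w) * (1 - 0)) / ((1 - w) * (1 - w))) (at 1 within circle)"
  proof (rule has_field_derivative_transform_within)
    show "0 < dist w 1" using assms(2) by simp
  qed (auto simp: div1_def div_diff_def dist_commute)
  then show ?thesis by blast
qed

definition div2 :: "complex \<Rightarrow> complex \<Rightarrow> complex" where
  "div2 w = div_diff (div1 w) (SOME d. (div1 w has_field_derivative d) (at 1 within circle)) 1"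

lemma continuous_div2: "w \<in> circle \<Longrightarrow> w \<noteq> 1 \<Longrightarrow> continuous_on circle (div2 w)"
  unfolding div2_def by (intro continuous_div_diff continuous_div1 someI_ex[OF div1_derivative_1])

lemma div1_mult: "circle_fun z - circle_fun w = div1 w z * (z - w)"
  unfolding div1_def by (rule div_diff_mult)

lemma div2_mult: "div1 w z - div1 w 1 = div2 w z * (z - 1)"
  unfolding div2_def by (rule div_diff_mult)

section \<open>Cayley coordinates on the circle\<close>

definition cayley :: "real \<Rightarrow> complex" where
  "cayley u = (1 + \<i> * of_real u) / (1 - \<i> * of_real u)"

lemma one_minus_iu: "1 - \<i> * of_real u \<noteq> 0" "cmod (1 - \<i> * of_real u) \<ge> 1" "cmod (1 + \<i> * of_real u) = cmod (1 - \<i> * of_real u)"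
proof -
  show 1: "1 - \<i> * of_real u \<noteq> 0" by (simp add: complex_eq_iff)
  show "cmod (1 - \<i> * of_real u) \<ge> 1" using abs_Re_le_cmod[of "1 - \<i> * of_real u"] by simp
  show "cmod (1 + \<i> * of_real u) = cmod (1 - \<i> * of_real u)" by (simp add: cmod_def)
qed

lemma cayley_circle [simp]: "cayley u \<in> circle"
  using one_minus_iu[of u] by (simp add: cayley_def norm_divide)

lemma Im_cayley: "Im (cayley u) = 2 * u / (1 + u\<^sup>2)"
  by (simp add: cayley_def Im_divide power2_eq_square)

lemma cayley_minus_1: "cayley u - 1 = 2 * \<i> * of_real u / (1 - \<i> * of_real u)"
  using one_minus_iu(1)[of u] by (simp add: cayley_def field_simps)

text \<open>Apart from \<open>u - v\<close> this is a function of \<open>u\<close> times a function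
  of \<open>v\<close>. Such factors can be moved into the amplitudes of \<open>Z\<close>, which is
  the reason for these coordinates.\<close>

lemma cayley_diff:
  "cayley u - cayley v = 2 * \<i> * of_real (u - v) / ((1 - \<i> * of_real u) * (1 - \<i> * of_real v))"
  using one_minus_iu(1)[of u] one_minus_iu(1)[of v] by (simp add: cayley_def field_simps)

text \<open>\<open>circle_fun\<close> vanishes at 1 and at \<open>cayley v\<close>, so a single
  quotient survives. With \<open>x = cayley u\<close> one has
  \<open>1 / (x - 1) = 1 / (2 \<i> u) - 1 / 2\<close>, and the half contributed by the exponential
  cancels the last term.\<close>

lemma divided_difference_value:
  assumes "u > 0" "v < 0"
  shows "div2 (cayley v) (cayley u) + div1 (cayley v) (cayley u) / 2 =
    - circle_fun (cayley u) * (1 - \<i> * of_real u) * (1 - \<i> * of_real v) / of_real (4 * u * (u - v))"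
proof -
  let ?x = "cayley u" and ?y = "cayley v"
  define a where "a = 1 - \<i> * complex_of_real u"
  define b where "b = 1 - \<i> * complex_of_real v"
  have ab: "a \<noteq> 0" "b \<noteq> 0" using one_minus_iu(1) by (auto simp: a_def b_def)
  have uv: "complex_of_real u \<noteq> 0" "complex_of_real (u - v) \<noteq> 0" "complex_of_real v \<noteq> 0"
    using assms by (auto simp del: of_real_diff)
  have x1: "?x - 1 = 2 * \<i> * of_real u / a" unfolding a_def by (rule cayley_minus_1)
  have xy: "?x - ?y = 2 * \<i> * of_real (u - v) / (a * b)" unfolding a_def b_def by (rule cayley_diff)
  have ne: "?x \<noteq> ?y" "?x \<noteq> 1" "?y \<noteq> 1"
  proof -
    have "?x - ?y \<noteq> 0" "?x - 1 \<noteq> 0" "?y - 1 \<noteq> 0"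
      using ab uv one_minus_iu(1)[of v] unfolding xy x1 cayley_minus_1[of v] by auto
    then show "?x \<noteq> ?y" "?x \<noteq> 1" "?y \<noteq> 1" by auto
  qed
  have "2 * v / (1 + v\<^sup>2) \<le> 0" using assms by (intro divide_nonpos_pos) (auto simp: add_pos_nonneg)
  then have f0: "circle_fun ?y = 0" "circle_fun 1 = 0"
    by (auto simp: circle_fun_def phi_def Im_cayley)
  have d1: "div1 ?y ?x = circle_fun ?x / (?x - ?y)" "div1 ?y 1 = 0"
    using ne f0 by (auto simp: div1_def div_diff_def)
  then have d2: "div2 ?y ?x = circle_fun ?x / (?x - ?y) / (?x - 1)"
    using ne by (auto simp: div2_def div_diff_def)
  have s: "1 / (?x - 1) + 1 / 2 = 1 / (2 * \<i> * of_real u)"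
    using ab uv unfolding x1 by (simp add: divide_simps) (simp add: a_def algebra_simps)
  have "div2 ?y ?x + div1 ?y ?x / 2 = circle_fun ?x / (?x - ?y) * (1 / (?x - 1) + 1 / 2)"
    unfolding d1 d2 by (simp add: algebra_simps)
  also have "\<dots> = circle_fun ?x / (2 * \<i> * of_real (u - v) / (a * b)) * (1 / (2 * \<i> * of_real u))"
    unfolding s xy ..
  also have "\<dots> = - circle_fun ?x * a * b / of_real (4 * u * (u - v))"
    using ab uv by (simp add: divide_simps del: of_real_diff)
  finally show ?thesis unfolding a_def b_def .
qed

text \<open>\<open>2 u / (1 + u^2) \<ge> u\<close> on the unit interval. Evaluating the weight at a
  common lower bound \<open>s\<close> gives all points of a block the same factor.\<close>

lemma phi_cayley_ge:
  assumes "0 < s" "s \<le> u" "u \<le> 1"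
  shows "u\<^sup>2 * wgt s \<le> phi (Im (cayley u))"
proof -
  have "u * (1 + u\<^sup>2) \<le> u * 2" using assms by (intro mult_left_mono) (auto simp: power_le_one)
  then have u: "u \<le> 2 * u / (1 + u\<^sup>2)" by (simp add: pos_le_divide_eq add_pos_nonneg mult.commute)
  then have "u\<^sup>2 * wgt s \<le> (2 * u / (1 + u\<^sup>2))\<^sup>2 * wgt (2 * u / (1 + u\<^sup>2))"
    using assms by (intro mult_mono power_mono wgt_mono) (auto intro!: less_imp_le[OF wgt_pos])
  moreover have "2 * u / (1 + u\<^sup>2) > 0" using assms u by linarith
  ultimately show ?thesis by (simp add: phi_def Im_cayley)
qed

section \<open>Fourier test vectors for triangular truncation\<close>

text \<open>For \<open>z\<close> a root of unity this is \<open>N\<close> times a diagonal entry of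
  the triangular matrix in the Fourier basis. The inner sum is geometric,
  \<open>(1 - cnj z ^ p) / (1 - z)\<close>, and the powers of \<open>cnj z\<close> add up to
  0.\<close>

lemma triangular_sum:
  fixes z :: complex
  assumes "z \<noteq> 1" "z ^ N = 1" "z * cnj z = 1"
  shows "(\<Sum>p<N. \<Sum>r<N. (if p \<le> r then 1 else 0) * (z ^ r * cnj z ^ p)) = of_nat N / (1 - z)"
proof -
  have inner: "(\<Sum>r<N. (if p \<le> r then 1 else 0) * (z ^ r * cnj z ^ p)) = (1 - cnj z ^ p) / (1 - z)" if p: "p < N" for p
  proof -
    have "(\<Sum>r<N. (if p \<le> r then 1 else 0) * (z ^ r * cnj z ^ p)) = (\<Sum>r\<in>{p..<N}. z ^ r * cnj z ^ p)"
      by (rule sum.mono_neutral_cong_right) auto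
    also have "\<dots> = cnj z ^ p * (\<Sum>r\<in>{p..<N}. z ^ r)" by (simp add: sum_distrib_left mult.commute)
    also have "(\<Sum>r\<in>{p..<N}. z ^ r) = (z ^ p - z ^ N) / (1 - z)"
    proof -
      have "(\<Sum>r\<in>{p..<N}. z ^ r) = (\<Sum>r<N. z ^ r) - (\<Sum>r<p. z ^ r)"
        using p sum.atLeastLessThan_concat[of 0 p N "\<lambda>r. z ^ r"] by (simp add: atLeast0LessThan eq_diff_eq add.commute)
      also have "\<dots> = (z ^ N - 1) / (z - 1) - (z ^ p - 1) / (z - 1)" using assms(1) by (simp add: geometric_sum)
      also have "\<dots> = (z ^ N - z ^ p) / (z - 1)" by (simp add: diff_divide_distrib)
      also have "\<dots> = (z ^ p - z ^ N) / (1 - z)"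
        using minus_divide_divide[of "z ^ p - z ^ N" "1 - z"] by simp
      finally show ?thesis .
    qed
    also have "cnj z ^ p * ((z ^ p - z ^ N) / (1 - z)) = ((z * cnj z) ^ p - cnj z ^ p) / (1 - z)"
      using assms(2) by (simp add: power_mult_distrib algebra_simps)
    finally show ?thesis using assms(3) by simp
  qed
  have "cnj z \<noteq> 1" "cnj z ^ N = 1"
    using assms by (metis complex_cnj_cnj complex_cnj_one, metis complex_cnj_one complex_cnj_power)
  then have z0: "(\<Sum>p<N. cnj z ^ p) = 0" by (simp add: geometric_sum)
  have "(\<Sum>p<N. \<Sum>r<N. (if p \<le> r then 1 else 0) * (z ^ r * cnj z ^ p)) = (\<Sum>p<N. (1 - cnj z ^ p) / (1 - z))"
    using inner by simp
  also have "\<dots> = of_nat N / (1 - z)"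
    by (simp add: sum_divide_distrib[symmetric] sum_subtractf z0)
  finally show ?thesis .
qed

lemma cmod_1_minus_unity_root: "cmod (1 - unity_root N k) \<le> 2 * pi * real k / real N"
proof -
  have "cmod (exp (\<i> * of_real (2 * pi * real k / real N)) - 1) = 2 * \<bar>sin (2 * pi * real k / real N / 2)\<bar>"
    by (rule dist_exp_i_1)
  also have "\<dots> \<le> 2 * \<bar>2 * pi * real k / real N / 2\<bar>"
    by (intro mult_left_mono abs_sin_x_le_abs_x) auto
  finally show ?thesis by (simp add: unity_root_def cis_conv_exp norm_minus_commute)
qed

text \<open>For \<open>l > 0\<close> the term is \<open>N / |1 - z|\<close> with \<open>z\<close> at
  distance at most \<open>2 \<pi> l / N\<close> from 1, which leaves a harmonic sum. The nonnegative
  term \<open>l = 0\<close> is dropped.\<close>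

lemma triangular_truncation_lower_bound:
  assumes N: "N \<ge> 2"
  shows "(\<Sum>l<N. cmod (\<Sum>p<N. \<Sum>r<N. (if p \<le> r then 1 else 0) * (unity_root N l ^ r * cnj (unity_root N l) ^ p)))
    \<ge> (real N)\<^sup>2 * ln (real N) / (2 * pi)"
proof -
  let ?D = "\<lambda>l. cmod (\<Sum>p<N. \<Sum>r<N. (if p \<le> r then 1 else 0) * (unity_root N l ^ r * cnj (unity_root N l) ^ p))"
  have D: "(real N)\<^sup>2 / (2 * pi) * inverse (real l) \<le> ?D l" if l: "l \<in> {1..N - 1}" for l
  proof -
    have lN: "0 < l" "l < N" using l N by auto
    have "unity_root N l \<noteq> unity_root N 0" using unity_root_inj[of l N 0] lN by simp
    then have z1: "unity_root N l \<noteq> 1" by (simp add: unity_root_def)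
    have "?D l = real N / cmod (1 - unity_root N l)"
      by (subst triangular_sum[OF z1]) (use N in \<open>auto simp: unity_root_power_N norm_divide\<close>)
    also have "\<dots> \<ge> real N / (2 * pi * real l / real N)"
      using cmod_1_minus_unity_root[of N l] z1[symmetric] lN
      by (intro divide_left_mono mult_pos_pos divide_pos_pos) auto
    finally show ?thesis using lN by (simp add: field_simps power2_eq_square)
  qed
  have "(real N)\<^sup>2 * ln (real N) / (2 * pi) = (real N)\<^sup>2 / (2 * pi) * ln (real (N - 1) + 1)"
    using N by (simp add: of_nat_diff)
  also have "\<dots> \<le> (real N)\<^sup>2 / (2 * pi) * harm (N - 1)"
    by (intro mult_left_mono ln_le_harm) auto
  also have "\<dots> = (\<Sum>l\<in>{1..N - 1}. (real N)\<^sup>2 / (2 * pi) * inverse (real l))"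
    by (simp add: harm_def sum_distrib_left)
  also have "\<dots> \<le> (\<Sum>l\<in>{1..N - 1}. ?D l)" by (rule sum_mono) (rule D)
  also have "\<dots> \<le> (\<Sum>l<N. ?D l)" by (rule sum_mono2) (use N in auto)
  finally show ?thesis .
qed

section \<open>The block construction\<close>

text \<open>Point 0 is the centre 1; odd points lie above it on the circle, even points below.\<close>

definition pt :: "real \<Rightarrow> nat \<Rightarrow> complex" where
  "pt q j = (if j = 0 then 1 else cayley (- ((- q) ^ j)))"

text \<open>
  The amplitudes absorb all factors of the second divided difference except \<open>u / (u - v)\<close>, see
  \<open>amp_entry\<close>.
\<close>

definition amp :: "nat \<Rightarrow> real \<Rightarrow> nat \<Rightarrow> complex" where
  "amp N q j = (if j = 0 \<or> 2 * N < j then 0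
    else if odd j then of_real (wgt (q ^ (2 * N)) * (q ^ j)\<^sup>2) / (circle_fun (cayley (q ^ j)) * (1 - \<i> * of_real (q ^ j)))
    else cnj (1 / (pt q j * (1 + \<i> * of_real (q ^ j)))))"

lemma pt_circle [simp]: "pt q j \<in> circle"
  using cayley_circle[of "- ((- q) ^ j)"] by (auto simp: pt_def)

lemma circle_fun_cayley_ge:
  assumes "0 < q" "q < 1" "j \<le> 2 * N"
  shows "(q ^ j)\<^sup>2 * wgt (q ^ (2 * N)) \<le> phi (Im (cayley (q ^ j)))"
  using assms by (intro phi_cayley_ge) (auto intro: power_decreasing power_le_one)

lemma circle_fun_cayley_pos:
  assumes "0 < q" "q < 1" "j \<le> 2 * N"
  shows "0 < phi (Im (cayley (q ^ j)))"
  using circle_fun_cayley_ge[OF assms] wgt_pos[of "q ^ (2 * N)"] assms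
  by (smt (verit) mult_pos_pos zero_less_power)

text \<open>For the points above the centre the weight is frozen at the smallest parameter of the
  block; by monotonicity the numerator then stays below \<open>circle_fun\<close>.\<close>

lemma cmod_amp_le:
  assumes q: "0 < q" "q < 1"
  shows "cmod (amp N q j) \<le> 1"
proof -
  consider "j = 0 \<or> 2 * N < j" | "j \<le> 2 * N" "odd j" | "j \<noteq> 0" "j \<le> 2 * N" "even j" by fastforce
  then show ?thesis
  proof cases
    case 1
    then show ?thesis by (simp add: amp_def)
  next
    case 2
    define f where "f = phi (Im (cayley (q ^ j)))"
    define s where "s = wgt (q ^ (2 * N)) * (q ^ j)\<^sup>2"
    define d where "d = cmod (1 - \<i> * of_real (q ^ j))"
    have "0 \<le> s" using wgt_pos[of "q ^ (2 * N)"] q by (simp add: s_def)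
    moreover have "s \<le> f" "0 < f"
      using circle_fun_cayley_ge[OF q 2(1)] circle_fun_cayley_pos[OF q 2(1)] by (auto simp: f_def s_def mult.commute)
    moreover have "1 \<le> d" unfolding d_def by (rule one_minus_iu(2))
    moreover have "cmod (amp N q j) = s / (f * d)"
    proof -
      have "j \<noteq> 0" using 2(2) by (intro notI) simp
      then have "amp N q j = of_real s / (of_real f * (1 - \<i> * of_real (q ^ j)))"
        using 2 by (simp add: amp_def s_def f_def circle_fun_def)
      then show ?thesis using \<open>0 \<le> s\<close> \<open>0 < f\<close> by (simp only: norm_divide norm_mult norm_of_real d_def[symmetric] abs_of_nonneg less_imp_le)
    qed
    ultimately show ?thesis
      using mult_mono[of s f 1 d] by (simp add: divide_le_eq)
  next
    case 3
    have "cmod (amp N q j) = 1 / cmod (1 + \<i> * of_real (q ^ j))"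
      using 3 pt_circle[of q j] one_minus_iu(3)[of "q ^ j"]
      by (simp add: amp_def norm_divide norm_mult del: pt_circle)
    also have "\<dots> \<le> 1"
      using one_minus_iu(2)[of "q ^ j"] unfolding one_minus_iu(3)[of "q ^ j"] by (simp add: divide_le_eq)
    finally show ?thesis .
  qed
qed

text \<open>All factors separate into functions of \<open>u\<close> and of \<open>v\<close> except
  \<open>1 / (u - v)\<close>. The amplitude carries \<open>u^2\<close>, comparable with
  \<open>circle_fun\<close> up to the weight; one power cancels the \<open>1 / u\<close> of the
  divided difference, the other remains as the numerator.\<close>

lemma amp_entry:
  assumes q: "0 < q" "q < 1" and pr: "p < N" "r < N"
  defines "x \<equiv> pt q (2 * p + 1)" and "y \<equiv> pt q (2 * r + 2)"
  defines "u \<equiv> q ^ (2 * p + 1)" and "v \<equiv> - (q ^ (2 * r + 2))"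
  shows "y * cnj (amp N q (2 * r + 2)) * ((div2 y x + div1 y x / 2) * amp N q (2 * p + 1)) =
    - of_real (wgt (q ^ (2 * N)) / 4 * (u / (u - v)))"
proof -
  have xy: "x = cayley u" "y = cayley v" by (simp_all add: x_def y_def u_def v_def pt_def)
  have uv: "u > 0" "v < 0" using q by (auto simp: u_def v_def)
  define a where "a = 1 - \<i> * complex_of_real u"
  define b where "b = 1 - \<i> * complex_of_real v"
  have ab: "a \<noteq> 0" "b \<noteq> 0" using one_minus_iu(1) by (auto simp: a_def b_def)
  have y0: "y \<noteq> 0" using pt_circle[of q "2 * r + 2"] by (auto simp: y_def)
  define F where "F = circle_fun (cayley u)"
  have F0: "F \<noteq> 0"
    using circle_fun_cayley_pos[OF q, of "2 * p + 1" N] pr by (auto simp: F_def circle_fun_def u_def)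
  define s where "s = complex_of_real (wgt (q ^ (2 * N)))"
  define U where "U = complex_of_real u"
  define W where "W = complex_of_real (u - v)"
  have UW: "U \<noteq> 0" "W \<noteq> 0" using uv by (auto simp: U_def W_def simp del: of_real_diff)
  have 1: "cnj (amp N q (2 * r + 2)) = 1 / (y * b)"
    using pr by (simp add: amp_def y_def b_def v_def)
  have 2: "amp N q (2 * p + 1) = s * U\<^sup>2 / (F * a)"
    using pr by (simp add: amp_def s_def U_def F_def a_def u_def)
  have 3: "div2 y x + div1 y x / 2 = - F * a * b / (4 * U * W)"
    unfolding xy divided_difference_value[OF uv] by (simp add: F_def a_def b_def U_def W_def)
  have 4: "- complex_of_real (wgt (q ^ (2 * N)) / 4 * (u / (u - v))) = - (s / 4 * (U / W))"
    by (simp add: s_def U_def W_def)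
  show ?thesis unfolding 1 2 3 4 using ab y0 F0 UW by (simp add: divide_simps power2_eq_square)
qed

text \<open>The exponents interlace: \<open>2 p + 1 < 2 r + 2\<close> holds exactly for
  \<open>p \<le> r\<close>. The smaller of \<open>u\<close> and \<open>- v\<close> is at most
  \<open>q\<close> times the larger, which puts \<open>u / (u - v)\<close> within \<open>q\<close>
  of 1 or of 0.\<close>

lemma entry_near_triangular:
  fixes p r :: nat and q :: real
  assumes q: "0 < q" "q < 1"
  defines "u \<equiv> q ^ (2 * p + 1)" and "v \<equiv> - (q ^ (2 * r + 2))"
  shows "\<bar>u / (u - v) - (if p \<le> r then 1 else 0)\<bar> \<le> q"
proof (cases "p \<le> r")
  case True
  have uv: "u > 0" "- v > 0"
    unfolding u_def v_def minus_minus by (rule zero_less_power[OF q(1)])+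
  have "2 * r + 2 = (2 * p + 1) + (2 * (r - p) + 1)" using True by simp
  then have "- v = u * q ^ (2 * (r - p) + 1)"
    unfolding u_def v_def minus_minus by (metis power_add)
  also have "\<dots> \<le> u * q"
    using q uv power_decreasing[of 1 "2 * (r - p) + 1" q] by (intro mult_left_mono) auto
  finally have "- v \<le> q * u" by (simp add: mult.commute)
  moreover have "u / (u - v) - 1 = - ((- v) / (u - v))" using uv by (simp add: field_simps)
  moreover have "(- v) / (u - v) \<le> (- v) / u" using uv by (intro divide_left_mono) auto
  moreover have "(- v) / u \<le> q" using calculation(1) uv(1) by (subst pos_divide_le_eq) auto
  moreover have "0 \<le> (- v) / (u - v)" using uv by (intro divide_nonneg_nonneg) auto
  ultimately have "\<bar>u / (u - v) - 1\<bar> \<le> q" by linarith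
  then show ?thesis using True by simp
next
  case False
  have uv: "u > 0" "- v > 0"
    unfolding u_def v_def minus_minus by (rule zero_less_power[OF q(1)])+
  have "2 * p + 1 = (2 * r + 2) + (2 * (p - r) - 1)" using False by simp
  then have "u = (- v) * q ^ (2 * (p - r) - 1)"
    unfolding u_def v_def minus_minus by (metis power_add)
  also have "\<dots> \<le> (- v) * q"
    using q uv False power_decreasing[of 1 "2 * (p - r) - 1" q] by (intro mult_left_mono) auto
  finally have "u \<le> q * (- v)" by (simp add: mult.commute)
  then have "u / (- v) \<le> q" using uv by (subst pos_divide_le_eq) auto
  moreover have "u / (u - v) \<le> u / (- v)"
    using uv mult_pos_pos[of "u - v" "- v"] by (intro divide_left_mono) auto
  moreover have "0 \<le> u / (u - v)" using uv by simp
  ultimately have "\<bar>u / (u - v)\<bar> \<le> q" by linarith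
  then show ?thesis using False by simp
qed

section \<open>The perturbation assembled from its blocks\<close>

abbreviation ix :: "nat \<Rightarrow> nat \<Rightarrow> nat" where
  "ix b j \<equiv> prod_encode (b, j)"

lemma ix_cases: obtains b j where "i = ix b j"
  by (metis prod_decode_inverse surj_pair)

text \<open>A block contributes at most \<open>2 N T^2\<close> through the column of its centre and
  as much through the other \<open>2 N\<close> columns. The total 16 yields
  \<open>norm Z \<le> 4\<close>, a bound known before any scale is chosen. A scale
  \<open>T b = 0\<close> switches a block off.\<close>

locale blocks =
  fixes N :: "nat \<Rightarrow> nat" and q T :: "nat \<Rightarrow> real" and C :: real
  assumes q: "\<And>b. 0 < q b" "\<And>b. q b < 1"
    and T: "\<And>b. 0 \<le> T b"
    and sum_le: "\<And>B. (\<Sum>b<B. 4 * real (N b) * (T b)\<^sup>2) \<le> 16"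
    and C: "\<And>z w. z \<in> circle \<Longrightarrow> w \<in> circle \<Longrightarrow> cmod (div1 w z) \<le> C"
begin

definition l where "l i = (case prod_decode i of (b, j) \<Rightarrow> pt (q b) j)"

definition A where "A b = amp (N b) (q b)"

definition vv where "vv b = (\<Sum>j\<in>{1..2 * N b}. A b j *\<^sub>C basis_vec (ix b j))"

text \<open>A star around the centre, with conjugate amplitudes in the row of the centre to make
  \<open>Z\<close> self-adjoint; \<open>A b 0 = 0\<close> leaves the diagonal empty.\<close>

definition zcol where
  "zcol i = (case prod_decode i of (b, j) \<Rightarrow>
    if j = 0 then T b *\<^sub>R vv b else (of_real (T b) * cnj (A b j)) *\<^sub>C basis_vec (ix b 0))"

lemma l_ix [simp]: "l (ix b j) = pt (q b) j"
  by (simp add: l_def)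

lemma cmod_A: "cmod (A b j) \<le> 1"
  unfolding A_def by (rule cmod_amp_le) (rule q)+

lemma A_outside: "j \<notin> {1..2 * N b} \<Longrightarrow> A b j = 0"
  by (auto simp: A_def amp_def)

lemma coord_vv: "coord (vv b) (ix b' j) = (if b = b' then A b j else 0)"
proof -
  have "coord (vv b) (ix b' j) = (\<Sum>k\<in>{1..2 * N b}. if k = j \<and> b = b' then A b k else 0)"
    unfolding vv_def by (auto intro!: sum.cong)
  also have "\<dots> = (if b = b' \<and> j \<in> {1..2 * N b} then A b j else 0)"
    by (cases "b = b'") auto
  finally show ?thesis using A_outside[of j b] by (auto split: if_splits)
qed

lemma coord_zcol: "coord (zcol (ix b' j')) (ix b j) =
    (if b = b' then of_real (T b) * (if j' = 0 then A b j else if j = 0 then cnj (A b j') else 0) else 0)"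
  by (auto simp: zcol_def coord_vv)

lemma ip_vv: "ip y (vv b) = (\<Sum>j\<in>{1..2 * N b}. cnj (A b j) * coord y (ix b j))"
  by (simp add: vv_def ip_sum_right ip_scaleC_right)

lemma norm_vv: "(norm (vv b))\<^sup>2 \<le> 2 * real (N b)"
proof -
  have "complex_of_real ((norm (vv b))\<^sup>2) = of_real (\<Sum>j\<in>{1..2 * N b}. (cmod (A b j))\<^sup>2)"
    unfolding ip_self[symmetric] ip_vv by (simp add: coord_vv mult_cnj_cmod)
  then have "(norm (vv b))\<^sup>2 = (\<Sum>j\<in>{1..2 * N b}. (cmod (A b j))\<^sup>2)" by (simp only: of_real_eq_iff)
  also have "\<dots> \<le> (\<Sum>j\<in>{1..2 * N b}. 1)"
    by (rule sum_mono) (simp add: cmod_A power_le_one)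
  finally show ?thesis by simp
qed

lemma norm_vv_le: "norm (vv b) \<le> 2 * real (N b)"
proof -
  have "norm (vv b) \<le> (\<Sum>j\<in>{1..2 * N b}. 1)"
    unfolding vv_def by (rule sum_norm_le) (simp add: cmod_A)
  then show ?thesis by simp
qed

lemma norm_zcol: "(norm (zcol (ix b j)))\<^sup>2 \<le>
    (if j = 0 then 2 * real (N b) * (T b)\<^sup>2 else 0) + (if j \<in> {1..2 * N b} then (T b)\<^sup>2 else 0)"
proof (cases "j = 0")
  case True
  then have "(norm (zcol (ix b j)))\<^sup>2 = (T b)\<^sup>2 * (norm (vv b))\<^sup>2"
    by (simp add: zcol_def power_mult_distrib)
  also have "\<dots> \<le> (T b)\<^sup>2 * (2 * real (N b))" by (intro mult_left_mono norm_vv) auto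
  finally show ?thesis using True by (simp add: mult_ac)
next
  case False
  then have "(norm (zcol (ix b j)))\<^sup>2 = (T b)\<^sup>2 * (cmod (A b j))\<^sup>2"
    by (simp add: zcol_def power_mult_distrib norm_mult)
  moreover have "(T b)\<^sup>2 * (cmod (A b j))\<^sup>2 \<le> (T b)\<^sup>2 * 1"
    using cmod_A[of b j] by (intro mult_left_mono) (auto simp: power_le_one)
  ultimately show ?thesis using False A_outside[of j b] by auto
qed

lemma sum_zcol_le: "(\<Sum>i<I. (norm (zcol i))\<^sup>2) \<le> 16"
proof -
  let ?P = "\<lambda>(b, j). ix b j"
  \<comment> \<open>\<open>prod_encode\<close> dominates both of its arguments, so an initial
    segment of indices lies in the image of a square.\<close>
  have "{..<I} \<subseteq> ?P ` ({..<I} \<times> {..<I})"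
  proof
    fix i assume "i \<in> {..<I}"
    obtain b j where "i = ix b j" by (rule ix_cases)
    then show "i \<in> ?P ` ({..<I} \<times> {..<I})"
      using \<open>i \<in> {..<I}\<close> le_prod_encode_1[of b j] le_prod_encode_2[of j b] by force
  qed
  then have "(\<Sum>i<I. (norm (zcol i))\<^sup>2) \<le> (\<Sum>i\<in>?P ` ({..<I} \<times> {..<I}). (norm (zcol i))\<^sup>2)"
    by (intro sum_mono2) auto
  also have "\<dots> = (\<Sum>(b, j)\<in>{..<I} \<times> {..<I}. (norm (zcol (ix b j)))\<^sup>2)"
    by (subst sum.reindex) (auto simp: inj_on_def case_prod_unfold)
  also have "\<dots> = (\<Sum>b<I. \<Sum>j<I. (norm (zcol (ix b j)))\<^sup>2)"
    by (simp add: sum.cartesian_product)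
  also have "\<dots> \<le> (\<Sum>b<I. 4 * real (N b) * (T b)\<^sup>2)"
  proof (rule sum_mono)
    fix b
    have "(\<Sum>j<I. (norm (zcol (ix b j)))\<^sup>2) \<le>
        (\<Sum>j<I. (if j = 0 then 2 * real (N b) * (T b)\<^sup>2 else 0) + (if j \<in> {1..2 * N b} then (T b)\<^sup>2 else 0))"
      by (rule sum_mono) (rule norm_zcol)
    also have "\<dots> = (\<Sum>j<I. if j = 0 then 2 * real (N b) * (T b)\<^sup>2 else 0) + (\<Sum>j<I. if j \<in> {1..2 * N b} then (T b)\<^sup>2 else 0)"
      by (rule sum.distrib)
    also have "\<dots> \<le> 2 * real (N b) * (T b)\<^sup>2 + 2 * real (N b) * (T b)\<^sup>2"
    proof (rule add_mono)
      show "(\<Sum>j<I. if j = 0 then 2 * real (N b) * (T b)\<^sup>2 else 0) \<le> 2 * real (N b) * (T b)\<^sup>2"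
        by (simp add: sum.delta)
      have "(\<Sum>j<I. if j \<in> {1..2 * N b} then (T b)\<^sup>2 else 0) = (\<Sum>j\<in>{..<I} \<inter> {1..2 * N b}. (T b)\<^sup>2)"
        by (rule sum.inter_restrict[symmetric]) simp
      also have "\<dots> \<le> (\<Sum>j\<in>{1..2 * N b}. (T b)\<^sup>2)" by (intro sum_mono2) auto
      finally show "(\<Sum>j<I. if j \<in> {1..2 * N b} then (T b)\<^sup>2 else 0) \<le> 2 * real (N b) * (T b)\<^sup>2" by simp
    qed
    finally show "(\<Sum>j<I. (norm (zcol (ix b j)))\<^sup>2) \<le> 4 * real (N b) * (T b)\<^sup>2" by simp
  qed
  also have "\<dots> \<le> 16" by (rule sum_le)
  finally show ?thesis .
qed

lemma summable_zcol: "summable (\<lambda>i. (norm (zcol i))\<^sup>2)"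
  by (rule summableI_nonneg_bounded[OF _ sum_zcol_le]) auto

definition Z where "Z = (SOME A. (\<forall>k. A \<cdot> basis_vec k = zcol k) \<and> norm A \<le> sqrt (\<Sum>k. (norm (zcol k))\<^sup>2))"

lemma Z_column: "Z \<cdot> basis_vec k = zcol k" and norm_Z: "norm Z \<le> 4"
proof -
  have Z: "(\<forall>k. Z \<cdot> basis_vec k = zcol k) \<and> norm Z \<le> sqrt (\<Sum>k. (norm (zcol k))\<^sup>2)"
    unfolding Z_def by (rule someI_ex[OF bop_of_columns_exists[OF summable_zcol]])
  then show "Z \<cdot> basis_vec k = zcol k" by blast
  have "(\<Sum>k. (norm (zcol k))\<^sup>2) \<le> 16" by (rule suminf_le_const[OF summable_zcol sum_zcol_le])
  then have "sqrt (\<Sum>k. (norm (zcol k))\<^sup>2) \<le> sqrt 16" by (rule real_sqrt_le_mono)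
  then show "norm Z \<le> 4" using Z by simp
qed

lemma adj_Z: "adj Z = Z"
proof (rule bop_eqI_basis, rule ell2_eqI)
  fix k i
  obtain b j b' j' where i: "i = ix b j" and k: "k = ix b' j'" by (metis ix_cases)
  have "coord (adj Z \<cdot> basis_vec k) i = cnj (coord (zcol i) k)"
    using ip_app_right[of "basis_vec k" Z "basis_vec i"] by (simp add: Z_column)
  also have "\<dots> = coord (zcol k) i"
    unfolding i k coord_zcol using A_outside[of 0 b] by auto
  finally show "coord (adj Z \<cdot> basis_vec k) i = coord (Z \<cdot> basis_vec k) i" by (simp add: Z_column)
qed

lemma pert: "perturbation l Z circle_fun (\<lambda>k. div1 (l k)) C"
proof
  show lc: "l n \<in> circle" for n by (metis ix_cases l_ix pt_circle)
  show "adj Z = Z" by (rule adj_Z)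
  show "summable (\<lambda>k. (norm (Z \<cdot> basis_vec k))\<^sup>2)" unfolding Z_column by (rule summable_zcol)
  show "continuous_on circle circle_fun" by (rule continuous_circle_fun)
  show "continuous_on circle (div1 (l k))" for k using lc by (rule continuous_div1)
  show "cmod (div1 (l k) z) \<le> C" if "z \<in> circle" for k z using that lc by (rule C)
  show "circle_fun z - circle_fun (l k) = div1 (l k) z * (z - l k)" for k z by (rule div1_mult)
qed

sublocale perturbation l Z circle_fun "\<lambda>k. div1 (l k)" C
  by (rule pert)

lemma Z_on_block:
  assumes y: "supp_on (range (ix b)) y"
  shows "Z \<cdot> y = T b *\<^sub>R (coord y (ix b 0) *\<^sub>C vv b + ip y (vv b) *\<^sub>C basis_vec (ix b 0))"
proof (rule ell2_eqI)
  fix i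
  obtain b' j where i: "i = ix b' j" by (rule ix_cases)
  have "coord (Z \<cdot> y) i = ip y (zcol i)"
    using ip_app_left[of Z y "basis_vec i"] by (simp add: adj_Z Z_column)
  also have "\<dots> = (if j = 0 then of_real (T b') * ip y (vv b') else of_real (T b') * A b' j * coord y (ix b' 0))"
    by (simp add: i zcol_def scaleR_scaleC ip_scaleC_right)
  also have "\<dots> = coord (T b *\<^sub>R (coord y (ix b 0) *\<^sub>C vv b + ip y (vv b) *\<^sub>C basis_vec (ix b 0))) i"
  proof (cases "b' = b")
    case True
    then show ?thesis using A_outside[of 0 b] by (auto simp: i coord_vv)
  next
    case False
    then have "ix b' j \<notin> range (ix b)" for j by auto
    then have "coord y (ix b' j) = 0" for j using y by (simp add: supp_on_def)
    then show ?thesis using False by (simp add: i coord_vv ip_vv)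
  qed
  finally show "coord (Z \<cdot> y) i = coord (T b *\<^sub>R (coord y (ix b 0) *\<^sub>C vv b + ip y (vv b) *\<^sub>C basis_vec (ix b 0))) i" .
qed

text \<open>Linear in \<open>T b\<close>, with a constant that depends on the size of the block
  only: the local smallness that \<open>second_order_asymptotics\<close> asks for.\<close>

lemma Z_block_bounds:
  assumes y: "supp_on (range (ix b)) y"
  shows "supp_on (range (ix b)) (Z \<cdot> y)" "norm (Z \<cdot> y) \<le> T b * (4 * real (N b)) * norm y"
proof -
  have "supp_on (range (ix b)) (vv b)"
    unfolding supp_on_def
  proof (intro allI impI)
    fix n assume n: "n \<notin> range (ix b)"
    obtain b' j where "n = ix b' j" by (rule ix_cases)
    with n show "coord (vv b) n = 0" by (auto simp: coord_vv)
  qed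
  then show "supp_on (range (ix b)) (Z \<cdot> y)"
    unfolding Z_on_block[OF y] scaleR_scaleC by (intro supp_on_intros) auto
  have "norm (coord y (ix b 0) *\<^sub>C vv b + ip y (vv b) *\<^sub>C basis_vec (ix b 0)) \<le>
      cmod (coord y (ix b 0)) * norm (vv b) + cmod (ip y (vv b)) * 1"
    by (rule order_trans[OF norm_triangle_ineq]) simp
  also have "\<dots> \<le> norm y * norm (vv b) + norm y * norm (vv b) * 1"
    by (intro add_mono mult_right_mono cmod_coord_le cmod_ip_le) auto
  also have "\<dots> = 2 * norm y * norm (vv b)" by simp
  also have "\<dots> \<le> 2 * norm y * (2 * real (N b))" by (intro mult_left_mono norm_vv_le) auto
  finally have "T b * norm (coord y (ix b 0) *\<^sub>C vv b + ip y (vv b) *\<^sub>C basis_vec (ix b 0)) \<le>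
      T b * (2 * norm y * (2 * real (N b)))" by (rule mult_left_mono[OF _ T])
  then show "norm (Z \<cdot> y) \<le> T b * (4 * real (N b)) * norm y"
    unfolding Z_on_block[OF y] using T[of b] by (simp add: mult_ac)
qed

definition R where "R = G 1 - D"

text \<open>\<open>s = 1\<close> uses the points above the centre and \<open>s = 2\<close> those
  below, so that testing \<open>R\<close> picks the rows \<open>2 p + 1\<close> and the columns
  \<open>2 r + 2\<close>.\<close>

definition fourier_vec where
  "fourier_vec s b k = (\<Sum>r<N b. (unity_root (N b) k ^ r / of_real (sqrt (real (N b)))) *\<^sub>C basis_vec (ix b (2 * r + s)))"

lemma coord_fourier_vec:
  assumes "r < N b"
  shows "coord (fourier_vec s b k) (ix b' (2 * r + s)) =
    (if b = b' then unity_root (N b) k ^ r / of_real (sqrt (real (N b))) else 0)"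
proof -
  have "coord (fourier_vec s b k) (ix b' (2 * r + s)) =
      (\<Sum>r'<N b. if r' = r then if b = b' then unity_root (N b) k ^ r / of_real (sqrt (real (N b))) else 0 else 0)"
    unfolding fourier_vec_def coord_sum by (intro sum.cong) auto
  then show ?thesis using assms by simp
qed

lemma fourier_vec_orthonormal:
  assumes "k < N b" "k' < N b'"
  shows "ip (fourier_vec s b k) (fourier_vec s b' k') = (if b = b' \<and> k = k' then 1 else 0)"
proof -
  let ?w = "unity_root (N b')"
  let ?s = "complex_of_real (sqrt (real (N b')))"
  have "ip (fourier_vec s b k) (fourier_vec s b' k') =
      (\<Sum>r<N b'. cnj (?w k' ^ r / ?s) * coord (fourier_vec s b k) (ix b' (2 * r + s)))"
    unfolding fourier_vec_def[of s b'] by (simp add: ip_sum_right ip_scaleC_right)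
  also have "\<dots> = (if b = b' \<and> k = k' then 1 else 0)"
  proof (cases "b = b'")
    case True
    have ss: "?s * ?s = of_nat (N b')" by (simp flip: of_real_mult)
    have N: "N b' > 0" using assms by linarith
    have "(\<Sum>r<N b'. cnj (?w k' ^ r / ?s) * coord (fourier_vec s b k) (ix b' (2 * r + s))) =
        (\<Sum>r<N b'. ?w r ^ k * cnj (?w r) ^ k' / of_nat (N b'))"
    proof (intro sum.cong refl)
      fix r assume "r \<in> {..<N b'}"
      then have "cnj (?w k' ^ r / ?s) * coord (fourier_vec s b k) (ix b' (2 * r + s)) =
          cnj (?w k' ^ r) * ?w k ^ r / (?s * ?s)"
        using True by (simp add: coord_fourier_vec)
      then show "cnj (?w k' ^ r / ?s) * coord (fourier_vec s b k) (ix b' (2 * r + s)) =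
          ?w r ^ k * cnj (?w r) ^ k' / of_nat (N b')"
        unfolding ss unity_root_power_swap[of _ k] unity_root_power_swap[of _ k'] by (simp add: mult.commute)
    qed
    also have "\<dots> = (if k = k' then 1 else 0)"
      using assms True N by (simp add: sum_divide_distrib[symmetric] unity_root_orthogonal)
    finally show ?thesis using True by simp
  next
    case False
    have "coord (fourier_vec s b k) (ix b' j) = 0" for j
      unfolding fourier_vec_def coord_sum using False by (intro sum.neutral) auto
    then show ?thesis using False by simp
  qed
  finally show ?thesis .
qed

text \<open>The quantity estimated in \<open>second_order_asymptotics\<close>, for column
  \<open>2 r + 2\<close> of block \<open>b\<close>, with \<open>t = T b\<close>,
  \<open>\<beta> = cnj (A b (2 * r + 2))\<close> and \<open>v = vv b\<close>.\<close>

definition second_order_error where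
  "second_order_error b r = norm (R \<cdot> basis_vec (ix b (2 * r + 2)) +
     (of_real ((T b)\<^sup>2) * l (ix b (2 * r + 2)) * cnj (A b (2 * r + 2))) *\<^sub>C
     (fc U (\<lambda>z. div2 (l (ix b (2 * r + 2))) z + div1 (l (ix b (2 * r + 2))) z / 2) \<cdot> vv b))"

text \<open>Entrywise, \<open>R\<close> is \<open>(T b)\<^sup>2 * \<sigma> / 4\<close> times the
  triangular matrix up to \<open>err\<close>. Testing \<open>N\<close> Fourier pairs turns this into
  an error \<open>N^2 err\<close>: the closeness \<open>q = 1 / N\<close> becomes the
  \<open>- 1\<close> next to the logarithm, and \<open>e\<close> becomes \<open>N e\<close>.\<close>

lemma block_lower_bound:
  assumes N: "N b \<ge> 2" and qN: "q b = 1 / real (N b)" and e: "0 \<le> e"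
    and R: "\<And>r. r < N b \<Longrightarrow> second_order_error b r \<le> e * (T b)\<^sup>2"
  defines "\<sigma> \<equiv> wgt (q b ^ (2 * N b))"
  shows "(\<Sum>k<N b. cmod (ip (R \<cdot> fourier_vec 2 b k) (fourier_vec 1 b k))) \<ge>
    (T b)\<^sup>2 * real (N b) * (\<sigma> / 4 * (ln (real (N b)) / (2 * pi) - 1) - real (N b) * e)"
proof -
  let ?n = "N b" and ?t = "(T b)\<^sup>2"
  define E where "E p r = coord (R \<cdot> basis_vec (ix b (2 * r + 2))) (ix b (2 * p + 1))" for p r
  define J where "J p r = (if p \<le> r then 1 else 0 :: complex)" for p r :: nat
  have \<sigma>: "\<sigma> > 0" unfolding \<sigma>_def using q[of b] by (intro wgt_pos) simp
  have E: "cmod (E p r - of_real (?t * (\<sigma> / 4)) * J p r) \<le> ?t * (\<sigma> / 4) * q b + e * ?t"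
    if pr: "p < ?n" "r < ?n" for p r
  proof -
    let ?k = "ix b (2 * r + 2)" and ?y = "pt (q b) (2 * r + 2)" and ?x = "pt (q b) (2 * p + 1)"
    let ?h = "\<lambda>z. div2 ?y z + div1 ?y z / 2"
    define u where "u = q b ^ (2 * p + 1)"
    define v where "v = - (q b ^ (2 * r + 2))"
    have ne: "?y \<noteq> 1"
    proof -
      have "?y - 1 \<noteq> 0"
        using q[of b] one_minus_iu(1)[of "- ((- q b) ^ (2 * r + 2))"] unfolding pt_def by (simp add: cayley_minus_1)
      then show ?thesis by simp
    qed
    have cont: "continuous_on circle ?h"
      by (intro continuous_intros continuous_div1 continuous_div2 pt_circle ne) auto
    have "coord (R \<cdot> basis_vec ?k + (of_real ?t * l ?k * cnj (A b (2 * r + 2))) *\<^sub>C (fc U ?h \<cdot> vv b)) (ix b (2 * p + 1))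
        = E p r + of_real ?t * (?y * cnj (A b (2 * r + 2)) * (?h ?x * A b (2 * p + 1)))"
    proof -
      have "coord (fc U ?h \<cdot> vv b) (ix b (2 * p + 1)) = ?h ?x * A b (2 * p + 1)"
        using coord_fc_U[OF cont, of "vv b" "ix b (2 * p + 1)"] by (simp add: coord_vv)
      then show ?thesis by (simp only: coord_simps E_def l_ix mult.assoc)
    qed
    \<comment> \<open>The main term was added and \<open>amp_entry\<close> has a minus sign, so
      \<open>E p r\<close> is close to a positive multiple of the triangular entry.\<close>
    also have "\<dots> = E p r - of_real (?t * (\<sigma> / 4) * (u / (u - v)))"
      unfolding A_def u_def v_def \<sigma>_def by (subst amp_entry[OF q pr]) simp
    finally have eq: "coord (R \<cdot> basis_vec ?k + (of_real ?t * l ?k * cnj (A b (2 * r + 2))) *\<^sub>C (fc U ?h \<cdot> vv b))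
        (ix b (2 * p + 1)) = E p r - of_real (?t * (\<sigma> / 4) * (u / (u - v)))" .
    have "cmod (E p r - of_real (?t * (\<sigma> / 4) * (u / (u - v)))) \<le>
        norm (R \<cdot> basis_vec ?k + (of_real ?t * l ?k * cnj (A b (2 * r + 2))) *\<^sub>C (fc U ?h \<cdot> vv b))"
      unfolding eq[symmetric] by (rule cmod_coord_le)
    also have "\<dots> \<le> e * ?t" using R[OF pr(2)] unfolding second_order_error_def l_ix .
    finally have "cmod (E p r - of_real (?t * (\<sigma> / 4) * (u / (u - v)))) \<le> e * ?t" .
    moreover have "cmod (of_real (?t * (\<sigma> / 4) * (u / (u - v))) - of_real (?t * (\<sigma> / 4)) * J p r) \<le> ?t * (\<sigma> / 4) * q b"
    proof -
      have "of_real (?t * (\<sigma> / 4) * (u / (u - v))) - of_real (?t * (\<sigma> / 4)) * J p r =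
          complex_of_real (?t * (\<sigma> / 4) * (u / (u - v) - (if p \<le> r then 1 else 0)))"
      proof -
        have "complex_of_real (a * w) - of_real a * (if p \<le> r then 1 else 0) =
            of_real (a * (w - (if p \<le> r then 1 else 0)))" for a w by (simp add: algebra_simps)
        then show ?thesis unfolding J_def .
      qed
      then have "cmod (of_real (?t * (\<sigma> / 4) * (u / (u - v))) - of_real (?t * (\<sigma> / 4)) * J p r) =
          ?t * (\<sigma> / 4) * \<bar>u / (u - v) - (if p \<le> r then 1 else 0)\<bar>"
        using \<sigma> by (simp only: norm_of_real abs_mult) simp
      also have "\<dots> \<le> ?t * (\<sigma> / 4) * q b"
        unfolding u_def v_def using \<sigma> by (intro mult_left_mono entry_near_triangular q) auto
      finally show ?thesis .
    qed
    ultimately show ?thesis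
      using norm_triangle_ineq[of "E p r - of_real (?t * (\<sigma> / 4) * (u / (u - v)))"
        "of_real (?t * (\<sigma> / 4) * (u / (u - v))) - of_real (?t * (\<sigma> / 4)) * J p r"] by simp
  qed
  define c where "c k p r = unity_root ?n k ^ r * cnj (unity_root ?n k) ^ p" for k p r
  have c1: "cmod (c k p r) = 1" for k p r by (simp add: c_def norm_mult norm_power)
  define err where "err = ?t * (\<sigma> / 4) * q b + e * ?t"
  have S: "cmod (\<Sum>p<?n. \<Sum>r<?n. E p r * c k p r) \<ge>
      ?t * (\<sigma> / 4) * cmod (\<Sum>p<?n. \<Sum>r<?n. J p r * c k p r) - (real ?n)\<^sup>2 * err" for k
  proof -
    have "cmod ((\<Sum>p<?n. \<Sum>r<?n. E p r * c k p r) - of_real (?t * (\<sigma> / 4)) * (\<Sum>p<?n. \<Sum>r<?n. J p r * c k p r)) =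
        cmod (\<Sum>p<?n. \<Sum>r<?n. (E p r - of_real (?t * (\<sigma> / 4)) * J p r) * c k p r)"
      by (simp add: sum_distrib_left sum_subtractf left_diff_distrib mult.assoc)
    also have "\<dots> \<le> (\<Sum>p<?n. \<Sum>r<?n. err)"
      by (intro sum_norm_le) (use E in \<open>auto simp: norm_mult c1 err_def\<close>)
    also have "\<dots> = (real ?n)\<^sup>2 * err" by (simp add: power2_eq_square)
    finally have 1: "cmod ((\<Sum>p<?n. \<Sum>r<?n. E p r * c k p r) - of_real (?t * (\<sigma> / 4)) * (\<Sum>p<?n. \<Sum>r<?n. J p r * c k p r)) \<le>
        (real ?n)\<^sup>2 * err" .
    have "cmod (of_real (?t * (\<sigma> / 4)) * (\<Sum>p<?n. \<Sum>r<?n. J p r * c k p r)) =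
        ?t * (\<sigma> / 4) * cmod (\<Sum>p<?n. \<Sum>r<?n. J p r * c k p r)"
      using \<sigma> by (simp add: norm_mult norm_power)
    then show ?thesis
      using 1 norm_triangle_ineq2[of "of_real (?t * (\<sigma> / 4)) * (\<Sum>p<?n. \<Sum>r<?n. J p r * c k p r)" "\<Sum>p<?n. \<Sum>r<?n. E p r * c k p r"]
      by (simp add: norm_minus_commute)
  qed
  have ip_eq: "ip (R \<cdot> fourier_vec 2 b k) (fourier_vec 1 b k) = (\<Sum>p<?n. \<Sum>r<?n. E p r * c k p r) / of_nat ?n" for k
  proof -
    let ?s = "complex_of_real (sqrt (real ?n))" and ?w = "unity_root ?n k"
    have ss: "?s * ?s = of_nat ?n" by (simp flip: of_real_mult)
    have "ip (R \<cdot> fourier_vec 2 b k) (fourier_vec 1 b k) =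
        (\<Sum>p<?n. cnj (?w ^ p / ?s) * coord (R \<cdot> fourier_vec 2 b k) (ix b (2 * p + 1)))"
      unfolding fourier_vec_def[of 1] by (simp add: ip_sum_right ip_scaleC_right)
    also have "\<dots> = (\<Sum>p<?n. cnj (?w ^ p / ?s) * (\<Sum>r<?n. ?w ^ r / ?s * E p r))"
      by (simp add: fourier_vec_def app_sum_right app_scaleC_right E_def)
    also have "\<dots> = (\<Sum>p<?n. \<Sum>r<?n. E p r * c k p r / (?s * ?s))"
      unfolding sum_distrib_left by (intro sum.cong refl) (simp add: c_def mult_ac)
    finally show ?thesis unfolding ss by (simp add: sum_divide_distrib)
  qed
  have "(\<Sum>k<?n. cmod (ip (R \<cdot> fourier_vec 2 b k) (fourier_vec 1 b k))) =
      (\<Sum>k<?n. cmod (\<Sum>p<?n. \<Sum>r<?n. E p r * c k p r)) / real ?n"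
    unfolding ip_eq norm_divide sum_divide_distrib[symmetric] by simp
  also have "\<dots> \<ge> (\<Sum>k<?n. ?t * (\<sigma> / 4) * cmod (\<Sum>p<?n. \<Sum>r<?n. J p r * c k p r) - (real ?n)\<^sup>2 * err) / real ?n"
    by (intro divide_right_mono sum_mono S) auto
  also have "(\<Sum>k<?n. ?t * (\<sigma> / 4) * cmod (\<Sum>p<?n. \<Sum>r<?n. J p r * c k p r) - (real ?n)\<^sup>2 * err) =
      ?t * (\<sigma> / 4) * (\<Sum>k<?n. cmod (\<Sum>p<?n. \<Sum>r<?n. J p r * c k p r)) - real ?n * (real ?n)\<^sup>2 * err"
    by (simp add: sum_subtractf sum_distrib_left)
  also have "(?t * (\<sigma> / 4) * (\<Sum>k<?n. cmod (\<Sum>p<?n. \<Sum>r<?n. J p r * c k p r)) - real ?n * (real ?n)\<^sup>2 * err) / real ?n \<ge>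
      (?t * (\<sigma> / 4) * ((real ?n)\<^sup>2 * ln (real ?n) / (2 * pi)) - real ?n * (real ?n)\<^sup>2 * err) / real ?n"
    using \<sigma> triangular_truncation_lower_bound[OF N] unfolding J_def c_def
    by (intro divide_right_mono diff_right_mono mult_left_mono) auto
  also have "(?t * (\<sigma> / 4) * ((real ?n)\<^sup>2 * ln (real ?n) / (2 * pi)) - real ?n * (real ?n)\<^sup>2 * err) / real ?n =
      ?t * real ?n * (\<sigma> / 4 * (ln (real ?n) / (2 * pi) - 1) - real ?n * e)"
    using N unfolding err_def qN by (simp add: field_simps power2_eq_square)
  finally show ?thesis .
qed

end

section \<open>Choice of sizes, scales and multiplicities\<close>

lemma block_threshold:
  assumes C: "0 \<le> C" and N0: "N0 \<ge> 2" and q0: "0 < q0" "q0 < 1" and e: "e > 0"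
  shows "\<exists>\<delta>>0. \<forall>N q T b. blocks N q T C \<longrightarrow> N b = N0 \<longrightarrow> q b = q0 \<longrightarrow> 0 < T b \<longrightarrow> T b \<le> \<delta> \<longrightarrow>
    (\<forall>r<N0. blocks.second_order_error N q T b r \<le> e * (T b)\<^sup>2)"
proof -
  let ?Q = "\<lambda>r \<delta>. \<forall>N q T b. blocks N q T C \<longrightarrow> N b = N0 \<longrightarrow> q b = q0 \<longrightarrow> 0 < T b \<longrightarrow> T b \<le> \<delta> \<longrightarrow>
    blocks.second_order_error N q T b r \<le> e * (T b)\<^sup>2"
  have "\<exists>\<delta>>0. ?Q r \<delta>" for r
  proof -
    define y where "y = pt q0 (2 * r + 2)"
    have y: "y \<in> circle" unfolding y_def by (rule pt_circle)
    have ne: "y \<noteq> 1"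
    proof -
      have "y - 1 \<noteq> 0"
        using q0 one_minus_iu(1)[of "- ((- q0) ^ (2 * r + 2))"] unfolding y_def pt_def by (simp add: cayley_minus_1)
      then show ?thesis by simp
    qed
    \<comment> \<open>\<open>div1 y\<close> and \<open>div2 y\<close> depend on \<open>r\<close>, so
      each \<open>r\<close> gets its own threshold and the minimum over \<open>r < N0\<close> is
      taken below. The constants 4 for \<open>norm Z\<close> and \<open>4 N0\<close> for the block
      do not involve the scales.\<close>
    obtain \<delta> where \<delta>: "\<delta> > 0" "\<And>l Z f p k m S t v \<beta>. perturbation l Z f p C \<Longrightarrow> norm Z \<le> 4 \<Longrightarrow> 0 < t \<Longrightarrow> t \<le> \<delta> \<Longrightarrow>
      p k = div1 y \<Longrightarrow> l m = 1 \<Longrightarrow> m \<in> S \<Longrightarrow>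
      (\<And>y. supp_on S y \<Longrightarrow> supp_on S (Z \<cdot> y) \<and> norm (Z \<cdot> y) \<le> t * (4 * real N0) * norm y) \<Longrightarrow>
      Z \<cdot> basis_vec m = t *\<^sub>R v \<Longrightarrow> Z \<cdot> basis_vec k = (of_real t * \<beta>) *\<^sub>C basis_vec m \<Longrightarrow>
      cmod \<beta> \<le> 1 \<Longrightarrow> norm v \<le> 4 * real N0 \<Longrightarrow>
      norm ((perturbation.G l Z f 1 - perturbation.D l Z p) \<cdot> basis_vec k +
        (of_real (t\<^sup>2) * l k * \<beta>) *\<^sub>C (fc (circle_diagonal.U l) (\<lambda>z. div2 y z + div1 y z / 2) \<cdot> v)) \<le> e * t\<^sup>2"
      using second_order_asymptotics[OF continuous_div1[OF y] continuous_div2[OF y ne] div2_mult C _ e, of "4 * real N0" 4]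
      by (simp only: mult_nonneg_nonneg of_nat_0_le_iff zero_le_numeral simp_thms) blast
    have "?Q r \<delta>"
    proof (intro allI impI)
      fix N q T b
      assume bl: "blocks N q T C" and b: "N b = N0" "q b = q0" "0 < T b" "T b \<le> \<delta>"
      interpret blocks N q T C by fact
      have y: "l (ix b (2 * r + 2)) = y" by (simp add: b y_def)
      have "norm ((G 1 - D) \<cdot> basis_vec (ix b (2 * r + 2)) + (of_real ((T b)\<^sup>2) * l (ix b (2 * r + 2)) * cnj (A b (2 * r + 2))) *\<^sub>C
        (fc U (\<lambda>z. div2 y z + div1 y z / 2) \<cdot> vv b)) \<le> e * (T b)\<^sup>2"
      proof (rule \<delta>(2)[OF pert norm_Z b(3,4), where m = "ix b 0" and S = "range (ix b)"])
        show "div1 (l (ix b (2 * r + 2))) = div1 y" unfolding y ..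
        show "l (ix b 0) = 1" by (simp add: pt_def)
        show "Z \<cdot> basis_vec (ix b 0) = T b *\<^sub>R vv b" by (simp add: Z_column zcol_def)
        show "Z \<cdot> basis_vec (ix b (2 * r + 2)) = (of_real (T b) * cnj (A b (2 * r + 2))) *\<^sub>C basis_vec (ix b 0)"
          by (simp add: Z_column zcol_def)
        show "cmod (cnj (A b (2 * r + 2))) \<le> 1" by (simp add: cmod_A)
        show "norm (vv b) \<le> 4 * real N0" using norm_vv_le[of b] b by simp
        show "supp_on (range (ix b)) (Z \<cdot> x) \<and> norm (Z \<cdot> x) \<le> T b * (4 * real N0) * norm x"
          if "supp_on (range (ix b)) x" for x using Z_block_bounds[OF that] b by simp
      qed simp
      then show "second_order_error b r \<le> e * (T b)\<^sup>2"
        unfolding second_order_error_def R_def y .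
    qed
    with \<delta>(1) show ?thesis by blast
  qed
  then have "\<forall>r. \<exists>\<delta>>0. ?Q r \<delta>" ..
  then obtain d where d: "\<And>r. d r > 0" "\<And>r. ?Q r (d r)" by (subst (asm) choice_iff) blast
  define \<delta> where "\<delta> = Min (d ` {..<N0})"
  have ne: "d ` {..<N0} \<noteq> {}" using N0 by (auto simp: lessThan_empty_iff)
  have "\<delta> > 0" unfolding \<delta>_def using d(1) ne by (subst Min_gr_iff) auto
  moreover have le: "\<delta> \<le> d r" if "r < N0" for r
    unfolding \<delta>_def using that by (intro Min_le) auto
  ultimately show ?thesis
  proof (intro exI[of _ \<delta>] conjI allI impI)
    fix N q T b r
    assume prems: "blocks N q T C" "N b = N0" "q b = q0" "0 < T b" "T b \<le> \<delta>" "r < N0"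
    show "blocks.second_order_error N q T b r \<le> e * (T b)\<^sup>2"
      by (rule d(2)[of r, rule_format, OF prems(1-4) order_trans[OF prems(5) le[OF prems(6)]]])
  qed
qed

text \<open>The weight is taken at \<open>x = (1 / n) ^ (2 n)\<close>, where
  \<open>1 / x = exp (2 n ln n)\<close>. Two logarithms reduce this to at most
  \<open>ln (2 n^2 + 2)\<close>, so the weight is at least of order \<open>1 / sqrt (ln n)\<close>
  and loses against the factor \<open>ln n\<close>.\<close>

lemma block_gain_tendsto:
  "filterlim (\<lambda>n. wgt ((1 / real n) ^ (2 * n)) / 4 * (ln (real n) / (2 * pi) - 1) - 1) at_top sequentially"
proof (rule filterlim_at_top_mono)
  show "filterlim (\<lambda>n::nat. ln (2 * (real n)\<^sup>2 + 2) powr (- 1 / 2) / 4 * (ln (real n) / (2 * pi) - 1) - 1) at_top sequentially"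
    by real_asymp
  have "\<forall>\<^sub>F n in sequentially. 0 \<le> ln (real n) / (2 * pi) - 1"
    by real_asymp
  then show "\<forall>\<^sub>F n in sequentially. ln (2 * (real n)\<^sup>2 + 2) powr (- 1 / 2) / 4 * (ln (real n) / (2 * pi) - 1) - 1 \<le>
      wgt ((1 / real n) ^ (2 * n)) / 4 * (ln (real n) / (2 * pi) - 1) - 1"
    using eventually_gt_at_top[of 0]
  proof eventually_elim
    case (elim n)
    define x where "x = (1 / real n) ^ (2 * n)"
    define y where "y = 2 * real n * ln (real n)"
    have x: "x > 0" using elim by (simp add: x_def)
    have y: "0 \<le> y" "y \<le> 2 * (real n)\<^sup>2"
      using elim ln_bound[of "real n"] by (auto simp: y_def power2_eq_square)
    have "exp y = exp (ln (real n)) ^ (2 * n)" by (simp add: y_def exp_of_nat_mult[symmetric])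
    then have xy: "1 / x = exp y" using elim by (simp add: x_def power_one_over)
    \<comment> \<open>Since \<open>exp y \<ge> 1\<close>, the left side is at most
      \<open>4 exp y\<close>, and \<open>4 \<le> exp 2\<close>.\<close>
    have "3 + exp y \<le> exp (y + 2)"
    proof -
      have "2 \<le> exp (1 :: real)" using exp_ge_add_one_self[of 1] by simp
      then have "2 * 2 \<le> exp (1 :: real) * exp 1" by (intro mult_mono) auto
      then have "4 \<le> exp (2 :: real)" by (simp add: exp_add[symmetric])
      then have "exp y * 4 \<le> exp (y + 2)" unfolding exp_add by (intro mult_left_mono) auto
      moreover have "1 \<le> exp y" using y by simp
      ultimately show ?thesis by linarith
    qed
    then have "ln (3 + exp y) \<le> ln (exp (y + 2))" by (subst ln_le_cancel_iff) (auto simp: add_pos_pos)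
    then have "ln (3 + exp y) \<le> 2 * (real n)\<^sup>2 + 2" using y by simp
    moreover have l: "1 < ln (3 + exp y)" "0 < ln (ln (3 + exp y))" using ln_3_gt[OF x] unfolding xy .
    ultimately have "ln (ln (3 + exp y)) \<le> ln (2 * (real n)\<^sup>2 + 2)"
      by (subst ln_le_cancel_iff) (auto simp: add_nonneg_pos)
    then have "ln (2 * (real n)\<^sup>2 + 2) powr (- 1 / 2) \<le> wgt x"
      unfolding wgt_def xy using l by (intro powr_mono2') auto
    then show ?case using elim unfolding x_def by (intro diff_right_mono mult_right_mono divide_right_mono) auto
  qed
qed

text \<open>An index is a level \<open>m\<close>, a copy \<open>j\<close> of its block and a
  frequency \<open>k\<close>. Level \<open>m\<close> costs at most \<open>8 (1 / 2) ^ m\<close> in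
  squared Hilbert-Schmidt norm and contributes at least 1 to the tested sum.\<close>

lemma block_example_exists:
  obtains N q T C where "blocks N q T C"
    "\<And>c. \<exists>(I :: ((nat \<times> nat) \<times> nat) set) x y. finite I \<and>
      (\<forall>i\<in>I. \<forall>j\<in>I. ip (x i) (x j) = (if i = j then 1 else 0)) \<and>
      (\<forall>i\<in>I. \<forall>j\<in>I. ip (y i) (y j) = (if i = j then 1 else 0)) \<and>
      c < (\<Sum>i\<in>I. cmod (ip (blocks.R N q T \<cdot> x i) (y i)))"
proof -
  obtain C where C: "0 \<le> C" "\<And>z w. z \<in> circle \<Longrightarrow> w \<in> circle \<Longrightarrow> cmod (circle_fun z - circle_fun w) \<le> C * cmod (z - w)"
    "\<And>z. z \<in> circle \<Longrightarrow> cmod (circle_fun1 z) \<le> C" using circle_fun_Lipschitz by blast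
  have d1: "cmod (div1 w z) \<le> C" if "z \<in> circle" "w \<in> circle" for z w
  proof (cases "z = w")
    case True
    then show ?thesis using C(3)[OF that(2)] by (simp add: div1_def div_diff_def)
  next
    case False
    then have "cmod (div1 w z) = cmod (circle_fun z - circle_fun w) / cmod (z - w)"
      by (simp add: div1_def div_diff_def norm_divide)
    then show ?thesis using C(2)[OF that] False by (simp add: pos_divide_le_eq)
  qed
  \<comment> \<open>The lower bound of \<open>block_lower_bound\<close> per unit of
    \<open>T^2 N\<close>, for error \<open>e = 1 / N\<close>; the last \<open>- 1\<close> is
    \<open>N e\<close>.\<close>
  define \<kappa> where "\<kappa> n = wgt ((1 / real n) ^ (2 * n)) / 4 * (ln (real n) / (2 * pi) - 1) - 1" for n :: nat
  have "\<exists>n\<ge>2. 2 ^ m \<le> \<kappa> n" for m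
  proof -
    have "\<forall>\<^sub>F n in sequentially. 2 ^ m \<le> \<kappa> n \<and> 2 \<le> n"
      using block_gain_tendsto unfolding \<kappa>_def filterlim_at_top
      by (intro eventually_conj eventually_ge_at_top) blast
    then show ?thesis by (auto simp: eventually_at_top_linorder)
  qed
  then obtain Nf where Nf: "\<And>m. Nf m \<ge> 2" "\<And>m. 2 ^ m \<le> \<kappa> (Nf m)" by metis
  have N0: "real (Nf m) > 0" for m using Nf(1)[of m] by simp
  let ?P = "\<lambda>m \<delta>. \<forall>N q T b. blocks N q T C \<longrightarrow> N b = Nf m \<longrightarrow> q b = 1 / real (Nf m) \<longrightarrow> 0 < T b \<longrightarrow> T b \<le> \<delta> \<longrightarrow>
    (\<forall>r<Nf m. blocks.second_order_error N q T b r \<le> 1 / real (Nf m) * (T b)\<^sup>2)"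
  have "\<exists>\<delta>>0. ?P m \<delta>" for m
    using Nf(1)[of m] by (intro block_threshold C) auto
  then have "\<forall>m. \<exists>\<delta>>0. ?P m \<delta>" ..
  then obtain \<delta> where d: "\<forall>m. \<delta> m > 0 \<and> ?P m (\<delta> m)" by (rule choice[THEN exE])
  have \<delta>: "\<delta> m > 0" "?P m (\<delta> m)" for m
    by (rule conjunct1[OF spec[OF d]], rule conjunct2[OF spec[OF d]])
  \<comment> \<open>The first bound is the threshold of the second order expansion. The second makes
    a single copy cost \<open>g m \<le> (1 / 2) ^ m\<close>, so that rounding the number of copies
    up to an integer at most doubles the total.\<close>
  define t where "t m = min (\<delta> m) (1 / sqrt (2 ^ m * real (Nf m)))" for m
  have t0: "t m > 0" for m using \<delta>(1) N0 by (simp add: t_def)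
  have tN: "(t m)\<^sup>2 * real (Nf m) \<le> (1 / 2) ^ m" for m
  proof -
    have "(t m)\<^sup>2 \<le> (1 / sqrt (2 ^ m * real (Nf m)))\<^sup>2"
      using t0[of m] by (intro power_mono) (auto simp: t_def)
    also have "\<dots> = 1 / (2 ^ m * real (Nf m))" by (simp add: power_divide)
    finally show ?thesis using N0[of m] by (simp add: field_simps power_one_over)
  qed
  define g where "g m = (t m)\<^sup>2 * real (Nf m)" for m
  have g0: "g m > 0" for m
    unfolding g_def by (intro mult_pos_pos zero_less_power t0 N0)
  \<comment> \<open>Enough copies to bring \<open>M m * g m\<close> up to
    \<open>(1 / 2) ^ m\<close>.\<close>
  define M where "M m = nat \<lceil>(1 / 2) ^ m / g m\<rceil>" for m
  have M1: "(1 / 2) ^ m \<le> real (M m) * g m" for m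
  proof -
    have "(1 / 2) ^ m / g m \<le> real (M m)" unfolding M_def by (rule real_nat_ceiling_ge)
    then show ?thesis using g0[of m] by (simp add: pos_divide_le_eq)
  qed
  have M2: "real (M m) * g m \<le> 2 * (1 / 2) ^ m" for m
  proof -
    have "0 \<le> (1 / 2) ^ m / g m" using g0[of m] by simp
    then have "real (M m) \<le> (1 / 2) ^ m / g m + 1" unfolding M_def by linarith
    then have "real (M m) * g m \<le> ((1 / 2) ^ m / g m + 1) * g m" using g0[of m] by (intro mult_right_mono) auto
    also have "\<dots> = (1 / 2) ^ m + g m" using g0[of m] by (simp add: field_simps)
    also have "\<dots> \<le> 2 * (1 / 2) ^ m" using tN[of m] by (simp add: g_def)
    finally show ?thesis .
  qed
  define N where "N b = Nf (fst (prod_decode b))" for b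
  define q where "q b = 1 / real (N b)" for b
  \<comment> \<open>Every pair \<open>(m, j)\<close> indexes a block, but the copies from
    \<open>M m\<close> on have scale 0.\<close>
  define T where "T b = (case prod_decode b of (m, j) \<Rightarrow> if j < M m then t m else 0)" for b
  have bl: "blocks N q T C"
  proof
    show "0 < q b" for b using N0 by (simp add: q_def N_def)
    show "q b < 1" for b using Nf(1)[of "fst (prod_decode b)"] by (simp add: q_def N_def)
    show "0 \<le> T b" for b using t0 by (auto simp: T_def less_imp_le split: prod.splits)
    show "cmod (div1 w z) \<le> C" if "z \<in> circle" "w \<in> circle" for z w by (rule d1[OF that])
    fix B
    let ?h = "\<lambda>b. 4 * real (N b) * (T b)\<^sup>2"
    let ?P = "\<lambda>(m, j). ix m j"
    have "{..<B} \<subseteq> ?P ` ({..<B} \<times> {..<B})"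
    proof
      fix i assume "i \<in> {..<B}"
      obtain m j where "i = ix m j" by (rule ix_cases)
      then show "i \<in> ?P ` ({..<B} \<times> {..<B})"
        using \<open>i \<in> {..<B}\<close> le_prod_encode_1[of m j] le_prod_encode_2[of j m] by force
    qed
    then have "(\<Sum>b<B. ?h b) \<le> (\<Sum>b\<in>?P ` ({..<B} \<times> {..<B}). ?h b)"
      by (intro sum_mono2) auto
    also have "\<dots> = (\<Sum>(m, j)\<in>{..<B} \<times> {..<B}. ?h (ix m j))"
      by (subst sum.reindex) (auto simp: inj_on_def case_prod_unfold)
    also have "\<dots> = (\<Sum>m<B. \<Sum>j<B. ?h (ix m j))"
      by (simp add: sum.cartesian_product)
    \<comment> \<open>The 4 of \<open>?h\<close> times the 2 of \<open>M2\<close>; the geometric sum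
      over \<open>m\<close> then gives the 16 of the locale.\<close>
    also have "\<dots> \<le> (\<Sum>m<B. 8 * (1 / 2) ^ m)"
    proof (rule sum_mono)
      fix m
      have "(\<Sum>j<B. ?h (ix m j)) = (\<Sum>j<B. if j \<in> {..<M m} then 4 * g m else 0)"
        by (intro sum.cong refl) (simp add: N_def T_def g_def)
      also have "\<dots> = (\<Sum>j\<in>{..<B} \<inter> {..<M m}. 4 * g m)"
        by (rule sum.inter_restrict[symmetric]) simp
      also have "\<dots> \<le> (\<Sum>j\<in>{..<M m}. 4 * g m)" using g0[of m] by (intro sum_mono2) auto
      also have "\<dots> \<le> 8 * (1 / 2) ^ m" using M2[of m] by (simp add: mult.commute)
      finally show "(\<Sum>j<B. ?h (ix m j)) \<le> 8 * (1 / 2) ^ m" .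
    qed
    also have "\<dots> = 8 * (\<Sum>m<B. (1 / 2) ^ m)" by (simp add: sum_distrib_left)
    also have "\<dots> \<le> 8 * 2"
    proof -
      have "(\<Sum>m<B. (1 / 2 :: real) ^ m) = 2 - 2 * (1 / 2) ^ B" by (simp add: geometric_sum)
      also have "\<dots> \<le> 2" by simp
      finally show ?thesis by simp
    qed
    finally show "(\<Sum>b<B. ?h b) \<le> 16" by simp
  qed
  interpret blocks N q T C by (rule bl)
  have block: "g m * 2 ^ m \<le> (\<Sum>k<Nf m. cmod (ip (R \<cdot> fourier_vec 2 (ix m j) k) (fourier_vec 1 (ix m j) k)))"
    if j: "j < M m" for m j
  proof -
    let ?b = "ix m j"
    have Nb: "N ?b = Nf m" and Tb: "T ?b = t m" using j by (auto simp: N_def T_def)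
    have qb: "q ?b = 1 / real (Nf m)" by (simp add: q_def Nb)
    have "T ?b \<le> \<delta> m" by (simp add: Tb t_def)
    then have "\<forall>r<Nf m. second_order_error ?b r \<le> 1 / real (Nf m) * (T ?b)\<^sup>2"
      by (intro \<delta>(2)[of m, rule_format, OF bl Nb qb] allI impI) (simp_all add: Tb t0)
    then have "(\<Sum>k<N ?b. cmod (ip (R \<cdot> fourier_vec 2 ?b k) (fourier_vec 1 ?b k))) \<ge>
      (T ?b)\<^sup>2 * real (N ?b) * (wgt (q ?b ^ (2 * N ?b)) / 4 * (ln (real (N ?b)) / (2 * pi) - 1) - real (N ?b) * (1 / real (Nf m)))"
      using Nf(1)[of m] by (intro block_lower_bound) (auto simp: Nb qb)
    also have "real (N ?b) * (1 / real (Nf m)) = 1" using N0[of m] by (simp add: Nb)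
    also have "(T ?b)\<^sup>2 * real (N ?b) * (wgt (q ?b ^ (2 * N ?b)) / 4 * (ln (real (N ?b)) / (2 * pi) - 1) - 1) = g m * \<kappa> (Nf m)"
      by (simp only: g_def \<kappa>_def Nb Tb qb)
    finally have "g m * \<kappa> (Nf m) \<le> (\<Sum>k<Nf m. cmod (ip (R \<cdot> fourier_vec 2 ?b k) (fourier_vec 1 ?b k)))"
      by (simp only: Nb)
    moreover have "g m * 2 ^ m \<le> g m * \<kappa> (Nf m)" using Nf(2)[of m] g0[of m] by simp
    ultimately show ?thesis by linarith
  qed
  have "\<exists>(I :: ((nat \<times> nat) \<times> nat) set) x y. finite I \<and>
      (\<forall>i\<in>I. \<forall>j\<in>I. ip (x i) (x j) = (if i = j then 1 else 0)) \<and>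
      (\<forall>i\<in>I. \<forall>j\<in>I. ip (y i) (y j) = (if i = j then 1 else 0)) \<and>
      c < (\<Sum>i\<in>I. cmod (ip (R \<cdot> x i) (y i)))" for c :: real
  proof -
    obtain n0 :: nat where n0: "c < real n0" using reals_Archimedean2 by blast
    define J where "J = Sigma {..<n0} (\<lambda>m. {..<M m})"
    define I where "I = Sigma J (\<lambda>(m, j). {..<Nf m})"
    define x where "x s = (\<lambda>((m, j), k). fourier_vec s (ix m j) k)" for s
    have fin: "finite J" "finite I" by (auto simp: J_def I_def)
    have on: "ip (x s i) (x s i') = (if i = i' then 1 else 0)" if "i \<in> I" "i' \<in> I" for s i i'
      using that by (auto simp: I_def x_def fourier_vec_orthonormal N_def split: if_splits)
    have "real n0 = (\<Sum>m<n0. 1)" by simp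
    \<comment> \<open>Cost at least \<open>(1 / 2) ^ m\<close> by \<open>M1\<close>, multiplied by
      the gain \<open>2 ^ m\<close>: each level contributes at least 1.\<close>
    also have "\<dots> \<le> (\<Sum>m<n0. real (M m) * (g m * 2 ^ m))"
    proof (rule sum_mono)
      fix m
      have "1 = (1 / 2) ^ m * (2 :: real) ^ m" by (simp add: power_one_over)
      also have "\<dots> \<le> real (M m) * g m * 2 ^ m" by (intro mult_right_mono M1) auto
      finally show "1 \<le> real (M m) * (g m * 2 ^ m)" by (simp add: mult.assoc)
    qed
    also have "\<dots> = (\<Sum>m<n0. \<Sum>j<M m. g m * 2 ^ m)" by simp
    also have "\<dots> \<le> (\<Sum>m<n0. \<Sum>j<M m. \<Sum>k<Nf m. cmod (ip (R \<cdot> fourier_vec 2 (ix m j) k) (fourier_vec 1 (ix m j) k)))"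
      by (intro sum_mono block) auto
    also have "\<dots> = (\<Sum>(m, j)\<in>J. \<Sum>k<Nf m. cmod (ip (R \<cdot> fourier_vec 2 (ix m j) k) (fourier_vec 1 (ix m j) k)))"
      unfolding J_def by (rule sum.Sigma) auto
    also have "\<dots> = (\<Sum>s\<in>J. \<Sum>k\<in>(case s of (m, j) \<Rightarrow> {..<Nf m}). cmod (ip (R \<cdot> x 2 (s, k)) (x 1 (s, k))))"
      by (intro sum.cong refl) (auto simp: x_def)
    also have "\<dots> = (\<Sum>(s, k)\<in>I. cmod (ip (R \<cdot> x 2 (s, k)) (x 1 (s, k))))"
      unfolding I_def using fin(1) by (intro sum.Sigma) auto
    also have "\<dots> = (\<Sum>i\<in>I. cmod (ip (R \<cdot> x 2 i) (x 1 i)))"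
      by (simp add: case_prod_unfold)
    finally show ?thesis using n0 fin on by (intro exI[of _ I] exI[of _ "x 2"] exI[of _ "x 1"]) auto
  qed
  with bl that show thesis by blast
qed

section \<open>The sequence space as a Hilbert space record\<close>

text \<open>
  The operations pass through \<open>Abs_ell2\<close>, so that \<open>hdist\<close> is symmetric and nonnegative outside the
  carrier as well, as the locale \<^locale>\<open>Metric_space\<close> requires.
\<close>

definition ell2_hilbert :: "(nat \<Rightarrow> complex) hilbert" where
  "ell2_hilbert = \<lparr>carrier = range coord, mult = undefined, one = undefined, zero = coord 0,
     add = (\<lambda>x y. coord (Abs_ell2 x + Abs_ell2 y)), smult = (\<lambda>c x. coord (c *\<^sub>C Abs_ell2 x)),
     cinner = (\<lambda>x y. ip (Abs_ell2 x) (Abs_ell2 y))\<rparr>"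

abbreviation H where "H \<equiv> ell2_hilbert"

lemma carrier_H: "carrier H = range coord"
  by (simp add: ell2_hilbert_def)

lemma coord_in_carrier [simp]: "coord x \<in> carrier H"
  by (simp add: carrier_H)

lemma carrierE: assumes "x \<in> carrier H" obtains x' where "x = coord x'"
  using assms by (auto simp: carrier_H)

lemma Abs_coord [simp]: "Abs_ell2 (coord x) = x"
  by (rule coord_inverse)

lemma coord_eq_iff [simp]: "coord x = coord y \<longleftrightarrow> x = y"
  by (rule coord_inject)

lemma H_simps [simp]:
  "coord x \<oplus>\<^bsub>H\<^esub> coord y = coord (x + y)" "c \<odot>\<^bsub>H\<^esub> coord x = coord (c *\<^sub>C x)" "\<zero>\<^bsub>H\<^esub> = coord 0"
  "cinner H (coord x) (coord y) = ip x y"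
  by (auto simp: ell2_hilbert_def)

lemma module_H: "Module.module complex_ring H"
proof (intro Module.module.intro)
  show "cring complex_ring"
  proof (rule cringI)
    show "abelian_group complex_ring"
    proof (rule abelian_groupI)
      show "\<exists>y\<in>carrier complex_ring. y \<oplus>\<^bsub>complex_ring\<^esub> x = \<zero>\<^bsub>complex_ring\<^esub>" for x
        by (intro bexI[of _ "- x"]) (auto simp: complex_ring_def)
    qed (auto simp: complex_ring_def)
    show "Group.comm_monoid complex_ring"
      by unfold_locales (auto simp: complex_ring_def)
  qed (auto simp: complex_ring_def algebra_simps)
  show "abelian_group H"
  proof (rule abelian_groupI)
    fix x assume "x \<in> carrier H"
    then obtain x' where "x = coord x'" by (rule carrierE)
    then show "\<exists>y\<in>carrier H. y \<oplus>\<^bsub>H\<^esub> x = \<zero>\<^bsub>H\<^esub>" by (intro bexI[of _ "coord (- x')"]) auto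
  qed (auto elim!: carrierE simp: algebra_simps)
  show "module_axioms complex_ring H"
    by (rule module_axioms.intro) (auto elim!: carrierE simp: complex_ring_def scaleC_add_left scaleC_add_right)
qed

lemma abelian_monoid_H: "abelian_monoid H"
  using module_H by (intro abelian_group.axioms module.axioms)

text \<open>The definite description behind the inverse ranges over the carrier, yet it determines a
  value for \<open>x\<close> outside the carrier too, since addition factors through
  \<open>Abs_ell2\<close>.\<close>

lemma H_minus: "\<ominus>\<^bsub>H\<^esub> x = coord (- Abs_ell2 x)"
  unfolding a_inv_def m_inv_def
proof (rule the_equality)
  show "coord (- Abs_ell2 x) \<in> carrier (add_monoid H) \<and> x \<otimes>\<^bsub>add_monoid H\<^esub> coord (- Abs_ell2 x) = \<one>\<^bsub>add_monoid H\<^esub> \<and>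
      coord (- Abs_ell2 x) \<otimes>\<^bsub>add_monoid H\<^esub> x = \<one>\<^bsub>add_monoid H\<^esub>"
    by (simp add: ell2_hilbert_def)
  fix y assume y: "y \<in> carrier (add_monoid H) \<and> x \<otimes>\<^bsub>add_monoid H\<^esub> y = \<one>\<^bsub>add_monoid H\<^esub> \<and>
      y \<otimes>\<^bsub>add_monoid H\<^esub> x = \<one>\<^bsub>add_monoid H\<^esub>"
  then obtain y' where y': "y = coord y'" by (auto simp: ell2_hilbert_def)
  have "Abs_ell2 x + y' = 0" using y by (simp add: ell2_hilbert_def y')
  then show "y = coord (- Abs_ell2 x)" by (simp add: y' eq_neg_iff_add_eq_0 add.commute)
qed

lemma H_diff: "x \<ominus>\<^bsub>H\<^esub> y = coord (Abs_ell2 x - Abs_ell2 y)"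
  by (simp add: a_minus_def H_minus) (simp add: ell2_hilbert_def)

lemma H_diff_coord [simp]: "coord x \<ominus>\<^bsub>H\<^esub> coord y = coord (x - y)"
  by (simp add: H_diff)

lemma hnorm_coord [simp]: "hnorm H (coord x) = norm x"
  by (simp add: hnorm_def ip_self)

lemma hdist_H: "hdist H x y = dist (Abs_ell2 x) (Abs_ell2 y)"
  by (simp add: hdist_def H_diff dist_norm)

lemma Metric_H: "Metric_space (carrier H) (hdist H)"
proof
  show "hdist H x y = 0 \<longleftrightarrow> x = y" if "x \<in> carrier H" "y \<in> carrier H" for x y
    using that by (auto elim!: carrierE simp: hdist_H)
  show "hdist H x z \<le> hdist H x y + hdist H y z" for x y z
    by (simp add: hdist_H dist_triangle)
qed (simp_all add: hdist_H dist_commute)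

lemma hilbert_H: "hilbert_space H"
proof (intro hilbert_space.intro hilbert_space_axioms.intro)
  show "Module.module complex_ring H" by (rule module_H)
  show "Metric_space.mcomplete (carrier H) (hdist H)"
    unfolding Metric_space.mcomplete_def[OF Metric_H]
  proof (intro allI impI)
    fix \<sigma> assume s: "Metric_space.MCauchy (carrier H) (hdist H) \<sigma>"
    then have r: "range \<sigma> \<subseteq> carrier H"
      and c: "\<And>e. e > 0 \<Longrightarrow> \<exists>N. \<forall>n n'. N \<le> n \<longrightarrow> N \<le> n' \<longrightarrow> hdist H (\<sigma> n) (\<sigma> n') < e"
      unfolding Metric_space.MCauchy_def[OF Metric_H] by blast+
    have "Cauchy (\<lambda>n. Abs_ell2 (\<sigma> n))"
      unfolding Cauchy_def using c by (simp add: hdist_H)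
    then obtain L where "(\<lambda>n. Abs_ell2 (\<sigma> n)) \<longlonglongrightarrow> L"
      by (auto simp: Cauchy_convergent_iff convergent_def)
    then have "limitin (Metric_space.mtopology (carrier H) (hdist H)) \<sigma> (coord L) sequentially"
      unfolding Metric_space.limit_metric_sequentially[OF Metric_H]
      using range_subsetD[OF r] by (simp add: hdist_H lim_sequentially)
    then show "\<exists>x. limitin (Metric_space.mtopology (carrier H) (hdist H)) \<sigma> x sequentially" by blast
  qed
  show "0 < Re (cinner H x x)" if "x \<in> carrier H" "x \<noteq> \<zero>\<^bsub>H\<^esub>" for x
    using that by (auto elim!: carrierE simp: ip_self)
  show "cinner H x y = cnj (cinner H y x)" if "x \<in> carrier H" "y \<in> carrier H" for x y
    using that by (auto elim!: carrierE intro: ip_commute)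
qed (auto elim!: carrierE simp: ip_add_left ip_scaleC_left)

lemma separable_H: "separable_hilbert H"
proof -
  let ?X = "Metric_space.mtopology (carrier H) (hdist H)"
  \<comment> \<open>Lists of pairs of rationals are a countable index type for the finite
    combinations with complex rational coefficients.\<close>
  define v where "v xs = coord (\<Sum>k<length xs. (of_real (of_rat (fst (xs ! k))) + \<i> * of_real (of_rat (snd (xs ! k)))) *\<^sub>C basis_vec k)"
    for xs :: "(rat \<times> rat) list"
  have "?X closure_of (range v) = carrier H"
  proof
    show "?X closure_of (range v) \<subseteq> carrier H"
      using closure_of_subset_topspace[of ?X "range v"] Metric_space.topspace_mtopology[OF Metric_H] by simp
    show "carrier H \<subseteq> ?X closure_of (range v)"
    proof
      fix x assume "x \<in> carrier H"
      then obtain x' where x: "x = coord x'" by (rule carrierE)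
      have "\<exists>xs. hdist H x (v xs) < e" if e: "e > 0" for e
      proof -
        have "(\<lambda>N. \<Sum>k<N. coord x' k *\<^sub>C basis_vec k) \<longlonglongrightarrow> x'"
          using coord_expansion unfolding sums_def .
        then have "\<forall>\<^sub>F N in sequentially. dist (\<Sum>k<N. coord x' k *\<^sub>C basis_vec k) x' < e / 2"
          by (rule tendstoD) (use e in simp)
        then obtain N where N: "dist (\<Sum>k<N. coord x' k *\<^sub>C basis_vec k) x' < e / 2"
          by (auto simp: eventually_at_top_linorder)
        \<comment> \<open>Each of the \<open>N\<close> coefficients is off by at most
          \<open>2 \<eta>\<close>; the added 1 makes the total strictly less than
          \<open>e / 2\<close> and covers \<open>N = 0\<close>.\<close>
        define \<eta> where "\<eta> = e / 2 / (2 * real N + 1)"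
        have N1: "2 * real N + 1 > 0" by simp
        have \<eta>: "\<eta> > 0" using e N1 by (simp add: \<eta>_def)
        have "\<exists>r s. \<bar>Re z - of_rat r\<bar> < \<eta> \<and> \<bar>Im z - of_rat s\<bar> < \<eta>" for z
        proof -
          have "\<exists>r. \<bar>y - of_rat r\<bar> < \<eta>" for y
            using of_rat_dense[of "y - \<eta>" "y + \<eta>"] \<eta> by (auto simp: abs_less_iff) (metis add.commute less_diff_eq diff_less_eq)
          then show ?thesis by blast
        qed
        then obtain r s where rs: "\<And>z. \<bar>Re z - of_rat (r z)\<bar> < \<eta>" "\<And>z. \<bar>Im z - of_rat (s z)\<bar> < \<eta>" by metis
        define c where "c k = of_real (of_rat (r (coord x' k))) + \<i> * of_real (of_rat (s (coord x' k)))" for k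
        have ck: "cmod (coord x' k - c k) \<le> 2 * \<eta>" for k
          using cmod_le[of "coord x' k - c k"] rs[of "coord x' k"] by (simp add: c_def)
        define xs where "xs = map (\<lambda>k. (r (coord x' k), s (coord x' k))) [0..<N]"
        have vx: "v xs = coord (\<Sum>k<N. c k *\<^sub>C basis_vec k)"
          by (simp add: v_def xs_def c_def)
        have "dist (\<Sum>k<N. coord x' k *\<^sub>C basis_vec k) (\<Sum>k<N. c k *\<^sub>C basis_vec k) =
            norm (\<Sum>k<N. (coord x' k - c k) *\<^sub>C basis_vec k)"
          by (simp add: dist_norm sum_subtractf scaleC_diff_left)
        also have "\<dots> \<le> (\<Sum>k<N. 2 * \<eta>)"
          by (rule sum_norm_le) (use ck in simp)
        also have "\<dots> < e / 2"
        proof -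
          have "real N * (2 * \<eta>) < (2 * real N + 1) * \<eta>" using \<eta> by (simp add: algebra_simps)
          also have "\<dots> = e / 2"
            unfolding \<eta>_def by (subst times_divide_eq_right, rule nonzero_mult_div_cancel_left) (use N1 in linarith)
          finally show ?thesis by simp
        qed
        finally have "dist x' (\<Sum>k<N. c k *\<^sub>C basis_vec k) < e"
          using N dist_triangle[of x' "\<Sum>k<N. c k *\<^sub>C basis_vec k" "\<Sum>k<N. coord x' k *\<^sub>C basis_vec k"]
          by (simp add: dist_commute)
        then show ?thesis by (intro exI[of _ xs]) (simp add: hdist_H x vx)
      qed
      then show "x \<in> ?X closure_of (range v)"
        unfolding Metric_space.metric_closure_of[OF Metric_H]
        by (auto simp: x Metric_space.in_mball[OF Metric_H] v_def) 
    qed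
  qed
  moreover have "countable (range v)" by simp
  moreover have "range v \<subseteq> carrier H" by (auto simp: v_def)
  ultimately show ?thesis
    unfolding separable_hilbert_def separable_space_def Metric_space.topspace_mtopology[OF Metric_H] by blast
qed

subsection \<open>Operators\<close>

definition lift_op :: "bop \<Rightarrow> (nat \<Rightarrow> complex) \<Rightarrow> nat \<Rightarrow> complex" where
  "lift_op A = (\<lambda>x\<in>carrier H. coord (A \<cdot> Abs_ell2 x))"

lemma lift_op_coord [simp]: "lift_op A (coord x) = coord (A \<cdot> x)"
  by (simp add: lift_op_def)

lemma lift_op_eqI:
  assumes "B \<in> extensional (carrier H)" "\<And>x. B (coord x) = coord (A \<cdot> x)"
  shows "B = lift_op A"
  by (rule extensionalityI[OF assms(1)]) (auto simp: lift_op_def assms(2) elim!: carrierE)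

lemma lift_op_inject [simp]: "lift_op A = lift_op B \<longleftrightarrow> A = B"
proof
  assume "lift_op A = lift_op B"
  then have "lift_op A (coord x) = lift_op B (coord x)" for x by simp
  then show "A = B" by (intro bop_eqI) simp
qed simp

lemma lift_op_bounded [simp]: "lift_op A \<in> bounded_ops H"
proof -
  have "\<exists>K. \<forall>x\<in>carrier H. hnorm H (lift_op A x) \<le> K * hnorm H x"
    by (intro exI[of _ "norm A"]) (auto elim!: carrierE intro: norm_app_le)
  then show ?thesis
    unfolding bounded_ops_def
    by (auto elim!: carrierE simp: app_add_right app_scaleC_right) (auto simp: lift_op_def)
qed

text \<open>With \<open>lift_op_inject\<close> this makes \<open>lift_op\<close> a bijection onto
  \<open>bounded_ops H\<close>, so that the uniqueness demanded by \<open>op_adj\<close>,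
  \<open>op_exp\<close> and \<open>cfc\<close> can be checked on \<open>bop\<close>.\<close>

lemma bounded_opsE:
  assumes "B \<in> bounded_ops H"
  obtains A where "B = lift_op A"
proof -
  have B: "B \<in> carrier H \<rightarrow>\<^sub>E carrier H"
    "\<And>x y. x \<in> carrier H \<Longrightarrow> y \<in> carrier H \<Longrightarrow> B (x \<oplus>\<^bsub>H\<^esub> y) = B x \<oplus>\<^bsub>H\<^esub> B y"
    "\<And>c x. x \<in> carrier H \<Longrightarrow> B (c \<odot>\<^bsub>H\<^esub> x) = c \<odot>\<^bsub>H\<^esub> B x"
    using assms unfolding bounded_ops_def by blast+
  obtain K where K: "\<And>x. x \<in> carrier H \<Longrightarrow> hnorm H (B x) \<le> K * hnorm H x"
    using assms unfolding bounded_ops_def by blast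
  define F where "F x = Abs_ell2 (B (coord x))" for x
  have BF: "B (coord x) = coord (F x)" for x
  proof -
    have "B (coord x) \<in> carrier H" by (rule PiE_mem[OF B(1) coord_in_carrier])
    then show ?thesis by (auto simp: F_def elim!: carrierE)
  qed
  have "\<exists>A. \<forall>x. A \<cdot> x = F x"
  proof (rule bop_exists)
    show "F (x + y) = F x + F y" for x y using B(2)[of "coord x" "coord y"] by (simp add: BF)
    show "F (c *\<^sub>C x) = c *\<^sub>C F x" for c x using B(3)[of "coord x" c] by (simp add: BF)
    show "norm (F x) \<le> K * norm x" for x using K[of "coord x"] by (simp add: BF)
  qed
  then obtain A where "\<And>x. A \<cdot> x = F x" by blast
  then have "B = lift_op A" using B(1) by (intro lift_op_eqI) (auto simp: BF PiE_def)
  then show thesis by (rule that)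
qed

lemma op_id_H: "op_id H = lift_op 1"
  by (rule lift_op_eqI) (auto simp: op_id_def)

lemma op_add_H: "op_add H (lift_op A) (lift_op B) = lift_op (A + B)"
  by (rule lift_op_eqI) (auto simp: op_add_def app_add_left)

lemma op_diff_H: "op_diff H (lift_op A) (lift_op B) = lift_op (A - B)"
  by (rule lift_op_eqI) (auto simp: op_diff_def app_diff_left)

lemma op_scale_H: "op_scale H c (lift_op A) = lift_op (scalar c * A)"
  by (rule lift_op_eqI) (auto simp: op_scale_def)

lemma op_comp_H: "op_comp H (lift_op A) (lift_op B) = lift_op (A * B)"
  by (rule lift_op_eqI) (auto simp: op_comp_def compose_def)

lemma op_norm_H: "op_norm H (lift_op A) = norm A"
proof -
  have eq: "op_norm H (lift_op A) = (SUP x\<in>{x. norm x \<le> 1}. norm (A \<cdot> x))"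
  proof -
    have "{x \<in> carrier H. hnorm H x \<le> 1} = coord ` {x. norm x \<le> 1}"
      by (auto elim!: carrierE)
    then show ?thesis by (simp add: op_norm_def image_image)
  qed
  have le: "norm (A \<cdot> x) \<le> norm A" if "norm x \<le> 1" for x
    using norm_app_le[of A x] mult_left_mono[OF that, of "norm A"] by simp
  have bdd: "bdd_above ((\<lambda>x. norm (A \<cdot> x)) ` {x. norm x \<le> 1})"
    using le by (auto intro!: bdd_aboveI2)
  let ?S = "SUP x\<in>{x. norm x \<le> 1}. norm (A \<cdot> x)"
  have "norm (A \<cdot> 0) \<le> ?S" by (rule cSUP_upper[OF _ bdd]) simp
  then have S0: "0 \<le> ?S" by simp
  have "norm A \<le> ?S"
  proof (rule norm_bop_le[OF S0])
    fix x
    show "norm (A \<cdot> x) \<le> ?S * norm x"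
    proof (cases "x = 0")
      case False
      have "norm (A \<cdot> ((1 / norm x) *\<^sub>R x)) \<le> ?S"
        by (rule cSUP_upper[OF _ bdd]) (use False in simp)
      then show ?thesis using False by (simp add: app_scaleR_right divide_le_eq)
    qed simp
  qed
  moreover have "?S \<le> norm A"
    by (rule cSUP_least) (auto intro: le exI[of _ 0])
  ultimately show ?thesis using eq by simp
qed

lemma op_adj_H: "op_adj H (lift_op A) = lift_op (adj A)"
  unfolding op_adj_def
proof (rule the_equality)
  show "lift_op (adj A) \<in> bounded_ops H \<and>
      (\<forall>x\<in>carrier H. \<forall>y\<in>carrier H. cinner H (lift_op A x) y = cinner H x (lift_op (adj A) y))"
    by (auto elim!: carrierE simp: ip_app_left)
  fix B assume B: "B \<in> bounded_ops H \<and>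
      (\<forall>x\<in>carrier H. \<forall>y\<in>carrier H. cinner H (lift_op A x) y = cinner H x (B y))"
  then obtain B' where B': "B = lift_op B'" using bounded_opsE by blast
  have "adj A = B'"
  proof (rule adj_unique)
    fix x y show "ip (A \<cdot> x) y = ip x (B' \<cdot> y)"
      using conjunct2[OF B, rule_format, of "coord x" "coord y"] by (simp add: B')
  qed
  then show "B = lift_op (adj A)" by (simp add: B')
qed

lemma unitary_op_H: "unitary V \<Longrightarrow> unitary_op H (lift_op V)"
  by (simp add: unitary_op_def op_adj_H op_comp_H op_id_H unitary_def)

lemma self_adjoint_op_H: "self_adjoint_op H (lift_op A) \<longleftrightarrow> adj A = A"
  by (simp add: self_adjoint_op_def op_adj_H)

lemma op_exp_H: "op_exp H (lift_op A) = lift_op (exp A)"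
proof -
  have pow: "(lift_op A ^^ n) (coord x) = coord (A ^ n \<cdot> x)" for n x
    by (induction n) auto
  have fs: "(\<Oplus>\<^bsub>H\<^esub>n\<in>{..<N}. (1 / fact n) \<odot>\<^bsub>H\<^esub> (lift_op A ^^ n) (coord x)) =
      coord ((\<Sum>n<N. (A ^ n) /\<^sub>R fact n) \<cdot> x)" for N x
  proof (induction N)
    case 0
    show ?case by (simp add: abelian_monoid.finsum_empty[OF abelian_monoid_H])
  next
    case (Suc N)
    have "(\<Oplus>\<^bsub>H\<^esub>n\<in>{..<Suc N}. (1 / fact n) \<odot>\<^bsub>H\<^esub> (lift_op A ^^ n) (coord x)) =
        ((1 / fact N) \<odot>\<^bsub>H\<^esub> (lift_op A ^^ N) (coord x)) \<oplus>\<^bsub>H\<^esub>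
        (\<Oplus>\<^bsub>H\<^esub>n\<in>{..<N}. (1 / fact n) \<odot>\<^bsub>H\<^esub> (lift_op A ^^ n) (coord x))"
      unfolding lessThan_Suc by (rule abelian_monoid.finsum_insert[OF abelian_monoid_H]) (auto simp: pow)
    also have "\<dots> = coord ((1 / fact N) *\<^sub>C (A ^ N \<cdot> x) + ((\<Sum>n<N. (A ^ n) /\<^sub>R fact n) \<cdot> x))"
      unfolding Suc.IH by (simp only: pow H_simps)
    also have "(1 / fact N) *\<^sub>C (A ^ N \<cdot> x) + ((\<Sum>n<N. (A ^ n) /\<^sub>R fact n) \<cdot> x) = (\<Sum>n<Suc N. (A ^ n) /\<^sub>R fact n) \<cdot> x"
      by (simp add: app_add_left app_scaleR_left scaleR_scaleC inverse_eq_divide add.commute)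
    finally show ?case .
  qed
  have part: "(\<lambda>x\<in>carrier H. \<Oplus>\<^bsub>H\<^esub>n\<in>{..<N}. (1 / fact n) \<odot>\<^bsub>H\<^esub> (lift_op A ^^ n) x) =
      lift_op (\<Sum>n<N. (A ^ n) /\<^sub>R fact n)" for N
    by (rule lift_op_eqI) (auto simp: fs)
  have lim: "(\<lambda>N. \<Sum>n<N. (A ^ n) /\<^sub>R fact n) \<longlonglongrightarrow> exp A"
    using exp_converges[of A] unfolding sums_def .
  show ?thesis
    unfolding op_exp_def
  proof (rule the_equality)
    show "lift_op (exp A) \<in> bounded_ops H \<and> (\<lambda>N. op_norm H (op_diff H
        (\<lambda>x\<in>carrier H. \<Oplus>\<^bsub>H\<^esub>n\<in>{..<N}. (1 / fact n) \<odot>\<^bsub>H\<^esub> (lift_op A ^^ n) x) (lift_op (exp A)))) \<longlonglongrightarrow> 0"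
      unfolding part op_diff_H op_norm_H using lim by (simp add: LIM_zero tendsto_norm_zero)
    fix B assume B: "B \<in> bounded_ops H \<and> (\<lambda>N. op_norm H (op_diff H
        (\<lambda>x\<in>carrier H. \<Oplus>\<^bsub>H\<^esub>n\<in>{..<N}. (1 / fact n) \<odot>\<^bsub>H\<^esub> (lift_op A ^^ n) x) B)) \<longlonglongrightarrow> 0"
    then obtain B' where B': "B = lift_op B'" using bounded_opsE by blast
    have "(\<lambda>N. (\<Sum>n<N. (A ^ n) /\<^sub>R fact n) - B') \<longlonglongrightarrow> 0"
      using conjunct2[OF B] unfolding B' part op_diff_H op_norm_H by (rule tendsto_norm_zero_cancel)
    then have "(\<lambda>N. \<Sum>n<N. (A ^ n) /\<^sub>R fact n) \<longlonglongrightarrow> B'" by (rule LIM_zero_cancel)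
    then have "B' = exp A" using lim LIMSEQ_unique by blast
    then show "B = lift_op (exp A)" by (simp add: B')
  qed
qed

lemma cfc_H:
  assumes V: "unitary V" and f: "continuous_on circle f"
  shows "cfc H f (lift_op V) = lift_op (fc V f)"
  unfolding cfc_def
proof (rule the_equality)
  have "is_functional_calculus H (lift_op V) (\<lambda>f. lift_op (fc V f))"
    unfolding is_functional_calculus_def
    by (auto simp: op_id_H op_add_H op_comp_H op_scale_H op_adj_H op_norm_H fc_const[OF V] fc_id[OF V]
        fc_add[OF V] fc_mult[OF V] fc_cmult[OF V] fc_cnj[OF V] intro: norm_fc_le[OF V])
  then show "\<exists>\<Phi>. is_functional_calculus H (lift_op V) \<Phi> \<and> lift_op (fc V f) = \<Phi> f" by blast
  fix A assume "\<exists>\<Phi>. is_functional_calculus H (lift_op V) \<Phi> \<and> A = \<Phi> f"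
  then obtain \<Phi> where \<Phi>: "is_functional_calculus H (lift_op V) \<Phi>" and A: "A = \<Phi> f" by blast
  \<comment> \<open>Only at continuous functions is \<open>\<Phi>\<close> known to be a bounded
    operator; the choice makes \<open>F\<close> total.\<close>
  define F where "F g = (SOME B. \<Phi> g = lift_op B)" for g
  have F: "\<Phi> g = lift_op (F g)" if "continuous_on circle g" for g
  proof -
    have "\<Phi> g \<in> bounded_ops H" using \<Phi> that unfolding is_functional_calculus_def by blast
    then have "\<exists>B. \<Phi> g = lift_op B" using bounded_opsE by blast
    then show ?thesis unfolding F_def by (rule someI_ex)
  qed
  have one: "F (\<lambda>_. 1) = 1"
    using \<Phi> F[of "\<lambda>_. 1"] unfolding is_functional_calculus_def op_id_H by simp
  have scale: "F (\<lambda>z. c * g z) = scalar c * F g" if g: "continuous_on circle g" for c g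
  proof -
    have "\<Phi> (\<lambda>z. c * g z) = op_scale H c (\<Phi> g)" using \<Phi> g unfolding is_functional_calculus_def by blast
    moreover have "continuous_on circle (\<lambda>z. c * g z)" using g by (intro continuous_intros)
    ultimately show ?thesis using F g by (simp add: op_scale_H)
  qed
  have id: "F (\<lambda>z. z) = V"
    using \<Phi> F[of "\<lambda>z. z"] unfolding is_functional_calculus_def by simp
  have "F f = fc V f"
  proof (rule fc_unique[where F = F and V = V and f = f])
    show "unitary V" "F (\<lambda>z. z) = V" "continuous_on circle f" by (rule V id f)+
    show "F (\<lambda>_. c) = scalar c" for c using scale[of "\<lambda>_. 1" c] one by simp
    show "F cnj = adj V"
    proof -
      have "\<Phi> (\<lambda>z. cnj z) = op_adj H (\<Phi> (\<lambda>z. z))"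
        using \<Phi> continuous_on_id[of circle] unfolding is_functional_calculus_def by blast
      moreover have "continuous_on circle cnj" by (intro continuous_intros)
      ultimately show ?thesis using F[of cnj] F[of "\<lambda>z. z"] by (simp add: op_adj_H id)
    qed
    fix g h :: "complex \<Rightarrow> complex" assume g: "continuous_on circle g" and h: "continuous_on circle h"
    have c: "continuous_on circle (\<lambda>z. g z + h z)" "continuous_on circle (\<lambda>z. g z * h z)"
      using g h by (intro continuous_intros; simp)+
    have "\<Phi> (\<lambda>z. g z + h z) = op_add H (\<Phi> g) (\<Phi> h)" "\<Phi> (\<lambda>z. g z * h z) = op_comp H (\<Phi> g) (\<Phi> h)"
      using \<Phi> g h unfolding is_functional_calculus_def by blast+
    then show "F (\<lambda>z. g z + h z) = F g + F h" "F (\<lambda>z. g z * h z) = F g * F h"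
      using F[OF g] F[OF h] F[OF c(1)] F[OF c(2)] by (simp_all add: op_add_H op_comp_H)
  next
    fix g :: "complex \<Rightarrow> complex" and K assume g: "continuous_on circle g" and K: "\<And>z. z \<in> circle \<Longrightarrow> cmod (g z) \<le> K"
    have "op_norm H (\<Phi> g) \<le> K" using \<Phi> g K unfolding is_functional_calculus_def by blast
    then show "norm (F g) \<le> K" using F[OF g] by (simp add: op_norm_H)
  qed
  then show "A = lift_op (fc V f)" using A F[OF f] by simp
qed

section \<open>Hilbert-Schmidt and trace class operators of the record\<close>

lemma standard_basis: "orthonormal_basis H (range (\<lambda>k. coord (basis_vec k)))"
  unfolding orthonormal_basis_def
proof (intro conjI ballI impI)
  fix x assume "x \<in> carrier H" and 0: "\<forall>e\<in>range (\<lambda>k. coord (basis_vec k)). cinner H x e = 0"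
  then obtain x' where x: "x = coord x'" by (elim carrierE)
  have "coord x' k = 0" for k using 0 by (auto simp: x)
  then have "x' = 0" by (intro ell2_eqI) simp
  then show "x = \<zero>\<^bsub>H\<^esub>" by (simp add: x)
next
  fix e e' assume "e \<in> range (\<lambda>k. coord (basis_vec k))" "e' \<in> range (\<lambda>k. coord (basis_vec k))"
  then obtain k k' where e: "e = coord (basis_vec k)" "e' = coord (basis_vec k')" by blast
  have "basis_vec k = basis_vec k' \<longleftrightarrow> k = k'" by (metis coord_basis_vec zero_neq_one)
  then show "cinner H e e' = (if e = e' then 1 else 0)" by (simp add: e)
qed auto

text \<open>A bound on finite parts of an arbitrary basis answers two demands:
  \<open>hilbert_schmidt\<close> quantifies over all bases, and \<open>hs_norm\<close> picks an
  unspecified one.\<close>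

lemma sum_basis_le:
  assumes "summable (\<lambda>k. (norm (A \<cdot> basis_vec k))\<^sup>2)" "orthonormal_basis H E" "finite F" "F \<subseteq> E"
  shows "(\<Sum>e\<in>F. (hnorm H (lift_op A e))\<^sup>2) \<le> (\<Sum>k. (norm (A \<cdot> basis_vec k))\<^sup>2)"
proof -
  have E: "e \<in> carrier H" "e = coord (Abs_ell2 e)" if "e \<in> E" for e
    using assms(2) that unfolding orthonormal_basis_def by (auto elim!: carrierE)
  have "(\<Sum>e\<in>F. (hnorm H (lift_op A e))\<^sup>2) = (\<Sum>e\<in>F. (norm (A \<cdot> Abs_ell2 e))\<^sup>2)"
  proof (intro sum.cong refl)
    fix e assume "e \<in> F"
    then have "lift_op A e = coord (A \<cdot> Abs_ell2 e)" using assms(4) E by (metis lift_op_coord subsetD)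
    then show "(hnorm H (lift_op A e))\<^sup>2 = (norm (A \<cdot> Abs_ell2 e))\<^sup>2" by simp
  qed
  also have "\<dots> \<le> (\<Sum>k. (norm (A \<cdot> basis_vec k))\<^sup>2)"
  proof (rule sum_norm_orthonormal_le[OF assms(1,3)])
    fix e e' assume "e \<in> F" "e' \<in> F"
    then have "e \<in> E" "e' \<in> E" using assms(4) by auto
    then have "cinner H e e' = (if e = e' then 1 else 0)" "cinner H e e' = ip (Abs_ell2 e) (Abs_ell2 e')"
      using assms(2) unfolding orthonormal_basis_def by (auto simp: ell2_hilbert_def)
    then show "ip (Abs_ell2 e) (Abs_ell2 e') = (if e = e' then 1 else 0)" by simp
  qed
  finally show ?thesis .
qed

lemma hilbert_schmidt_H:
  assumes "summable (\<lambda>k. (norm (A \<cdot> basis_vec k))\<^sup>2)"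
  shows "lift_op A \<in> hilbert_schmidt H"
  unfolding hilbert_schmidt_def
proof (intro CollectI conjI allI impI lift_op_bounded)
  fix E assume E: "orthonormal_basis H E"
  show "(\<lambda>e. (hnorm H (lift_op A e))\<^sup>2) summable_on E"
  proof (rule nonneg_bdd_above_summable_on)
    show "bdd_above (sum (\<lambda>e. (hnorm H (lift_op A e))\<^sup>2) ` {F. F \<subseteq> E \<and> finite F})"
      by (rule bdd_aboveI2[of _ _ "\<Sum>k. (norm (A \<cdot> basis_vec k))\<^sup>2"]) (auto intro: sum_basis_le[OF assms E])
  qed simp
qed

lemma hs_norm_H:
  assumes "summable (\<lambda>k. (norm (A \<cdot> basis_vec k))\<^sup>2)"
  shows "0 \<le> hs_norm H (lift_op A)" "hs_norm H (lift_op A) \<le> sqrt (\<Sum>k. (norm (A \<cdot> basis_vec k))\<^sup>2)"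
proof -
  define E where "E = (SOME E. orthonormal_basis H E)"
  have E: "orthonormal_basis H E" unfolding E_def using standard_basis by (rule someI)
  have "(\<lambda>e. (hnorm H (lift_op A e))\<^sup>2) summable_on E"
    using hilbert_schmidt_H[OF assms] E unfolding hilbert_schmidt_def by blast
  then have "(\<Sum>\<^sub>\<infinity>e\<in>E. (hnorm H (lift_op A e))\<^sup>2) \<le> (\<Sum>k. (norm (A \<cdot> basis_vec k))\<^sup>2)"
    by (rule infsum_le_finite_sums) (rule sum_basis_le[OF assms E])
  then show "hs_norm H (lift_op A) \<le> sqrt (\<Sum>k. (norm (A \<cdot> basis_vec k))\<^sup>2)"
    unfolding hs_norm_def E_def by (rule real_sqrt_le_mono)
  show "0 \<le> hs_norm H (lift_op A)"
    unfolding hs_norm_def by (intro real_sqrt_ge_zero infsum_nonneg) auto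
qed

context perturbation
begin

lemma perturbed_unitary_H: "perturbed_unitary H (lift_op Z) (lift_op U) t = lift_op (V t)"
  by (simp add: perturbed_unitary_def op_scale_H op_exp_H op_comp_H V_def X_def)

lemma G_H: "op_diff H (cfc H f (perturbed_unitary H (lift_op Z) (lift_op U) t)) (cfc H f (lift_op U)) = lift_op (G t)"
  unfolding perturbed_unitary_H cfc_H[OF unitary_V f] cfc_H[OF unitary_U f] op_diff_H G_def ..

lemma G_0: "G 0 = 0"
  by (simp add: G_def V_def X_def)

lemma has_hs_derivative_H:
  "has_hs_derivative H (\<lambda>t. op_diff H (cfc H f (perturbed_unitary H (lift_op Z) (lift_op U) t)) (cfc H f (lift_op U)))
    (lift_op D) 0"
  unfolding has_hs_derivative_def G_H
proof (intro conjI allI)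
  show "lift_op (G t) \<in> hilbert_schmidt H" for t by (rule hilbert_schmidt_H[OF G_hs])
  have Dhs: "summable (\<lambda>k. (norm (D \<cdot> basis_vec k))\<^sup>2)" unfolding D_column by (rule dcol_hs)
  then show "lift_op D \<in> hilbert_schmidt H" by (rule hilbert_schmidt_H)
  define E where "E t = scalar (of_real (1 / (t - 0))) * (G t - G 0) - D" for t
  have Ek: "E t \<cdot> basis_vec k = (1 / t) *\<^sub>R (G t \<cdot> basis_vec k) - D \<cdot> basis_vec k" for t k
    by (simp add: E_def G_0 app_diff_left scaleR_scaleC)
  \<comment> \<open>At \<open>t = 0\<close> the quotient \<open>1 / t\<close> is 0, so the
    summability extends to every \<open>t\<close>.\<close>
  have Ehs: "summable (\<lambda>k. (norm (E t \<cdot> basis_vec k))\<^sup>2)" for t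
  proof (rule summable_comparison_test')
    show "summable (\<lambda>k. 2 * ((1 / t)\<^sup>2 * (norm (G t \<cdot> basis_vec k))\<^sup>2) + 2 * (norm (D \<cdot> basis_vec k))\<^sup>2)"
      by (intro summable_add summable_mult G_hs Dhs)
    show "norm ((norm (E t \<cdot> basis_vec k))\<^sup>2) \<le> 2 * ((1 / t)\<^sup>2 * (norm (G t \<cdot> basis_vec k))\<^sup>2) + 2 * (norm (D \<cdot> basis_vec k))\<^sup>2" for k
    proof -
      let ?a = "norm ((1 / t) *\<^sub>R (G t \<cdot> basis_vec k))" and ?b = "norm (D \<cdot> basis_vec k)"
      have "norm (E t \<cdot> basis_vec k) \<le> ?a + ?b" unfolding Ek by (rule norm_triangle_ineq4)
      then have "(norm (E t \<cdot> basis_vec k))\<^sup>2 \<le> (?a + ?b)\<^sup>2" by (intro power_mono) auto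
      also have "\<dots> \<le> 2 * ?a\<^sup>2 + 2 * ?b\<^sup>2"
        using zero_le_power2[of "?a - ?b"] by (simp add: power2_eq_square algebra_simps)
      also have "?a\<^sup>2 = (1 / t)\<^sup>2 * (norm (G t \<cdot> basis_vec k))\<^sup>2" by (simp add: power_mult_distrib power_divide)
      finally show ?thesis by simp
    qed
  qed
  have "((\<lambda>t. hs_norm H (lift_op (E t))) \<longlongrightarrow> 0) (at 0)"
  proof (rule tendsto_sandwich[OF _ _ tendsto_const])
    show "\<forall>\<^sub>F t in at 0. 0 \<le> hs_norm H (lift_op (E t))" by (intro always_eventually allI hs_norm_H Ehs)
    show "\<forall>\<^sub>F t in at 0. hs_norm H (lift_op (E t)) \<le> sqrt (\<Sum>k. (norm (E t \<cdot> basis_vec k))\<^sup>2)"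
      by (intro always_eventually allI hs_norm_H Ehs)
    show "((\<lambda>t. sqrt (\<Sum>k. (norm (E t \<cdot> basis_vec k))\<^sup>2)) \<longlongrightarrow> 0) (at 0)"
      using tendsto_real_sqrt[OF hs_derivative] by (simp add: Ek)
  qed
  then show "((\<lambda>t. hs_norm H (op_diff H (op_scale H (of_real (1 / (t - 0))) (op_diff H (lift_op (G t)) (lift_op (G 0)))) (lift_op D)))
      \<longlongrightarrow> 0) (at 0)"
    unfolding op_diff_H op_scale_H E_def .
qed

end

text \<open>The bound is the trace of \<open>P\<close> in the standard basis, hence the same for all
  finite index sets. The index type is fixed by \<open>'i\<close>, as the obtained fact cannot be
  polymorphic.\<close>

lemma trace_class_H:
  assumes "lift_op A \<in> trace_class H"
  obtains c where "\<And>(I :: 'i set) x y. finite I \<Longrightarrow>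
    (\<And>i j. i \<in> I \<Longrightarrow> j \<in> I \<Longrightarrow> ip (x i) (x j) = (if i = j then 1 else 0)) \<Longrightarrow>
    (\<And>i j. i \<in> I \<Longrightarrow> j \<in> I \<Longrightarrow> ip (y i) (y j) = (if i = j then 1 else 0)) \<Longrightarrow>
    (\<Sum>i\<in>I. cmod (ip (A \<cdot> x i) (y i))) \<le> c"
proof -
  obtain P' where P': "is_op_abs H (lift_op A) P'"
    and tr: "\<And>E. orthonormal_basis H E \<Longrightarrow> (\<lambda>e. Re (cinner H (P' e) e)) summable_on E"
    using assms unfolding trace_class_def by blast
  have sa: "self_adjoint_op H P'" and pos': "\<And>x. x \<in> carrier H \<Longrightarrow> 0 \<le> Re (cinner H (P' x) x)"
    and comp: "op_comp H P' P' = op_comp H (op_adj H (lift_op A)) (lift_op A)"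
    using P' by (simp_all add: is_op_abs_def positive_op_def)
  have "P' \<in> bounded_ops H" using sa by (simp add: self_adjoint_op_def)
  then obtain P where P: "P' = lift_op P" by (rule bounded_opsE)
  have adjP: "adj P = P"
    using sa unfolding P self_adjoint_op_H .
  have pos: "0 \<le> Re (ip (P \<cdot> x) x)" for x
    using pos'[of "coord x"] by (simp add: P)
  have PA: "P * P = adj A * A"
    using comp unfolding P op_adj_H op_comp_H lift_op_inject .
  have inj: "inj (\<lambda>k. coord (basis_vec k))"
    by (rule injI) (metis coord_basis_vec coord_eq_iff zero_neq_one)
  have "(\<lambda>e. Re (cinner H (lift_op P e) e)) summable_on range (\<lambda>k. coord (basis_vec k))"
    using tr[OF standard_basis] unfolding P .
  then have "((\<lambda>e. Re (cinner H (lift_op P e) e)) \<circ> (\<lambda>k. coord (basis_vec k))) summable_on UNIV"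
    using summable_on_reindex[OF inj] by blast
  then have "(\<lambda>k. Re (ip (P \<cdot> basis_vec k) (basis_vec k))) summable_on UNIV"
    by (simp add: o_def del: ip_basis_right)
  then have "summable (\<lambda>k. Re (ip (P \<cdot> basis_vec k) (basis_vec k)))"
    by (rule summable_on_UNIV_nonneg_real_iff[THEN iffD1, rotated]) (rule pos)
  from trace_duality[OF adjP pos PA this] show thesis by (rule that)
qed

theorem theorem12:
  shows "\<exists>(f :: complex \<Rightarrow> complex) (H :: (nat \<Rightarrow> complex) hilbert) U Z D.
    C2_circle f \<and> hilbert_space H \<and> separable_hilbert H \<and>
    unitary_op H U \<and> Z \<in> hilbert_schmidt H \<and> self_adjoint_op H Z \<and>
    has_hs_derivative H
      (\<lambda>t. op_diff H (cfc H f (perturbed_unitary H Z U t)) (cfc H f U)) D 0 \<and>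
    op_diff H (op_diff H (cfc H f (perturbed_unitary H Z U 1)) (cfc H f U)) D \<notin> trace_class H"
proof -
  obtain N q T C where bl: "blocks N q T C" and
    large: "\<And>c. \<exists>(I :: ((nat \<times> nat) \<times> nat) set) x y. finite I \<and>
      (\<forall>i\<in>I. \<forall>j\<in>I. ip (x i) (x j) = (if i = j then 1 else 0)) \<and>
      (\<forall>i\<in>I. \<forall>j\<in>I. ip (y i) (y j) = (if i = j then 1 else 0)) \<and>
      c < (\<Sum>i\<in>I. cmod (ip (blocks.R N q T \<cdot> x i) (y i)))"
    by (rule block_example_exists) blast
  interpret blocks N q T C by (rule bl)
  have "lift_op R \<notin> trace_class H"
  proof
    assume "lift_op R \<in> trace_class H"
    then obtain c where c: "\<And>(I :: ((nat \<times> nat) \<times> nat) set) x y. finite I \<Longrightarrow>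
      (\<And>i j. i \<in> I \<Longrightarrow> j \<in> I \<Longrightarrow> ip (x i) (x j) = (if i = j then 1 else 0)) \<Longrightarrow>
      (\<And>i j. i \<in> I \<Longrightarrow> j \<in> I \<Longrightarrow> ip (y i) (y j) = (if i = j then 1 else 0)) \<Longrightarrow>
      (\<Sum>i\<in>I. cmod (ip (R \<cdot> x i) (y i))) \<le> c"
      by (rule trace_class_H) blast
    obtain I :: "((nat \<times> nat) \<times> nat) set" and x y where "finite I"
      "\<forall>i\<in>I. \<forall>j\<in>I. ip (x i) (x j) = (if i = j then 1 else 0)"
      "\<forall>i\<in>I. \<forall>j\<in>I. ip (y i) (y j) = (if i = j then 1 else 0)"
      "c < (\<Sum>i\<in>I. cmod (ip (R \<cdot> x i) (y i)))"
      using large[of c] by blast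
    with c[of I x y] show False by simp
  qed
  then have "op_diff H (op_diff H (cfc H circle_fun (perturbed_unitary H (lift_op Z) (lift_op U) 1))
      (cfc H circle_fun (lift_op U))) (lift_op D) \<notin> trace_class H"
    unfolding G_H op_diff_H R_def .
  then show ?thesis
    using C2_circle_fun hilbert_H separable_H unitary_op_H[OF unitary_U] hilbert_schmidt_H[OF hs]
      self_adjoint_op_H[of Z] selfadj has_hs_derivative_H by blast
qed

end
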